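(* Let $n\geq 2$, and let $\psi \in H^1_{loc}(\mathbb{R}^n;\mathbb{C}^N)$ be a solution to $$\mathcal{D}_n \psi + \mathbb{V}\psi = 0 \quad \text{in } \mathbb{R}^n,$$ where $\mathbb{V}:\mathbb{R}^n\to\mathbb{C}^{N\times N}$ is such that, for some $-\infty<\epsilon<1$ and some $\rho, C>0$, $$|\mathbb{V}(x)|\leq C|x|^{-\epsilon}\quad\text{for all } |x|>\rho.$$ Then there exists $\tau_0>0$ such that, if for all $\tau>\tau_0$ $$e^{\tau|x|^{2-2\epsilon}}\psi\in L^2(\{|x|>\rho\};\mathbb{C}^N),$$ then $\psi$ has compact support.
   Context: For $n\geq 2$ let $N:=2^{\lfloor (n+1)/2\rfloor}$. Let $\alpha_1,\dots,\alpha_n,\alpha_{n+1}\in\mathbb{C}^{N\times N}$ be Hermitian matrices satisfying the anticommutation relations $\alpha_j\alpha_k+\alpha_k\alpha_j=2\delta_{j,k}\mathbb{I}_N$ for $1\leq j,k\leq n+1$, where $\delta_{j,k}$ is the Kronecker delta and $\mathbb{I}_N$ is the $N\times N$ identity matrix (such matrices exist). The massless Dirac operator acts on functions $\psi:\mathbb{R}^n\to\mathbb{C}^N$ by $$\mathcal{D}_n\psi:=-i\sum_{j=1}^n\alpha_j\,\partial_j\psi.$$ The (measurable) matrix-valued function $\mathbb{V}$ is not assumed to be Hermitian; $|\mathbb{V}(x)|$ denotes a matrix norm of $\mathbb{V}(x)$ (e.g. the operator norm). *)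

theory Defs
  imports "HOL-Analysis.Analysis"
begin

subsection \<open>Square integrability\<close>

text \<open>All functions are Lebesgue measurable representatives of their almost-everywhere classes.\<close>

definition L2_on :: "('a::euclidean_space) set \<Rightarrow> ('a \<Rightarrow> 'b::euclidean_space) \<Rightarrow> bool" where
  "L2_on S f \<longleftrightarrow> f \<in> borel_measurable (lebesgue_on S)
      \<and> integrable (lebesgue_on S) (\<lambda>x. (norm (f x))\<^sup>2)"

definition L2_loc :: "('a::euclidean_space \<Rightarrow> 'b::euclidean_space) \<Rightarrow> bool" where
  "L2_loc f \<longleftrightarrow> (\<forall>K. compact K \<longrightarrow> L2_on K f)"

subsection \<open>Weak derivatives and the local Sobolev space\<close>

primrec C_times :: "nat \<Rightarrow> (real^'n \<Rightarrow> real) \<Rightarrow> bool" where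
  "C_times 0 \<phi> \<longleftrightarrow> continuous_on UNIV \<phi>"
| "C_times (Suc k) \<phi> \<longleftrightarrow> (\<exists>\<phi>'. (\<forall>x. (\<phi> has_derivative \<phi>' x) (at x))
      \<and> (\<forall>v. C_times k (\<lambda>x. \<phi>' x v)))"

text \<open>Real-valued test functions suffice to define weak derivatives of vector-valued functions:
  complex-valued ones split into real and imaginary parts.\<close>

definition test_function :: "(real^'n \<Rightarrow> real) \<Rightarrow> bool" where
  "test_function \<phi> \<longleftrightarrow> (\<forall>k. C_times k \<phi>) \<and> compact (closure {x. \<phi> x \<noteq> 0})"

definition has_weak_partial ::
    "(real^'n \<Rightarrow> 'b::euclidean_space) \<Rightarrow> 'n \<Rightarrow> (real^'n \<Rightarrow> 'b) \<Rightarrow> bool" where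
  "has_weak_partial f j g \<longleftrightarrow> L2_loc f \<and> L2_loc g \<and>
     (\<forall>\<phi>. test_function \<phi> \<longrightarrow>
        (\<integral>x. frechet_derivative \<phi> (at x) (axis j 1) *\<^sub>R f x \<partial>lebesgue)
          = - (\<integral>x. \<phi> x *\<^sub>R g x \<partial>lebesgue))"

definition H1_loc :: "(real^'n \<Rightarrow> 'b::euclidean_space) \<Rightarrow> bool" where
  "H1_loc f \<longleftrightarrow> L2_loc f \<and> (\<forall>j. \<exists>g. has_weak_partial f j g)"

text \<open>For \<^term>\<open>f\<close> in the local Sobolev space this picks a representative of the weak partial
  derivative, which is unique up to a null set.\<close>

definition weak_partial ::
    "'n \<Rightarrow> (real^'n \<Rightarrow> 'b::euclidean_space) \<Rightarrow> real^'n \<Rightarrow> 'b" where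
  "weak_partial j f = (SOME g. has_weak_partial f j g)"

subsection \<open>The Dirac operator\<close>

text \<open>The $n+1$ matrices are indexed by \<^typ>\<open>'n option\<close>: \<^term>\<open>Some j\<close> stands for the
  space directions and \<^term>\<open>None\<close> for the index $n+1$.\<close>

definition dirac_matrices :: "('n::finite option \<Rightarrow> complex^'m^'m) \<Rightarrow> bool" where
  "dirac_matrices \<alpha> \<longleftrightarrow>
     (\<forall>j a b. \<alpha> j $ a $ b = cnj (\<alpha> j $ b $ a)) \<and>
     (\<forall>j k. \<alpha> j ** \<alpha> k + \<alpha> k ** \<alpha> j = mat (if j = k then 2 else 0))"

definition dirac ::
    "('n::finite option \<Rightarrow> complex^'m^'m) \<Rightarrow> (real^'n \<Rightarrow> complex^'m) \<Rightarrow> real^'n \<Rightarrow> complex^'m" where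
  "dirac \<alpha> \<psi> x = (- \<i>) *s (\<Sum>j\<in>UNIV. \<alpha> (Some j) *v weak_partial j \<psi> x)"

subsection \<open>Support\<close>

text \<open>The support of an almost-everywhere class: the complement of the largest open set on which
  \<^term>\<open>f\<close> vanishes almost everywhere.\<close>

definition ess_support :: "('a::euclidean_space \<Rightarrow> 'b::zero) \<Rightarrow> 'a set" where
  "ess_support f = - \<Union>{U. open U \<and> (AE x in lebesgue. x \<in> U \<longrightarrow> f x = 0)}"

end

(* Write X for Clifford multiplication by x, P for the sum of A_j d_j, E = x . grad for the Euler
   field, q = |x|^2 and n for the dimension. Then G = X P - E is the angular part of the Dirac
   operator: it is formally symmetric and commutes with E and with radial functions. For a radial
   weight w = Omega u with Omega = exp (tau q^gamma) q^(-n/4), gamma = 1 - epsilon, the conjugated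
   operator is (E + n/2) + (G - s) with s = 2 tau gamma q^gamma. The first summand is antisymmetric
   and the second one symmetric, and their commutator is E s = 4 tau gamma^2 q^gamma > 0. This gives
   the Carleman estimate
     4 tau gamma^2 int q^gamma Omega^2 |u|^2 <= int Omega^2 |X P u|^2,
   whose left-hand side absorbs the potential, since |X V u|^2 <= C^2 q^gamma |u|^2, once tau is large.
   Applied to cutoffs of psi, the decay hypothesis removes the outer cutoff, and tau -> infinity
   shows that psi vanishes outside a ball. *)
theory Submission
  imports Defs "HOL-Computational_Algebra.Polynomial"
begin

subsection \<open>Smooth mollifiers\<close>

text \<open>The exponent 2 - 2 epsilon reflects a balance: multiplied by X, a potential of size
  |x|^(-epsilon) grows like |x|^gamma, and its square has the order of the commutator. The factor
  q^(-n/4) in Omega compensates the n/2 that makes E antisymmetric, so that conjugation leaves no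
  error except the one from the derivative of the cutoff. The obstacle is regularity: the commutator
  involves second derivatives, while psi has one weak derivative. The estimate is therefore proved
  for functions with continuous second derivatives and transferred by mollification; in the limit
  only psi and its weak gradient appear. Weight and cutoff form a single radial factor theta, which
  is never mollified. It vanishes near the origin, hiding the singularity of q^gamma there, and
  outside a ball, so that integration by parts has no boundary terms; C^1 regularity is enough for
  it. The potential is controlled only outside the ball of radius rho, so the inner cutoff leaves an
  error that does not go away. It is beaten because it sits at smaller radii, where the weight is
  exponentially smaller in tau.\<close>

definition flat :: "real poly \<Rightarrow> real \<Rightarrow> real" where
  "flat p t = (if t > 0 then poly p (1 / t) * exp (- 1 / t) else 0)"

text \<open>The derivative of p(1/t) exp(-1/t) is r(1/t) exp(-1/t) with r(y) = y^2 (p(y) - p'(y)).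
  So the functions \<open>flat p\<close> are closed under differentiation, and iterating
  \<open>flat_step\<close> lists all derivatives explicitly.\<close>

definition flat_step :: "real poly \<Rightarrow> real poly" where
  "flat_step p = [:0, 0, 1:] * (p - pderiv p)"

lemma poly_times_exp_minus_tendsto_0: "((\<lambda>y. poly p y * exp (- y)) \<longlongrightarrow> (0::real)) at_top"
proof -
  have "((\<lambda>y. \<Sum>i\<le>degree p. coeff p i * (y ^ i / exp y)) \<longlongrightarrow> (\<Sum>i\<le>degree p. coeff p i * 0)) at_top"
    by (intro tendsto_sum tendsto_mult tendsto_const tendsto_power_div_exp_0)
  then show ?thesis
    by (simp add: poly_altdef sum_distrib_right exp_minus divide_inverse mult.assoc)
qed

lemma flat_has_derivative: "(flat p has_real_derivative flat (flat_step p) t) (at t)"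
proof -
  consider "t > 0" | "t < 0" | "t = 0" by linarith
  then show ?thesis
  proof cases
    case 1
    have "((\<lambda>t. poly p (1 / t) * exp (- 1 / t)) has_real_derivative flat (flat_step p) t) (at t)"
      using 1 by (auto intro!: derivative_eq_intros DERIV_chain'[where g = "poly p"] poly_DERIV
          simp: flat_def flat_step_def field_simps power2_eq_square)
    then show ?thesis
      by (rule DERIV_cong_ev[THEN iffD1, rotated -1])
        (use 1 in \<open>auto simp: flat_def intro: eventually_mono[OF eventually_nhds_in_open[of "{0<..}"]]\<close>)
  next
    case 2
    have "((\<lambda>t. 0) has_real_derivative flat (flat_step p) t) (at t)"
      using 2 by (auto simp: flat_def)
    then show ?thesis
      by (rule DERIV_cong_ev[THEN iffD1, rotated -1])
        (use 2 in \<open>auto simp: flat_def intro: eventually_mono[OF eventually_nhds_in_open[of "{..<0}"]]\<close>)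
  next
    case 3
    have l: "((\<lambda>h. (flat p h - flat p 0) / h) \<longlongrightarrow> 0) (at_left 0)"
      by (rule tendsto_eventually)
        (auto simp: flat_def eventually_at_filter)
    \<comment> \<open>Division by h multiplies the polynomial by the variable 1/h, hence
      \<open>pCons 0 p\<close>; exponential decay makes the right-hand derivative at 0
      vanish.\<close>
    have "((\<lambda>h. poly (pCons 0 p) (inverse h) * exp (- inverse h)) \<longlongrightarrow> 0) (at_right 0)"
      using poly_times_exp_minus_tendsto_0 filterlim_inverse_at_top_right
      by (rule filterlim_compose)
    then have r: "((\<lambda>h. (flat p h - flat p 0) / h) \<longlongrightarrow> 0) (at_right 0)"
      by (rule Lim_transform_eventually)
        (auto simp: flat_def eventually_at_filter field_simps)
    show ?thesis
      using l r 3 by (simp add: has_field_derivative_iff filterlim_split_at flat_def)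
  qed
qed

text \<open>Pascal's rule for derivatives given as sequences: every higher derivative of the product
  becomes an explicit function whose support can be read off.\<close>

lemma Leibniz_rule_sequences:
  fixes u v :: "nat \<Rightarrow> real \<Rightarrow> real"
  assumes u: "\<And>i. (u i has_real_derivative u (Suc i) t) (at t)"
    and v: "\<And>i. (v i has_real_derivative v (Suc i) t) (at t)"
  shows "((\<lambda>t. \<Sum>i\<le>m. real (m choose i) * u i t * v (m - i) t) has_real_derivative
     (\<Sum>i\<le>Suc m. real (Suc m choose i) * u i t * v (Suc m - i) t)) (at t)"
proof -
  have "(\<Sum>i\<le>Suc m. real (Suc m choose i) * u i t * v (Suc m - i) t)
     = u 0 t * v (Suc m) t + (\<Sum>i\<le>m. real (Suc m choose Suc i) * u (Suc i) t * v (m - i) t)"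
    by (subst sum.atMost_Suc_shift) simp
  also have "\<dots> = (\<Sum>i\<le>m. real (m choose i) * u (Suc i) t * v (m - i) t)
     + (u 0 t * v (Suc m) t + (\<Sum>i\<le>m. real (m choose Suc i) * u (Suc i) t * v (m - i) t))"
    by (simp add: sum.distrib distrib_right)
  also have "u 0 t * v (Suc m) t + (\<Sum>i\<le>m. real (m choose Suc i) * u (Suc i) t * v (m - i) t)
     = (\<Sum>i\<le>Suc m. real (m choose i) * u i t * v (Suc m - i) t)"
    by (subst sum.atMost_Suc_shift) simp
  also have "\<dots> = (\<Sum>i\<le>m. real (m choose i) * u i t * v (Suc (m - i)) t)"
    by (auto intro!: sum.cong simp: Suc_diff_le)
  finally have eq: "(\<Sum>i\<le>Suc m. real (Suc m choose i) * u i t * v (Suc m - i) t)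
     = (\<Sum>i\<le>m. real (m choose i) * u (Suc i) t * v (m - i) t + real (m choose i) * u i t * v (Suc (m - i)) t)"
    by (simp add: sum.distrib)
  show ?thesis
    unfolding eq
    by (auto intro!: derivative_eq_intros u v sum.cong)
qed

text \<open>The function is exp(-1/(r+t)) exp(-1/(r-t)) on |t| < r. All its derivatives are supplied
  along with it, because the partial derivatives of a product over coordinates are assembled from
  them.\<close>

lemma smooth_bump_real:
  assumes "r > 0"
  obtains b :: "nat \<Rightarrow> real \<Rightarrow> real" where
    "\<And>m t. (b m has_real_derivative b (Suc m) t) (at t)"
    "\<And>t. b 0 t \<ge> 0" "b 0 0 > 0" "\<And>m t. \<bar>t\<bar> \<ge> r \<Longrightarrow> b m t = 0"
proof -
  define u where "u i t = flat ((flat_step ^^ i) 1) (r + t)" for i :: nat and t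
  define v where "v i t = (-1) ^ i * flat ((flat_step ^^ i) 1) (r - t)" for i :: nat and t
  define b where "b m t = (\<Sum>i\<le>m. real (m choose i) * u i t * v (m - i) t)" for m t
  show thesis
  proof
    have u: "(u i has_real_derivative u (Suc i) t) (at t)" for i t
      unfolding u_def
      using DERIV_chain'[OF DERIV_add[OF DERIV_const DERIV_ident] flat_has_derivative] by simp
    have v: "(v i has_real_derivative v (Suc i) t) (at t)" for i t
      unfolding v_def
      by (rule derivative_eq_intros DERIV_chain2[OF flat_has_derivative] refl | simp)+
    show "(b m has_real_derivative b (Suc m) t) (at t)" for m t
      unfolding b_def by (rule Leibniz_rule_sequences) (rule u v)+
    show "b 0 t \<ge> 0" for t
      by (simp add: b_def u_def v_def flat_def)
    show "b 0 0 > 0"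
      using assms by (simp add: b_def u_def v_def flat_def)
    show "b m t = 0" if "\<bar>t\<bar> \<ge> r" for m t
      using that by (auto simp: b_def u_def v_def flat_def intro!: sum.neutral)
  qed
qed

text \<open>The multi-index \<open>m\<close> counts derivatives per coordinate. Increments of a
  multi-index commute, so the symmetry of mixed partial derivatives is built into the notation; the
  commutator computation relies on it later.\<close>

definition tensor_prod :: "('n::finite \<Rightarrow> nat \<Rightarrow> real \<Rightarrow> real) \<Rightarrow> ('n \<Rightarrow> nat) \<Rightarrow> real^'n \<Rightarrow> real" where
  "tensor_prod B m x = (\<Prod>i\<in>UNIV. B i (m i) (x $ i))"

lemma tensor_prod_has_derivative:
  assumes "\<And>i m t. (B i m has_real_derivative B i (Suc m) t) (at t)"
  shows "(tensor_prod B m has_derivative (\<lambda>h. \<Sum>j\<in>UNIV. h $ j * tensor_prod B (m(j := Suc (m j))) x)) (at x)"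
proof -
  have 1: "((\<lambda>x. B i (m i) (x $ i)) has_derivative (\<lambda>h. h $ i * B i (Suc (m i)) (x $ i))) (at x)" for i
    by (rule has_derivative_eq_rhs[OF has_derivative_compose[OF
            bounded_linear_imp_has_derivative[OF bounded_linear_vec_nth]
            assms[unfolded has_field_derivative_def]]])
      (simp add: mult.commute)
  have "(tensor_prod B m has_derivative (\<lambda>h. \<Sum>j\<in>UNIV. h $ j * B j (Suc (m j)) (x $ j) * (\<Prod>i\<in>UNIV - {j}. B i (m i) (x $ i)))) (at x)"
    unfolding tensor_prod_def[abs_def]
    by (rule has_derivative_prod) (rule 1)
  moreover have "B j (Suc (m j)) (x $ j) * (\<Prod>i\<in>UNIV - {j}. B i (m i) (x $ i)) = tensor_prod B (m(j := Suc (m j))) x" for j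
    unfolding tensor_prod_def by (subst prod.remove[of _ j]) (auto intro!: prod.cong)
  ultimately show ?thesis by (simp add: mult.assoc)
qed

lemma C_times_lincomb:
  assumes "finite J" "\<And>j. j \<in> J \<Longrightarrow> C_times k (f j)"
  shows "C_times k (\<lambda>x. \<Sum>j\<in>J. c j * f j x)"
  using assms(2)
proof (induction k arbitrary: f c)
  case 0
  then show ?case by (auto intro!: continuous_intros)
next
  case (Suc k)
  then have "\<exists>\<phi>'. \<forall>j\<in>J. (\<forall>x. (f j has_derivative \<phi>' j x) (at x)) \<and> (\<forall>v. C_times k (\<lambda>x. \<phi>' j x v))"
    by (intro bchoice) simp
  then obtain \<phi>' where d: "\<And>j x. j \<in> J \<Longrightarrow> (f j has_derivative \<phi>' j x) (at x)"
    and c: "\<And>j v. j \<in> J \<Longrightarrow> C_times k (\<lambda>x. \<phi>' j x v)" by metis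
  show ?case
    unfolding C_times.simps
  proof (intro exI[of _ "\<lambda>x v. \<Sum>j\<in>J. c j * \<phi>' j x v"] conjI allI)
    show "((\<lambda>x. \<Sum>j\<in>J. c j * f j x) has_derivative (\<lambda>v. \<Sum>j\<in>J. c j * \<phi>' j x v)) (at x)" for x
      by (auto intro!: derivative_eq_intros d)
    show "C_times k (\<lambda>x. \<Sum>j\<in>J. c j * \<phi>' j x v)" for v
      by (rule Suc.IH) (rule c)
  qed
qed

text \<open>\<open>C_times\<close> asks for every directional derivative, which is a linear
  combination of partial ones. Induction on the order, for all members of the family at once, then
  needs only closure under linear combinations.\<close>

lemma C_times_derivative_family:
  fixes F :: "('n::finite \<Rightarrow> nat) \<Rightarrow> real^'n \<Rightarrow> real"
  assumes "\<And>m x. (F m has_derivative (\<lambda>h. \<Sum>j\<in>UNIV. h $ j * F (m(j := Suc (m j))) x)) (at x)"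
  shows "C_times k (F m)"
proof (induction k arbitrary: m)
  case 0
  have "continuous_on UNIV (F m)"
    by (rule has_derivative_continuous_on, rule has_derivative_at_withinI, rule assms)
  then show ?case by simp
next
  case (Suc k)
  show ?case
    unfolding C_times.simps
    by (intro exI[of _ "\<lambda>x h. \<Sum>j\<in>UNIV. h $ j * F (m(j := Suc (m j))) x"] conjI allI assms C_times_lincomb Suc)
      simp
qed

text \<open>\<open>\<eta>\<close> is a kernel together with all its partial derivatives. The kernel
  itself is \<open>\<eta> (\<lambda>_. 0)\<close>, and the conditions on sign and mass concern this
  member alone.\<close>

locale mollifier =
  fixes \<eta> :: "('n::finite \<Rightarrow> nat) \<Rightarrow> real^'n \<Rightarrow> real" and r :: real
  assumes r_pos: "r > 0"
    and deriv: "\<And>m x. (\<eta> m has_derivative (\<lambda>h. \<Sum>j\<in>UNIV. h $ j * \<eta> (m(j := Suc (m j))) x)) (at x)"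
    and support: "\<And>m x. norm x \<ge> r \<Longrightarrow> \<eta> m x = 0"
    and nonneg: "\<And>x. \<eta> (\<lambda>_. 0) x \<ge> 0"
    and integral_1: "(\<integral>x. \<eta> (\<lambda>_. 0) x \<partial>lborel) = 1"
begin

lemma continuous_on_mollifier: "continuous_on S (\<eta> m)"
  by (rule has_derivative_continuous_on, rule has_derivative_at_withinI, rule deriv)

lemma borel_measurable_mollifier [measurable]: "\<eta> m \<in> borel_measurable borel"
  by (intro borel_measurable_continuous_onI continuous_on_mollifier)

lemma reflected_deriv:
  "((\<lambda>y. \<eta> m (x - y)) has_derivative (\<lambda>h. \<Sum>j\<in>UNIV. h $ j * - \<eta> (m(j := Suc (m j))) (x - y))) (at y)"
  by (rule has_derivative_eq_rhs[OF has_derivative_compose[OF _ deriv, where f = "\<lambda>y. x - y"]])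
    (auto intro!: derivative_eq_intros simp: sum_negf)

lemma test_function_reflected: "test_function (\<lambda>y. \<eta> m (x - y))"
  unfolding test_function_def
proof
  \<comment> \<open>Each derivative of the reflected kernel brings a sign. With (-1)^|m| attached to
    member \<open>m\<close> the family is again closed under differentiation; multiplying by the
    same sign once more removes it.\<close>
  define F where "F m y = (-1) ^ (\<Sum>i\<in>UNIV. m i) * \<eta> m (x - y)" for m y
  have s: "(\<Sum>i\<in>UNIV. (m(j := Suc (m j))) i) = Suc (\<Sum>i\<in>UNIV. m i)" for m :: "'n \<Rightarrow> nat" and j
    by (simp add: sum.remove[of UNIV j] cong: sum.cong) (auto intro!: sum.cong)
  have "(F m has_derivative (\<lambda>h. \<Sum>j\<in>UNIV. h $ j * F (m(j := Suc (m j))) y)) (at y)" for m y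
    unfolding F_def s
    by (rule has_derivative_eq_rhs[OF has_derivative_mult_right[OF reflected_deriv]])
      (simp add: sum_distrib_left algebra_simps)
  then have C: "C_times k (F m)" for k m by (rule C_times_derivative_family)
  have "C_times k (\<lambda>y. \<Sum>j\<in>{()}. (-1) ^ (\<Sum>i\<in>UNIV. m i) * F m y)" for k
    by (intro C_times_lincomb C) simp
  then show "\<forall>k. C_times k (\<lambda>y. \<eta> m (x - y))"
    by (simp add: F_def flip: power_add mult_2 mult.assoc)
  have "closure {y. \<eta> m (x - y) \<noteq> 0} \<subseteq> cball x r"
    by (rule closure_minimal) (auto simp: dist_norm intro: less_imp_le not_le_imp_less support)
  then show "compact (closure {y. \<eta> m (x - y) \<noteq> 0})"
    using compact_cball bounded_subset compact_eq_bounded_closed by blast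
qed

end

lemma mollifier_exists:
  assumes "r > 0"
  obtains \<eta> :: "('n::finite \<Rightarrow> nat) \<Rightarrow> real^'n \<Rightarrow> real" where "mollifier \<eta> r"
proof -
  \<comment> \<open>A vector of Euclidean norm at least \<open>r\<close> has l1 norm at least
    \<open>r\<close>, hence a coordinate of modulus at least \<open>d\<close>. So the product of
    bumps of radius \<open>d\<close> is supported in the ball of radius \<open>r\<close>.\<close>
  define d where "d = r / real CARD('n)"
  have "d > 0" using assms by (simp add: d_def)
  then obtain b :: "nat \<Rightarrow> real \<Rightarrow> real" where
    b: "\<And>m t. (b m has_real_derivative b (Suc m) t) (at t)"
    "\<And>t. b 0 t \<ge> 0" "b 0 0 > 0" "\<And>m t. \<bar>t\<bar> \<ge> d \<Longrightarrow> b m t = 0"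
    using smooth_bump_real[of d] by metis
  define \<theta> :: "('n \<Rightarrow> nat) \<Rightarrow> real^'n \<Rightarrow> real" where "\<theta> = tensor_prod (\<lambda>_. b)"
  have deriv: "(\<theta> m has_derivative (\<lambda>h. \<Sum>j\<in>UNIV. h $ j * \<theta> (m(j := Suc (m j))) x)) (at x)" for m x
    unfolding \<theta>_def by (rule tensor_prod_has_derivative) (rule b)
  have supp: "\<theta> m x = 0" if "norm x \<ge> r" for m x
  proof -
    have "\<exists>i. \<bar>x $ i\<bar> \<ge> d"
    proof (rule ccontr)
      assume "\<not> (\<exists>i. \<bar>x $ i\<bar> \<ge> d)"
      then have "(\<Sum>i\<in>UNIV. \<bar>x $ i\<bar>) < (\<Sum>i\<in>(UNIV::'n set). d)"
        by (intro sum_strict_mono) (auto simp: not_le)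
      also have "\<dots> = r" by (simp add: d_def)
      finally show False using norm_le_l1_cart[of x] that by linarith
    qed
    then show ?thesis using b(4) by (auto simp: \<theta>_def tensor_prod_def)
  qed
  have nonneg: "\<theta> (\<lambda>_. 0) x \<ge> 0" for x
    by (auto simp: \<theta>_def tensor_prod_def intro!: prod_nonneg b)
  have cont: "continuous_on UNIV (\<theta> m)" for m
    by (rule has_derivative_continuous_on, rule has_derivative_at_withinI, rule deriv)
  have supp': "(\<lambda>x. indicator (cball 0 r) x *\<^sub>R \<theta> m x) = \<theta> m" for m
    using supp by (auto simp: indicator_def fun_eq_iff)
  have int: "integrable lborel (\<theta> m)" for m
    using borel_integrable_compact[of "cball 0 r" "\<theta> m"] continuous_on_subset[OF cont, of "cball 0 r" m]
    by (simp add: supp' mult_ac[of "\<theta> m _"] flip: real_scaleR_def)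
  define Z where "Z = (\<integral>x. \<theta> (\<lambda>_. 0) x \<partial>lborel)"
  \<comment> \<open>A continuous nonnegative function with integral 0 vanishes off a negligible set.
    The set where it is positive is open, hence empty, although it contains the origin.\<close>
  have "Z \<noteq> 0"
  proof
    assume "Z = 0"
    have op: "open {x. \<theta> (\<lambda>_. 0) x \<noteq> 0}"
      using cont[of "\<lambda>_. 0"] by (intro open_Collect_neq continuous_intros) auto
    from \<open>Z = 0\<close> have "AE x in lborel. \<theta> (\<lambda>_. 0) x = 0"
      using integral_nonneg_eq_0_iff_AE[OF int] nonneg by (simp add: Z_def)
    then have "AE x in lebesgue. \<not> \<theta> (\<lambda>_. 0) x \<noteq> 0"
      by (simp add: AE_completion)
    then have "negligible {x. \<theta> (\<lambda>_. 0) x \<noteq> 0}"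
      using op by (subst negligible_iff_null_sets, subst AE_iff_null_sets) auto
    with op have "{x. \<theta> (\<lambda>_. 0) x \<noteq> 0} = {}"
      using open_not_negligible by blast
    moreover have "\<theta> (\<lambda>_. 0) 0 \<noteq> 0" using b(3) by (simp add: \<theta>_def tensor_prod_def)
    ultimately show False by blast
  qed
  moreover have "Z \<ge> 0" unfolding Z_def by (simp add: nonneg)
  ultimately have "Z > 0" by simp
  have "mollifier (\<lambda>m x. \<theta> m x / Z) r"
  proof
    show "((\<lambda>x. \<theta> m x / Z) has_derivative (\<lambda>h. \<Sum>j\<in>UNIV. h $ j * (\<theta> (m(j := Suc (m j))) x / Z))) (at x)" for m x
      using has_derivative_divide'[OF deriv has_derivative_const, of Z m x] \<open>Z > 0\<close>
      by (simp add: sum_divide_distrib field_simps power2_eq_square)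
    show "(\<integral>x. \<theta> (\<lambda>_. 0) x / Z \<partial>lborel) = 1" using \<open>Z > 0\<close> by (simp add: Z_def)
  qed (use assms supp nonneg \<open>Z > 0\<close> in auto)
  then show thesis ..
qed

subsection \<open>Mollification in \<open>L\<^sup>2\<close>\<close>

lemma lborel_reflect: "lborel = distr lborel borel (\<lambda>y. x - y)" for x :: "'a::euclidean_space"
  by (subst lborel_affine[of "-1" x]) (simp_all add: density_1)

lemma integral_lborel_reflect:
  fixes x :: "'a::euclidean_space" and f :: "'a \<Rightarrow> 'b::{banach, second_countable_topology}"
  assumes [measurable]: "f \<in> borel_measurable borel"
  shows "(\<integral>y. f (x - y) \<partial>lborel) = (\<integral>y. f y \<partial>lborel)"
  by (subst (2) lborel_reflect[of x]) (simp add: integral_distr)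

lemma integrable_lborel_reflect:
  fixes x :: "'a::euclidean_space" and f :: "'a \<Rightarrow> 'b::{banach, second_countable_topology}"
  assumes "integrable lborel f"
  shows "integrable lborel (\<lambda>y. f (x - y))"
proof -
  have "integrable (distr lborel borel (\<lambda>y. x - y)) f"
    using assms by (simp flip: lborel_reflect)
  then show ?thesis by (subst (asm) integrable_distr_eq) (use assms in auto)
qed

text \<open>The counterpart of \<open>L2_loc\<close> for Borel functions and \<open>lborel\<close>,
  where convolutions and the exchange of iterated integrals are at home. The completed measure is
  left as soon as representatives have been chosen.\<close>

definition loc_L2 :: "('a::euclidean_space \<Rightarrow> 'b::euclidean_space) \<Rightarrow> bool" where
  "loc_L2 f \<longleftrightarrow> f \<in> borel_measurable borel
     \<and> (\<forall>R. integrable lborel (\<lambda>x. indicator (cball 0 R) x * (norm (f x))\<^sup>2))"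

lemma loc_L2_measurable [measurable_dest]: "loc_L2 f \<Longrightarrow> f \<in> borel_measurable borel"
  by (simp add: loc_L2_def)

lemma loc_L2_integrable: "loc_L2 f \<Longrightarrow> integrable lborel (\<lambda>x. indicator (cball 0 R) x * (norm (f x))\<^sup>2)"
  by (simp add: loc_L2_def)

lemma cball_sets_borel [measurable]: "cball a R \<in> sets borel"
  by simp

lemma integrable_indicator_cball: "integrable lborel (indicator (cball a R) :: 'a::euclidean_space \<Rightarrow> real)"
  by (rule integrable_real_indicator) (use emeasure_lborel_cball_finite in auto)

lemma le_1_plus_square: "t \<le> 1 + t\<^sup>2" for t :: real
  using zero_le_power2[of "t - 1 / 2"] by (simp add: power2_eq_square algebra_simps)

lemma norm_add_square_le: "(norm (a + b))\<^sup>2 \<le> 2 * (norm a)\<^sup>2 + 2 * (norm b)\<^sup>2" for a b :: "'a::real_inner"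
  using inner_ge_zero[of "a - b"] by (simp add: power2_norm_eq_inner algebra_simps inner_commute)

lemma norm_diff_square_le: "(norm (a - b))\<^sup>2 \<le> 2 * (norm a)\<^sup>2 + 2 * (norm b)\<^sup>2" for a b :: "'a::real_inner"
  using norm_add_square_le[of a "- b"] by simp

lemma loc_L2_loc_integrable:
  assumes "loc_L2 f"
  shows "integrable lborel (\<lambda>x. indicator (cball 0 R) x *\<^sub>R f x)"
proof (rule Bochner_Integration.integrable_bound)
  have [measurable]: "f \<in> borel_measurable borel" using assms by (rule loc_L2_measurable)
  show "integrable lborel (\<lambda>x. indicator (cball 0 R) x + indicator (cball 0 R) x * (norm (f x))\<^sup>2)"
    using assms by (intro Bochner_Integration.integrable_add loc_L2_integrable integrable_indicator_cball)
  show "(\<lambda>x. indicator (cball 0 R) x *\<^sub>R f x) \<in> borel_measurable lborel"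
    by measurable
  show "AE x in lborel. norm (indicator (cball 0 R) x *\<^sub>R f x)
      \<le> norm (indicator (cball 0 R) x + indicator (cball 0 R) x * (norm (f x))\<^sup>2)"
    using le_1_plus_square by (auto simp: indicator_def)
qed

lemma continuous_loc_L2:
  assumes "continuous_on UNIV f"
  shows "loc_L2 f"
  unfolding loc_L2_def
proof (intro conjI allI)
  show "f \<in> borel_measurable borel" by (rule borel_measurable_continuous_onI[OF assms])
  fix R
  have "continuous_on (cball 0 R) (\<lambda>x. (norm (f x))\<^sup>2)"
    by (intro continuous_intros continuous_on_subset[OF assms]) auto
  from borel_integrable_compact[OF _ this]
  show "integrable lborel (\<lambda>x. indicator (cball 0 R) x * (norm (f x))\<^sup>2)"
    by (simp add: mult.commute)
qed

lemma loc_L2_diff: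
  assumes f: "loc_L2 f" and g: "loc_L2 g"
  shows "loc_L2 (\<lambda>x. f x - g x)"
  unfolding loc_L2_def
proof (intro conjI allI)
  have [measurable]: "f \<in> borel_measurable borel" "g \<in> borel_measurable borel"
    using f g by (auto intro: loc_L2_measurable)
  show "(\<lambda>x. f x - g x) \<in> borel_measurable borel" by measurable
  fix R
  show "integrable lborel (\<lambda>x. indicator (cball 0 R) x * (norm (f x - g x))\<^sup>2)"
  proof (rule Bochner_Integration.integrable_bound)
    show "integrable lborel (\<lambda>x. 2 * (indicator (cball 0 R) x * (norm (f x))\<^sup>2) + 2 * (indicator (cball 0 R) x * (norm (g x))\<^sup>2))"
      using f g by (intro Bochner_Integration.integrable_add integrable_mult_right loc_L2_integrable)
    show "AE x in lborel. norm (indicator (cball 0 R) x * (norm (f x - g x))\<^sup>2)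
      \<le> norm (2 * (indicator (cball 0 R) x * (norm (f x))\<^sup>2) + 2 * (indicator (cball 0 R) x * (norm (g x))\<^sup>2))"
      using norm_diff_square_le by (auto simp: indicator_def)
  qed measurable
qed


definition conv :: "('a::euclidean_space \<Rightarrow> real) \<Rightarrow> ('a \<Rightarrow> 'b::euclidean_space) \<Rightarrow> 'a \<Rightarrow> 'b" where
  "conv k f x = (\<integral>y. k (x - y) *\<^sub>R f y \<partial>lborel)"

context mollifier
begin

lemma mollifier_bounded: "\<exists>M. \<forall>x. \<bar>\<eta> m x\<bar> \<le> M"
proof -
  have "bounded (\<eta> m ` cball 0 r)"
    by (intro compact_imp_bounded compact_continuous_image continuous_on_mollifier) auto
  then obtain M where "M > 0" "\<forall>x\<in>cball 0 r. \<bar>\<eta> m x\<bar> \<le> M" by (auto simp: bounded_pos)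
  then have "\<bar>\<eta> m x\<bar> \<le> M" for x using support[of x m] by (cases "norm x \<le> r") auto
  then show ?thesis by blast
qed

lemma mollifier_uniformly_continuous: "uniformly_continuous_on UNIV (\<eta> m)"
  unfolding uniformly_continuous_on_def
proof (intro allI impI)
  fix e :: real assume "e > 0"
  have "uniformly_continuous_on (cball 0 (r + 1)) (\<eta> m)"
    by (intro compact_uniformly_continuous continuous_on_mollifier) auto
  then obtain d where d: "d > 0" "\<And>x y. norm x \<le> r + 1 \<Longrightarrow> norm y \<le> r + 1 \<Longrightarrow> dist y x < d \<Longrightarrow> dist (\<eta> m y) (\<eta> m x) < e"
    unfolding uniformly_continuous_on_def using \<open>e > 0\<close> by (metis mem_cball_0)
  have "dist (\<eta> m y) (\<eta> m x) < e" if "dist y x < min d 1" for x y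
  proof (cases "norm x \<le> r + 1 \<and> norm y \<le> r + 1")
    case True
    then show ?thesis using d that by auto
  next
    case False
    moreover have "\<bar>norm y - norm x\<bar> < 1"
      using that norm_triangle_ineq3[of y x] by (simp add: dist_norm)
    ultimately have "norm x \<ge> r" "norm y \<ge> r" by auto
    then show ?thesis using \<open>e > 0\<close> by (simp add: support)
  qed
  then show "\<exists>d>0. \<forall>x\<in>UNIV. \<forall>x'\<in>UNIV. dist x' x < d \<longrightarrow> dist (\<eta> m x') (\<eta> m x) < e"
    using \<open>d > 0\<close> by (intro exI[of _ "min d 1"]) auto
qed

text \<open>Uniformity in \<open>z\<close> is the point: under a convolution integral the remainder
  is then bounded by a small multiple of the L1 norm on a ball, so differentiation under the
  integral works for locally integrable functions. It comes from the uniform continuity of the first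
  partial derivatives.\<close>

lemma mollifier_uniformly_differentiable:
  assumes "e > 0"
  obtains d where "d > 0"
    "\<And>z h. norm h < d \<Longrightarrow> \<bar>\<eta> m (z + h) - \<eta> m z - (\<Sum>j\<in>UNIV. h $ j * \<eta> (m(j := Suc (m j))) z)\<bar> \<le> norm h * e"
proof -
  let ?n = "real CARD('n)"
  have "\<exists>d>0. \<forall>x y. dist y x < d \<longrightarrow> dist (\<eta> (m(j := Suc (m j))) y) (\<eta> (m(j := Suc (m j))) x) < e / ?n" for j
    using mollifier_uniformly_continuous[of "m(j := Suc (m j))"] assms
    unfolding uniformly_continuous_on_def by simp
  then obtain D where D: "\<And>j. D j > 0"
    "\<And>j x y. dist y x < D j \<Longrightarrow> dist (\<eta> (m(j := Suc (m j))) y) (\<eta> (m(j := Suc (m j))) x) < e / ?n"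
    by metis
  define d where "d = Min (range D)"
  have "d > 0" using D by (auto simp: d_def)
  have dD: "d \<le> D j" for j by (auto simp: d_def)
  show thesis
  proof
    fix z h :: "real^'n" assume h: "norm h < d"
    have "norm (\<eta> m (z + h) - \<eta> m z - (\<Sum>j\<in>UNIV. (z + h - z) $ j * \<eta> (m(j := Suc (m j))) z)) \<le> norm (z + h - z) * e"
    proof (rule differentiable_bound_linearization[where S = "ball z d" and f' = "\<lambda>x h. \<Sum>j\<in>UNIV. h $ j * \<eta> (m(j := Suc (m j))) x"])
      show "z + t *\<^sub>R (z + h - z) \<in> ball z d" if "t \<in> {0..1}" for t
      proof -
        have "\<bar>t\<bar> * norm h \<le> 1 * norm h" using that by (intro mult_right_mono) auto
        then show ?thesis using h by (simp add: dist_norm)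
      qed
      show "onorm ((\<lambda>h. \<Sum>j\<in>UNIV. h $ j * \<eta> (m(j := Suc (m j))) x) - (\<lambda>h. \<Sum>j\<in>UNIV. h $ j * \<eta> (m(j := Suc (m j))) z)) \<le> e"
        if x: "x \<in> ball z d" for x
      proof (rule onorm_bound)
        fix h :: "real^'n"
        have "norm (((\<lambda>h. \<Sum>j\<in>UNIV. h $ j * \<eta> (m(j := Suc (m j))) x) - (\<lambda>h. \<Sum>j\<in>UNIV. h $ j * \<eta> (m(j := Suc (m j))) z)) h)
            = \<bar>\<Sum>j\<in>UNIV. h $ j * (\<eta> (m(j := Suc (m j))) x - \<eta> (m(j := Suc (m j))) z)\<bar>"
          by (simp add: fun_diff_def sum_subtractf algebra_simps)
        also have "\<dots> \<le> (\<Sum>j\<in>(UNIV::'n set). norm h * (e / ?n))"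
        proof (rule order_trans[OF sum_abs], rule sum_mono)
          fix j
          have "dist (\<eta> (m(j := Suc (m j))) x) (\<eta> (m(j := Suc (m j))) z) < e / ?n"
            by (rule D(2)) (use x dD[of j] in \<open>auto simp: dist_commute\<close>)
          then show "\<bar>h $ j * (\<eta> (m(j := Suc (m j))) x - \<eta> (m(j := Suc (m j))) z)\<bar> \<le> norm h * (e / ?n)"
            unfolding abs_mult by (intro mult_mono component_le_norm_cart) (auto simp: dist_real_def)
        qed
        also have "\<dots> = e * norm h" by simp
        finally show "norm (((\<lambda>h. \<Sum>j\<in>UNIV. h $ j * \<eta> (m(j := Suc (m j))) x) - (\<lambda>h. \<Sum>j\<in>UNIV. h $ j * \<eta> (m(j := Suc (m j))) z)) h) \<le> e * norm h" .
      qed (use assms in simp)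
    qed (use \<open>d > 0\<close> in \<open>auto intro: has_derivative_at_withinI deriv\<close>)
    then show "\<bar>\<eta> m (z + h) - \<eta> m z - (\<Sum>j\<in>UNIV. h $ j * \<eta> (m(j := Suc (m j))) z)\<bar> \<le> norm h * e"
      by simp
  qed fact
qed

lemma integrable_conv_kernel:
  assumes f: "loc_L2 f"
  shows "integrable lborel (\<lambda>y. \<eta> m (x - y) *\<^sub>R f y)"
proof -
  obtain M where M: "\<And>x. \<bar>\<eta> m x\<bar> \<le> M" using mollifier_bounded by blast
  show ?thesis
  proof (rule Bochner_Integration.integrable_bound)
    show "integrable lborel (\<lambda>y. M * norm (indicator (cball 0 (norm x + r)) y *\<^sub>R f y))"
      using loc_L2_loc_integrable[OF f] by (intro integrable_mult_right integrable_norm)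
    show "(\<lambda>y. \<eta> m (x - y) *\<^sub>R f y) \<in> borel_measurable lborel"
      using f by measurable
    show "AE y in lborel. norm (\<eta> m (x - y) *\<^sub>R f y) \<le> norm (M * norm (indicator (cball 0 (norm x + r)) y *\<^sub>R f y))"
    proof (rule AE_I2)
      fix y
      show "norm (\<eta> m (x - y) *\<^sub>R f y) \<le> norm (M * norm (indicator (cball 0 (norm x + r)) y *\<^sub>R f y))"
      proof (cases "norm y \<le> norm x + r")
        case True
        have "\<bar>\<eta> m (x - y)\<bar> * norm (f y) \<le> \<bar>M\<bar> * norm (f y)"
          using M[of "x - y"] by (intro mult_right_mono) auto
        then show ?thesis using True by (simp add: abs_mult)
      next
        case False
        then have "r \<le> norm (x - y)" using norm_triangle_ineq2[of y x] by (simp add: norm_minus_commute)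
        then show ?thesis using False by (simp add: support)
      qed
    qed
  qed
qed

lemma conv_has_derivative:
  assumes f: "loc_L2 f"
  shows "(conv (\<eta> m) f has_derivative (\<lambda>h. \<Sum>j\<in>UNIV. h $ j *\<^sub>R conv (\<eta> (m(j := Suc (m j)))) f x)) (at x)"
  unfolding has_derivative_at_alt
proof (intro conjI allI impI)
  show "bounded_linear (\<lambda>h. \<Sum>j\<in>UNIV. h $ j *\<^sub>R conv (\<eta> (m(j := Suc (m j)))) f x)"
    by (intro bounded_linear_sum bounded_linear_scaleR_left[THEN bounded_linear_compose, unfolded o_def] bounded_linear_vec_nth)
  \<comment> \<open>The kernels centred at points within distance 1 of \<open>x\<close> all live in
    this ball; hence the increment is restricted by \<open>min d 1\<close> below.\<close>
  define R where "R = norm x + 1 + r"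
  define I where "I = (\<integral>y. norm (indicator (cball 0 R) y *\<^sub>R f y) \<partial>lborel)"
  have "I \<ge> 0" by (simp add: I_def)
  fix e :: real assume "e > 0"
  define e' where "e' = e / (I + 1)"
  have "e' > 0" using \<open>e > 0\<close> \<open>I \<ge> 0\<close> by (simp add: e'_def)
  obtain d where d: "d > 0"
    "\<And>z h. norm h < d \<Longrightarrow> \<bar>\<eta> m (z + h) - \<eta> m z - (\<Sum>j\<in>UNIV. h $ j * \<eta> (m(j := Suc (m j))) z)\<bar> \<le> norm h * e'"
    using mollifier_uniformly_differentiable[OF \<open>e' > 0\<close>, of m] by blast
  show "\<exists>d>0. \<forall>y. norm (y - x) < d \<longrightarrow> norm (conv (\<eta> m) f y - conv (\<eta> m) f x
      - (\<Sum>j\<in>UNIV. (y - x) $ j *\<^sub>R conv (\<eta> (m(j := Suc (m j)))) f x)) \<le> e * norm (y - x)"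
  proof (intro exI[of _ "min d 1"] conjI allI impI)
    fix x' assume x': "norm (x' - x) < min d 1"
    define h where "h = x' - x"
    define E where "E y = \<eta> m (x' - y) - \<eta> m (x - y) - (\<Sum>j\<in>UNIV. h $ j * \<eta> (m(j := Suc (m j))) (x - y))" for y
    have int: "integrable lborel (\<lambda>y. \<eta> m (x - y) *\<^sub>R f y)" for m x by (rule integrable_conv_kernel[OF f])
    have int': "integrable lborel (\<lambda>y. h $ j *\<^sub>R (\<eta> m (x - y) *\<^sub>R f y))" for m x j
      by (intro integrable_scaleR_right int)
    have eq: "E y *\<^sub>R f y = \<eta> m (x' - y) *\<^sub>R f y - \<eta> m (x - y) *\<^sub>R f y
        - (\<Sum>j\<in>UNIV. h $ j *\<^sub>R (\<eta> (m(j := Suc (m j))) (x - y) *\<^sub>R f y))" for y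
      by (simp add: E_def scaleR_left_diff_distrib scaleR_left.sum)
    have "conv (\<eta> m) f x' - conv (\<eta> m) f x - (\<Sum>j\<in>UNIV. h $ j *\<^sub>R conv (\<eta> (m(j := Suc (m j)))) f x)
      = (\<integral>y. E y *\<^sub>R f y \<partial>lborel)"
      unfolding eq conv_def
      by (simp del: scaleR_scaleR add: int int' Bochner_Integration.integral_diff[OF Bochner_Integration.integrable_diff[OF int int] Bochner_Integration.integrable_sum[OF int']]
          Bochner_Integration.integral_diff[OF int int] Bochner_Integration.integral_sum[OF int'])
    also have "norm \<dots> \<le> (\<integral>y. norm (E y *\<^sub>R f y) \<partial>lborel)" by (rule integral_norm_bound)
    also have "\<dots> \<le> (\<integral>y. (norm h * e') * norm (indicator (cball 0 R) y *\<^sub>R f y) \<partial>lborel)"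
    proof (rule integral_mono)
      show "integrable lborel (\<lambda>y. norm (E y *\<^sub>R f y))"
        unfolding eq by (intro integrable_norm Bochner_Integration.integrable_diff int int' Bochner_Integration.integrable_sum)
      show "integrable lborel (\<lambda>y. (norm h * e') * norm (indicator (cball 0 R) y *\<^sub>R f y))"
        by (intro integrable_mult_right integrable_norm loc_L2_loc_integrable f)
      fix y
      show "norm (E y *\<^sub>R f y) \<le> (norm h * e') * norm (indicator (cball 0 R) y *\<^sub>R f y)"
      proof (cases "norm y \<le> R")
        case True
        have "\<bar>E y\<bar> \<le> norm h * e'"
          using d(2)[of h "x - y"] x' by (simp add: E_def h_def)
        then show ?thesis using True by (simp add: mult_right_mono)
      next
        case False
        have "norm x' \<le> norm x + 1" using x' norm_triangle_ineq2[of x' x] by simp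
        then have "r \<le> norm (x - y)" "r \<le> norm (x' - y)"
          using False norm_triangle_ineq2[of y x] norm_triangle_ineq2[of y x']
          by (simp_all add: R_def norm_minus_commute)
        then show ?thesis using False by (simp add: E_def support)
      qed
    qed
    also have "\<dots> = (norm h * e') * I" by (simp add: I_def)
    also have "\<dots> = norm h * e * (I / (I + 1))" by (simp add: e'_def)
    also have "\<dots> \<le> norm h * e * 1" using \<open>I \<ge> 0\<close> \<open>e > 0\<close> by (intro mult_left_mono) auto
    finally show "norm (conv (\<eta> m) f x' - conv (\<eta> m) f x
      - (\<Sum>j\<in>UNIV. (x' - x) $ j *\<^sub>R conv (\<eta> (m(j := Suc (m j)))) f x)) \<le> e * norm (x' - x)"
      by (simp add: h_def mult.commute)
  qed (use \<open>d > 0\<close> in simp)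
qed

lemma conv_continuous_on: "loc_L2 f \<Longrightarrow> continuous_on S (conv (\<eta> m) f)"
  by (rule has_derivative_continuous_on, rule has_derivative_at_withinI, rule conv_has_derivative)

lemma conv_borel_measurable [measurable]: "loc_L2 f \<Longrightarrow> conv (\<eta> m) f \<in> borel_measurable borel"
  by (intro borel_measurable_continuous_onI conv_continuous_on)

end

text \<open>Expand the variance, the integral of w |G - m|^2 with m the mean, which is
  nonnegative.\<close>

lemma Jensen_norm_square:
  fixes G :: "'a \<Rightarrow> 'b::euclidean_space"
  assumes w: "integrable M w" "\<And>x. w x \<ge> 0" "(\<integral>x. w x \<partial>M) = 1"
    and wG: "integrable M (\<lambda>x. w x *\<^sub>R G x)" and wG2: "integrable M (\<lambda>x. w x * (norm (G x))\<^sup>2)"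
  shows "(norm (\<integral>x. w x *\<^sub>R G x \<partial>M))\<^sup>2 \<le> (\<integral>x. w x * (norm (G x))\<^sup>2 \<partial>M)"
proof -
  define m where "m = (\<integral>x. w x *\<^sub>R G x \<partial>M)"
  have eq: "w x * (norm (G x - m))\<^sup>2 = w x * (norm (G x))\<^sup>2 - 2 * ((w x *\<^sub>R G x) \<bullet> m) + w x * (norm m)\<^sup>2" for x
    by (simp add: power2_norm_eq_inner algebra_simps inner_commute)
  have i: "integrable M (\<lambda>x. 2 * ((w x *\<^sub>R G x) \<bullet> m))"
    by (intro integrable_mult_right integrable_inner_left wG)
  have "0 \<le> (\<integral>x. w x * (norm (G x - m))\<^sup>2 \<partial>M)"
    using w(2) by (intro integral_nonneg_AE) auto
  also have "\<dots> = (\<integral>x. w x * (norm (G x))\<^sup>2 \<partial>M) - (\<integral>x. 2 * ((w x *\<^sub>R G x) \<bullet> m) \<partial>M) + (\<integral>x. w x * (norm m)\<^sup>2 \<partial>M)"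
    unfolding eq
    by (simp add: Bochner_Integration.integral_add[OF Bochner_Integration.integrable_diff[OF wG2 i] integrable_mult_left[OF w(1)]]
        Bochner_Integration.integral_diff[OF wG2 i] del: inner_scaleR_left)
  also have "(\<integral>x. 2 * ((w x *\<^sub>R G x) \<bullet> m) \<partial>M) = 2 * (m \<bullet> m)"
    unfolding integral_mult_right_zero m_def by (subst integral_inner_left) (rule wG, simp)
  also have "(\<integral>x. w x * (norm m)\<^sup>2 \<partial>M) = m \<bullet> m"
    by (simp add: w power2_norm_eq_inner)
  finally show ?thesis by (simp add: m_def power2_norm_eq_inner)
qed

context mollifier
begin

lemma integrable_mollifier: "integrable lborel (\<eta> m)"
proof -
  have "integrable lborel (\<lambda>x. indicator (cball 0 r) x *\<^sub>R \<eta> m x)"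
    by (rule borel_integrable_compact) (auto intro: continuous_on_mollifier)
  moreover have "indicator (cball 0 r) x *\<^sub>R \<eta> m x = \<eta> m x" for x
    using support[of x m] by (auto simp: indicator_def)
  ultimately show ?thesis by (simp only:)
qed

lemma conv_square_le:
  assumes G: "loc_L2 G"
  shows "(norm (conv (\<eta> (\<lambda>_. 0)) G x))\<^sup>2 \<le> (\<integral>y. \<eta> (\<lambda>_. 0) (x - y) * (norm (G y))\<^sup>2 \<partial>lborel)"
    and "integrable lborel (\<lambda>y. \<eta> (\<lambda>_. 0) (x - y) * (norm (G y))\<^sup>2)"
proof -
  have [measurable]: "G \<in> borel_measurable borel" using G by (rule loc_L2_measurable)
  obtain M where M: "\<And>x. \<bar>\<eta> (\<lambda>_. 0) x\<bar> \<le> M" using mollifier_bounded by blast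
  show int: "integrable lborel (\<lambda>y. \<eta> (\<lambda>_. 0) (x - y) * (norm (G y))\<^sup>2)"
  proof (rule Bochner_Integration.integrable_bound)
    show "integrable lborel (\<lambda>y. M * (indicator (cball 0 (norm x + r)) y * (norm (G y))\<^sup>2))"
      by (intro integrable_mult_right loc_L2_integrable G)
    show "AE y in lborel. norm (\<eta> (\<lambda>_. 0) (x - y) * (norm (G y))\<^sup>2)
        \<le> norm (M * (indicator (cball 0 (norm x + r)) y * (norm (G y))\<^sup>2))"
    proof (rule AE_I2)
      fix y
      show "norm (\<eta> (\<lambda>_. 0) (x - y) * (norm (G y))\<^sup>2) \<le> norm (M * (indicator (cball 0 (norm x + r)) y * (norm (G y))\<^sup>2))"
      proof (cases "norm y \<le> norm x + r")
        case True
        then show ?thesis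
          using M[of "x - y"] by (auto simp: abs_mult intro!: mult_right_mono)
      next
        case False
        then have "r \<le> norm (x - y)" using norm_triangle_ineq2[of y x] by (simp add: norm_minus_commute)
        then show ?thesis using False by (simp add: support)
      qed
    qed
  qed measurable
  show "(norm (conv (\<eta> (\<lambda>_. 0)) G x))\<^sup>2 \<le> (\<integral>y. \<eta> (\<lambda>_. 0) (x - y) * (norm (G y))\<^sup>2 \<partial>lborel)"
    unfolding conv_def
  proof (rule Jensen_norm_square)
    show "(\<integral>y. \<eta> (\<lambda>_. 0) (x - y) \<partial>lborel) = 1"
      by (subst integral_lborel_reflect) (simp_all add: integral_1)
  qed (use integrable_lborel_reflect[OF integrable_mollifier] nonneg integrable_conv_kernel[OF G] int in auto)
qed

text \<open>Young's inequality for a kernel of mass one: integrate the Jensen bound over x and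
  exchange the integrals. Working with nonnegative integrals yields integrability on the left as
  well.\<close>

lemma conv_L2_contraction:
  assumes G: "loc_L2 G" and G2: "integrable lborel (\<lambda>x. (norm (G x))\<^sup>2)"
  shows "integrable lborel (\<lambda>x. (norm (conv (\<eta> (\<lambda>_. 0)) G x))\<^sup>2)"
    and "(\<integral>x. (norm (conv (\<eta> (\<lambda>_. 0)) G x))\<^sup>2 \<partial>lborel) \<le> (\<integral>x. (norm (G x))\<^sup>2 \<partial>lborel)"
proof -
  have [measurable]: "G \<in> borel_measurable borel" "conv (\<eta> (\<lambda>_. 0)) G \<in> borel_measurable borel"
    using G by (auto intro: loc_L2_measurable conv_borel_measurable)
  have "(\<integral>\<^sup>+x. ennreal ((norm (conv (\<eta> (\<lambda>_. 0)) G x))\<^sup>2) \<partial>lborel)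
      \<le> (\<integral>\<^sup>+x. (\<integral>\<^sup>+y. ennreal (\<eta> (\<lambda>_. 0) (x - y) * (norm (G y))\<^sup>2) \<partial>lborel) \<partial>lborel)"
    using conv_square_le[OF G] nonneg
    by (intro nn_integral_mono) (subst nn_integral_eq_integral, auto intro!: ennreal_leI)
  also have "\<dots> = (\<integral>\<^sup>+y. (\<integral>\<^sup>+x. ennreal (\<eta> (\<lambda>_. 0) (x - y) * (norm (G y))\<^sup>2) \<partial>lborel) \<partial>lborel)"
    by (rule lborel_pair.Fubini'[symmetric]) measurable
  also have "\<dots> = (\<integral>\<^sup>+y. ennreal ((norm (G y))\<^sup>2) \<partial>lborel)"
  proof (rule nn_integral_cong)
    fix y
    have "(\<integral>\<^sup>+x. ennreal (\<eta> (\<lambda>_. 0) (x - y) * (norm (G y))\<^sup>2) \<partial>lborel)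
        = (\<integral>\<^sup>+x. ennreal (\<eta> (\<lambda>_. 0) (x - y)) \<partial>lborel) * ennreal ((norm (G y))\<^sup>2)"
      by (subst nn_integral_multc[symmetric]) (simp_all add: ennreal_mult nonneg)
    also have "(\<integral>\<^sup>+x. ennreal (\<eta> (\<lambda>_. 0) (x - y)) \<partial>lborel) = (\<integral>\<^sup>+x. ennreal (\<eta> (\<lambda>_. 0) x) \<partial>lborel)"
    proof -
      have "(\<integral>\<^sup>+x. ennreal (\<eta> (\<lambda>_. 0) x) \<partial>lborel) = (\<integral>\<^sup>+x. ennreal (\<eta> (\<lambda>_. 0) (- y + x)) \<partial>lborel)"
        by (subst lborel_distr_plus[of "- y", symmetric]) (simp add: nn_integral_distr)
      then show ?thesis by simp
    qed
    also have "\<dots> = 1"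
      using nn_integral_eq_integral[OF integrable_mollifier, of "\<lambda>_. 0"] nonneg integral_1 by simp
    finally show "(\<integral>\<^sup>+x. ennreal (\<eta> (\<lambda>_. 0) (x - y) * (norm (G y))\<^sup>2) \<partial>lborel) = ennreal ((norm (G y))\<^sup>2)"
      by simp
  qed
  also have "\<dots> = ennreal (\<integral>y. (norm (G y))\<^sup>2 \<partial>lborel)"
    by (rule nn_integral_eq_integral[OF G2]) simp
  finally have le: "(\<integral>\<^sup>+x. ennreal ((norm (conv (\<eta> (\<lambda>_. 0)) G x))\<^sup>2) \<partial>lborel) \<le> ennreal (\<integral>y. (norm (G y))\<^sup>2 \<partial>lborel)" .
  show int: "integrable lborel (\<lambda>x. (norm (conv (\<eta> (\<lambda>_. 0)) G x))\<^sup>2)"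
    by (rule integrableI_nonneg) (use le in \<open>auto simp: top.not_eq_extremum intro: le_less_trans\<close>)
  show "(\<integral>x. (norm (conv (\<eta> (\<lambda>_. 0)) G x))\<^sup>2 \<partial>lborel) \<le> (\<integral>x. (norm (G x))\<^sup>2 \<partial>lborel)"
    using le by (subst (asm) nn_integral_eq_integral[OF int]) auto
qed

lemma conv_diff:
  "loc_L2 f \<Longrightarrow> loc_L2 g \<Longrightarrow> conv (\<eta> m) (\<lambda>x. f x - g x) x = conv (\<eta> m) f x - conv (\<eta> m) g x"
  unfolding conv_def scaleR_diff_right
  by (intro Bochner_Integration.integral_diff integrable_conv_kernel)

text \<open>The kernel is a probability density on the ball of radius \<open>r\<close> around
  \<open>x\<close>, so a mean deviates no more than the values do.\<close>

lemma conv_near: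
  assumes c: "loc_L2 c" and e: "\<And>y. norm (y - x) < r \<Longrightarrow> norm (c y - c x) \<le> e"
  shows "norm (conv (\<eta> (\<lambda>_. 0)) c x - c x) \<le> e"
proof -
  have w: "integrable lborel (\<lambda>y. \<eta> (\<lambda>_. 0) (x - y))" "(\<integral>y. \<eta> (\<lambda>_. 0) (x - y) \<partial>lborel) = 1"
    using integrable_lborel_reflect[OF integrable_mollifier] integral_1 by (auto simp: integral_lborel_reflect)
  have "conv (\<eta> (\<lambda>_. 0)) c x - c x = (\<integral>y. \<eta> (\<lambda>_. 0) (x - y) *\<^sub>R c y \<partial>lborel) - (\<integral>y. \<eta> (\<lambda>_. 0) (x - y) *\<^sub>R c x \<partial>lborel)"
    by (simp add: conv_def w)
  also have "\<dots> = (\<integral>y. \<eta> (\<lambda>_. 0) (x - y) *\<^sub>R c y - \<eta> (\<lambda>_. 0) (x - y) *\<^sub>R c x \<partial>lborel)"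
    by (rule Bochner_Integration.integral_diff[symmetric]) (intro integrable_conv_kernel c continuous_loc_L2 continuous_on_const)+
  finally have eq: "conv (\<eta> (\<lambda>_. 0)) c x - c x = (\<integral>y. \<eta> (\<lambda>_. 0) (x - y) *\<^sub>R c y - \<eta> (\<lambda>_. 0) (x - y) *\<^sub>R c x \<partial>lborel)" .
  have "norm (conv (\<eta> (\<lambda>_. 0)) c x - c x) \<le> (\<integral>y. norm (\<eta> (\<lambda>_. 0) (x - y) *\<^sub>R c y - \<eta> (\<lambda>_. 0) (x - y) *\<^sub>R c x) \<partial>lborel)"
    unfolding eq by (rule integral_norm_bound)
  also have "\<dots> \<le> (\<integral>y. \<eta> (\<lambda>_. 0) (x - y) * e \<partial>lborel)"
  proof (rule integral_mono)
    show "integrable lborel (\<lambda>y. norm (\<eta> (\<lambda>_. 0) (x - y) *\<^sub>R c y - \<eta> (\<lambda>_. 0) (x - y) *\<^sub>R c x))"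
      by (intro integrable_norm Bochner_Integration.integrable_diff integrable_conv_kernel c continuous_loc_L2 continuous_on_const)
    fix y
    show "norm (\<eta> (\<lambda>_. 0) (x - y) *\<^sub>R c y - \<eta> (\<lambda>_. 0) (x - y) *\<^sub>R c x) \<le> \<eta> (\<lambda>_. 0) (x - y) * e"
    proof (cases "norm (y - x) < r")
      case True
      then show ?thesis
        using e nonneg by (auto simp: scaleR_diff_right[symmetric] intro!: mult_left_mono)
    next
      case False
      then show ?thesis by (simp add: support norm_minus_commute)
    qed
  qed (simp add: w)
  also have "\<dots> = e" by (simp add: w)
  finally show ?thesis .
qed

end

text \<open>Two dominated convergences. Truncating the values of f to a ball of large radius n costs
  little. The truncation \<open>T n\<close> is continuous, so it can be applied to continuous
  functions converging to f almost everywhere, and then the differences are dominated by 2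
  n.\<close>

lemma loc_L2_approx_continuous:
  fixes f :: "'a::euclidean_space \<Rightarrow> 'b::euclidean_space"
  assumes f: "loc_L2 f" and "e > 0"
  obtains c where "continuous_on UNIV c" "(\<integral>x. indicator (cball 0 R) x * (norm (f x - c x))\<^sup>2 \<partial>lborel) < e"
proof -
  have [measurable]: "f \<in> borel_measurable borel" using f by (rule loc_L2_measurable)
  define T where "T n y = (real n / max (real n) (norm y)) *\<^sub>R y" for n and y :: 'b
  have T_bound: "norm (T n y) \<le> real n" if "n > 0" for n y
    using that by (auto simp: T_def field_simps max_def mult_left_mono)
  have T_diff: "norm (y - T n y) \<le> norm y" for n y
  proof -
    define s where "s = real n / max (real n) (norm y)"
    have "0 \<le> s" "s \<le> 1" by (auto simp: s_def field_simps max_def divide_le_eq_1)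
    have "y - T n y = (1 - s) *\<^sub>R y" by (simp add: T_def s_def algebra_simps)
    then show ?thesis using \<open>0 \<le> s\<close> \<open>s \<le> 1\<close> by (simp add: mult_left_le_one_le)
  qed
  have T_cont: "continuous_on UNIV (T n)" if "n > 0" for n
    unfolding T_def using that by (intro continuous_intros) (auto simp: max_def)
  have T_meas [measurable]: "T n \<in> borel_measurable borel" if "n > 0" for n
    using T_cont[OF that] by (rule borel_measurable_continuous_onI)
  have "(\<lambda>n. \<integral>x. indicator (cball 0 R) x * (norm (f x - T (Suc n) (f x)))\<^sup>2 \<partial>lborel) \<longlonglongrightarrow> (\<integral>x. 0 \<partial>(lborel :: 'a measure))"
  proof (rule integral_dominated_convergence)
    show "integrable lborel (\<lambda>x. indicator (cball 0 R) x * (norm (f x))\<^sup>2)" by (rule loc_L2_integrable[OF f])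
    show "AE x in lborel. (\<lambda>n. indicator (cball 0 R) x * (norm (f x - T (Suc n) (f x)))\<^sup>2) \<longlonglongrightarrow> 0"
    proof (rule AE_I2)
      fix x
      obtain N where N: "norm (f x) \<le> real N" using real_arch_simple by blast
      have "T (Suc n) (f x) = f x" if "n \<ge> N" for n
        using that N by (simp add: T_def max_def)
      then show "(\<lambda>n. indicator (cball 0 R) x * (norm (f x - T (Suc n) (f x)))\<^sup>2) \<longlonglongrightarrow> 0"
        by (intro tendsto_eventually eventually_sequentiallyI[of N]) simp
    qed
    show "AE x in lborel. norm (indicator (cball 0 R) x * (norm (f x - T (Suc n) (f x)))\<^sup>2)
        \<le> indicator (cball 0 R) x * (norm (f x))\<^sup>2" for n
      using T_diff by (auto simp: indicator_def intro!: power_mono)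
  qed measurable
  then have "\<forall>\<^sub>F n in sequentially. (\<integral>x. indicator (cball 0 R) x * (norm (f x - T (Suc n) (f x)))\<^sup>2 \<partial>lborel) < e / 4"
    using \<open>e > 0\<close> by (intro order_tendstoD(2)[where y = 0]) simp_all
  then obtain n0 where "(\<integral>x. indicator (cball 0 R) x * (norm (f x - T (Suc n0) (f x)))\<^sup>2 \<partial>lborel) < e / 4"
    by (auto simp: eventually_sequentially)
  then obtain n where n: "n > 0" "(\<integral>x. indicator (cball 0 R) x * (norm (f x - T n (f x)))\<^sup>2 \<partial>lborel) < e / 4"
    by blast
  note [measurable] = T_meas[OF n(1)]
  \<comment> \<open>\<open>measurable_on\<close> means almost everywhere convergence of continuous
    functions, so it supplies the approximants.\<close>
  have "f measurable_on UNIV"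
    by (rule lebesgue_measurable_imp_measurable_on) (simp_all add: measurable_completion)
  then obtain N g where N: "negligible N" and g: "\<And>k. continuous_on UNIV (g k)"
    and lim: "\<And>x. x \<notin> N \<Longrightarrow> (\<lambda>k. g k x) \<longlonglongrightarrow> f x"
    by (auto simp: measurable_on_def)
  have [measurable]: "g k \<in> borel_measurable borel" for k
    by (rule borel_measurable_continuous_onI[OF g])
  have "AE x in lebesgue. x \<notin> N"
    using N by (simp add: negligible_iff_null_sets AE_not_in)
  then have "AE x in lebesgue. (\<lambda>k. g k x) \<longlonglongrightarrow> f x" by eventually_elim (rule lim)
  then have ae: "AE x in lborel. (\<lambda>k. g k x) \<longlonglongrightarrow> f x"
    by (subst (asm) AE_completion_iff) auto
  have "(\<lambda>k. \<integral>x. indicator (cball 0 R) x * (norm (T n (f x) - T n (g k x)))\<^sup>2 \<partial>lborel) \<longlonglongrightarrow> (\<integral>x. 0 \<partial>(lborel :: 'a measure))"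
  proof (rule integral_dominated_convergence)
    show "integrable lborel (\<lambda>x::'a. indicator (cball 0 R) x * (2 * real n)\<^sup>2)"
      by (intro integrable_mult_left integrable_indicator_cball)
    show "AE x in lborel. (\<lambda>k. indicator (cball 0 R) x * (norm (T n (f x) - T n (g k x)))\<^sup>2) \<longlonglongrightarrow> 0"
      using ae
    proof eventually_elim
      case (elim x)
      have "isCont (T n) (f x)" using T_cont[OF n(1)] by (simp add: continuous_on_eq_continuous_at)
      then have "(\<lambda>k. T n (g k x)) \<longlonglongrightarrow> T n (f x)" using elim by (rule isCont_tendsto_compose)
      then have "(\<lambda>k. indicator (cball 0 R) x * (norm (T n (f x) - T n (g k x)))\<^sup>2)
          \<longlonglongrightarrow> indicator (cball 0 R) x * (norm (T n (f x) - T n (f x)))\<^sup>2"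
        by (intro tendsto_intros)
      then show ?case by simp
    qed
    show "AE x in lborel. norm (indicator (cball 0 R) x * (norm (T n (f x) - T n (g k x)))\<^sup>2)
        \<le> indicator (cball 0 R) x * (2 * real n)\<^sup>2" for k
    proof (rule AE_I2)
      fix x
      have "norm (T n (f x) - T n (g k x)) \<le> real n + real n"
        by (intro order_trans[OF norm_triangle_ineq4] add_mono T_bound n)
      then have "(norm (T n (f x) - T n (g k x)))\<^sup>2 \<le> (2 * real n)\<^sup>2"
        by (intro power_mono) auto
      then show "norm (indicator (cball 0 R) x * (norm (T n (f x) - T n (g k x)))\<^sup>2) \<le> indicator (cball 0 R) x * (2 * real n)\<^sup>2"
        by (simp add: indicator_def)
    qed
  qed measurable
  then have "\<forall>\<^sub>F k in sequentially. (\<integral>x. indicator (cball 0 R) x * (norm (T n (f x) - T n (g k x)))\<^sup>2 \<partial>lborel) < e / 4"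
    using \<open>e > 0\<close> by (intro order_tendstoD(2)[where y = 0]) simp_all
  then obtain k where k: "(\<integral>x. indicator (cball 0 R) x * (norm (T n (f x) - T n (g k x)))\<^sup>2 \<partial>lborel) < e / 4"
    by (auto simp: eventually_sequentially)
  define c where "c x = T n (g k x)" for x
  have c: "continuous_on UNIV c"
    unfolding c_def by (rule continuous_on_compose2[OF T_cont[OF n(1)] g]) simp
  have i1: "integrable lborel (\<lambda>x. indicator (cball 0 R) x * (norm (f x - T n (f x)))\<^sup>2)"
    by (rule Bochner_Integration.integrable_bound[OF loc_L2_integrable[OF f, of R]], measurable)
      (use T_diff in \<open>auto simp: indicator_def intro!: power_mono\<close>)
  have "loc_L2 (\<lambda>x. T n (f x))"
    unfolding loc_L2_def
  proof (intro conjI allI)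
    show "integrable lborel (\<lambda>x. indicator (cball 0 R) x * (norm (T n (f x)))\<^sup>2)" for R
    proof (rule Bochner_Integration.integrable_bound)
      show "integrable lborel (\<lambda>x::'a. indicator (cball 0 R) x * (real n)\<^sup>2)"
        by (intro integrable_mult_left integrable_indicator_cball)
    qed (measurable, use T_bound n in \<open>auto simp: indicator_def intro!: power_mono\<close>)
  qed measurable
  then have i2: "integrable lborel (\<lambda>x. indicator (cball 0 R) x * (norm (T n (f x) - c x))\<^sup>2)"
    by (rule loc_L2_integrable[OF loc_L2_diff[OF _ continuous_loc_L2[OF c]]])
  have "(\<integral>x. indicator (cball 0 R) x * (norm (f x - c x))\<^sup>2 \<partial>lborel)
     \<le> (\<integral>x. 2 * (indicator (cball 0 R) x * (norm (f x - T n (f x)))\<^sup>2) + 2 * (indicator (cball 0 R) x * (norm (T n (f x) - c x))\<^sup>2) \<partial>lborel)"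
  proof (rule integral_mono)
    show "integrable lborel (\<lambda>x. indicator (cball 0 R) x * (norm (f x - c x))\<^sup>2)"
      by (rule loc_L2_integrable[OF loc_L2_diff[OF f continuous_loc_L2[OF c]]])
    show "integrable lborel (\<lambda>x. 2 * (indicator (cball 0 R) x * (norm (f x - T n (f x)))\<^sup>2) + 2 * (indicator (cball 0 R) x * (norm (T n (f x) - c x))\<^sup>2))"
      by (rule Bochner_Integration.integrable_add[OF integrable_mult_right[OF i1] integrable_mult_right[OF i2]])
    show "indicator (cball 0 R) x * (norm (f x - c x))\<^sup>2
        \<le> 2 * (indicator (cball 0 R) x * (norm (f x - T n (f x)))\<^sup>2) + 2 * (indicator (cball 0 R) x * (norm (T n (f x) - c x))\<^sup>2)" for x
      using norm_add_square_le[of "f x - T n (f x)" "T n (f x) - c x"] by (simp add: indicator_def)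
  qed
  also have "\<dots> = 2 * (\<integral>x. indicator (cball 0 R) x * (norm (f x - T n (f x)))\<^sup>2 \<partial>lborel) + 2 * (\<integral>x. indicator (cball 0 R) x * (norm (T n (f x) - c x))\<^sup>2 \<partial>lborel)"
    by (subst Bochner_Integration.integral_add[OF integrable_mult_right[OF i1] integrable_mult_right[OF i2]]) (simp only: integral_mult_right_zero)
  also have "\<dots> < e" using n(2) k by (simp add: c_def)
  finally show thesis using that c by blast
qed

text \<open>On a ball, f is close in L2 to a continuous c. Mollification moves c little by uniform
  continuity, and it does not enlarge the L2 norm of f - c.\<close>

lemma mollification_tendsto:
  fixes f :: "real^'n::finite \<Rightarrow> 'b::euclidean_space"
  assumes f: "loc_L2 f" and moll: "\<And>k. mollifier (\<eta> k) (r k)" and r: "r \<longlonglongrightarrow> 0"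
  shows "(\<lambda>k. \<integral>x. indicator (cball 0 R) x * (norm (conv (\<eta> k (\<lambda>_. 0)) f x - f x))\<^sup>2 \<partial>lborel) \<longlonglongrightarrow> 0"
proof (rule order_tendstoI)
  fix e :: real assume "e > 0"
  define v where "v = (\<integral>x. indicator (cball 0 R) (x :: real^'n) \<partial>lborel :: real)"
  have "v \<ge> 0" by (simp add: v_def)
  obtain c where c: "continuous_on UNIV c"
    and fc: "(\<integral>x. indicator (cball 0 (R + 1)) x * (norm (f x - c x))\<^sup>2 \<partial>lborel) < e / 8"
    using loc_L2_approx_continuous[OF f, of "e / 8"] \<open>e > 0\<close> by auto
  have [measurable]: "f \<in> borel_measurable borel" "c \<in> borel_measurable borel"
    using f c by (auto intro: loc_L2_measurable borel_measurable_continuous_onI)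
  \<comment> \<open>Once \<open>r k < 1\<close>, the kernel at a point of the ball of radius
    \<open>R\<close> sees only the ball of radius \<open>R + 1\<close>. Cutting f - c off there
    makes the contraction on the whole space applicable.\<close>
  define G where "G x = indicator (cball 0 (R + 1)) x *\<^sub>R (f x - c x)" for x
  have G2: "(norm (G x))\<^sup>2 = indicator (cball 0 (R + 1)) x * (norm (f x - c x))\<^sup>2" for x
    by (simp add: G_def indicator_def)
  have iG: "integrable lborel (\<lambda>x. (norm (G x))\<^sup>2)"
    unfolding G2 by (intro loc_L2_integrable loc_L2_diff f continuous_loc_L2 c)
  have lG: "loc_L2 G"
    unfolding loc_L2_def
  proof (intro conjI allI)
    show "G \<in> borel_measurable borel" unfolding G_def[abs_def] by measurable
    then have [measurable]: "G \<in> borel_measurable borel" .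
    show "integrable lborel (\<lambda>x. indicator (cball 0 R) x * (norm (G x))\<^sup>2)" for R
      by (rule Bochner_Integration.integrable_bound[OF iG], measurable) (auto simp: indicator_def)
  qed
  \<comment> \<open>The squared error will be at most 4 |conv G|^2 + 4 s^2 + 2 |G|^2. The terms with
    G contribute less than 6 e / 8, and this \<open>s\<close> keeps the middle one below e / 4 on a
    ball of volume \<open>v\<close>.\<close>
  define s where "s = sqrt (e / (16 * (v + 1)))"
  have "s > 0" using \<open>e > 0\<close> \<open>v \<ge> 0\<close> by (simp add: s_def field_simps)
  have "uniformly_continuous_on (cball 0 (R + 1)) c"
    by (intro compact_uniformly_continuous continuous_on_subset[OF c]) auto
  then obtain d where d: "d > 0" "\<And>x y. norm x \<le> R + 1 \<Longrightarrow> norm y \<le> R + 1 \<Longrightarrow> dist y x < d \<Longrightarrow> dist (c y) (c x) < s"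
    unfolding uniformly_continuous_on_def using \<open>s > 0\<close> by (metis mem_cball_0)
  have "\<forall>\<^sub>F k in sequentially. r k < min d 1"
    using r \<open>d > 0\<close> by (intro order_tendstoD(2)) auto
  then show "\<forall>\<^sub>F k in sequentially. (\<integral>x. indicator (cball 0 R) x * (norm (conv (\<eta> k (\<lambda>_. 0)) f x - f x))\<^sup>2 \<partial>lborel) < e"
  proof eventually_elim
    case (elim k)
    interpret mollifier "\<eta> k" "r k" by (rule moll)
    let ?\<eta> = "\<eta> k (\<lambda>_. 0)"
    have [measurable]: "conv ?\<eta> f \<in> borel_measurable borel" by (rule conv_borel_measurable[OF f])
    have pt: "(norm (conv ?\<eta> f x - f x))\<^sup>2 \<le> 4 * (norm (conv ?\<eta> G x))\<^sup>2 + 4 * s\<^sup>2 + 2 * (norm (G x))\<^sup>2"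
      if x: "norm x \<le> R" for x
    proof -
      have "?\<eta> (x - y) *\<^sub>R G y = ?\<eta> (x - y) *\<^sub>R (f y - c y)" for y
      proof (cases "norm y \<le> R + 1")
        case False
        then have "r k \<le> norm (x - y)"
          using x elim norm_triangle_ineq2[of y x] by (simp add: norm_minus_commute)
        then show ?thesis by (simp add: support)
      qed (simp add: G_def)
      then have "conv ?\<eta> G x = conv ?\<eta> (\<lambda>y. f y - c y) x" unfolding conv_def by (simp only:)
      then have cG: "conv ?\<eta> G x = conv ?\<eta> f x - conv ?\<eta> c x"
        using conv_diff[OF f continuous_loc_L2[OF c]] by simp
      have "norm (conv ?\<eta> c x - c x) \<le> s"
      proof (rule conv_near[OF continuous_loc_L2[OF c]])
        fix y assume y: "norm (y - x) < r k"
        then have "norm y \<le> R + 1" using norm_triangle_ineq2[of y x] x elim by simp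
        then show "norm (c y - c x) \<le> s"
          using d(2)[of x y] x y elim by (simp add: dist_norm less_imp_le)
      qed
      then have cs: "(norm (conv ?\<eta> c x - c x))\<^sup>2 \<le> s\<^sup>2" by (intro power_mono) auto
      have "conv ?\<eta> f x - f x = (conv ?\<eta> G x + (conv ?\<eta> c x - c x)) - G x"
        using x by (simp add: cG G_def)
      then have "(norm (conv ?\<eta> f x - f x))\<^sup>2 \<le> 2 * (norm (conv ?\<eta> G x + (conv ?\<eta> c x - c x)))\<^sup>2 + 2 * (norm (G x))\<^sup>2"
        using norm_diff_square_le by metis
      also have "\<dots> \<le> 2 * (2 * (norm (conv ?\<eta> G x))\<^sup>2 + 2 * (norm (conv ?\<eta> c x - c x))\<^sup>2) + 2 * (norm (G x))\<^sup>2"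
        by (intro add_right_mono mult_left_mono norm_add_square_le) simp
      also have "\<dots> \<le> 4 * (norm (conv ?\<eta> G x))\<^sup>2 + 4 * s\<^sup>2 + 2 * (norm (G x))\<^sup>2"
        using cs by simp
      finally show ?thesis .
    qed
    note int = conv_L2_contraction(1)[OF lG iG]
    have v_int: "integrable lborel (\<lambda>x. 4 * s\<^sup>2 * indicator (cball 0 R) (x :: real^'n))"
      by (intro integrable_mult_right integrable_indicator_cball)
    have "(\<integral>x. indicator (cball 0 R) x * (norm (conv ?\<eta> f x - f x))\<^sup>2 \<partial>lborel)
       \<le> (\<integral>x. (4 * (norm (conv ?\<eta> G x))\<^sup>2 + 4 * s\<^sup>2 * indicator (cball 0 R) x) + 2 * (norm (G x))\<^sup>2 \<partial>lborel)"
    proof (rule integral_mono)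
      show "integrable lborel (\<lambda>x. indicator (cball 0 R) x * (norm (conv ?\<eta> f x - f x))\<^sup>2)"
        by (intro loc_L2_integrable loc_L2_diff f continuous_loc_L2 conv_continuous_on)
      show "integrable lborel (\<lambda>x. (4 * (norm (conv ?\<eta> G x))\<^sup>2 + 4 * s\<^sup>2 * indicator (cball 0 R) x) + 2 * (norm (G x))\<^sup>2)"
        using int iG by (intro Bochner_Integration.integrable_add integrable_mult_right integrable_indicator_cball)
    qed (use pt in \<open>auto simp: indicator_def\<close>)
    also have "\<dots> = 4 * (\<integral>x. (norm (conv ?\<eta> G x))\<^sup>2 \<partial>lborel) + 4 * s\<^sup>2 * v + 2 * (\<integral>x. (norm (G x))\<^sup>2 \<partial>lborel)"
      unfolding v_def
      by (subst Bochner_Integration.integral_add[OF Bochner_Integration.integrable_add[OF integrable_mult_right[OF int] v_int] integrable_mult_right[OF iG]],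
          subst Bochner_Integration.integral_add[OF integrable_mult_right[OF int] v_int]) (simp only: integral_mult_right_zero)
    also have "\<dots> \<le> 6 * (\<integral>x. (norm (G x))\<^sup>2 \<partial>lborel) + 4 * s\<^sup>2 * v"
      using conv_L2_contraction(2)[OF lG iG] by simp
    also have "\<dots> < 6 * (e / 8) + 4 * s\<^sup>2 * v"
      using fc by (simp add: G2)
    also have "4 * s\<^sup>2 * v = e / 4 * (v / (v + 1))" using \<open>e > 0\<close> \<open>v \<ge> 0\<close> by (simp add: s_def field_simps)
    also have "6 * (e / 8) + e / 4 * (v / (v + 1)) \<le> 6 * (e / 8) + e / 4 * 1"
      using \<open>e > 0\<close> \<open>v \<ge> 0\<close> by (intro add_left_mono mult_left_mono) auto
    finally show ?case by simp
  qed
next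
  fix a :: real assume "a < 0"
  then show "\<forall>\<^sub>F k in sequentially. a < (\<integral>x. indicator (cball 0 R) x * (norm (conv (\<eta> k (\<lambda>_. 0)) f x - f x))\<^sup>2 \<partial>lborel)"
    by (intro always_eventually allI) (rule less_le_trans[OF _ integral_nonneg_AE], auto)
qed

section \<open>Borel representatives and mollified weak derivatives\<close>

lemma L2_loc_lebesgue_measurable:
  fixes f :: "'a::euclidean_space \<Rightarrow> 'b::euclidean_space"
  assumes "L2_loc f"
  shows "f \<in> borel_measurable lebesgue"
proof (rule borel_measurable_LIMSEQ_metric)
  show "(\<lambda>x. indicator (cball 0 (real k)) x *\<^sub>R f x) \<in> borel_measurable lebesgue" for k
    using assms unfolding L2_loc_def L2_on_def
    by (subst borel_measurable_restrict_space_iff[symmetric]) auto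
  fix x :: 'a
  obtain N where N: "norm x \<le> real N" using real_arch_simple by blast
  show "(\<lambda>k. indicator (cball 0 (real k)) x *\<^sub>R f x) \<longlonglongrightarrow> f x"
    by (intro tendsto_eventually eventually_sequentiallyI[of N]) (use N in auto)
qed

lemma lebesgue_borel_representative:
  fixes f :: "'a::euclidean_space \<Rightarrow> 'b::euclidean_space"
  assumes "f \<in> borel_measurable lebesgue"
  obtains f' where "f' \<in> borel_measurable borel" "AE x in lebesgue. f x = f' x"
proof -
  have "\<exists>g\<in>borel_measurable lborel. AE x in lborel. f x \<bullet> b = g x" if "b \<in> Basis" for b
    by (rule completion_ex_borel_measurable_real) (use assms in measurable)
  then obtain g where g: "\<And>b. b \<in> Basis \<Longrightarrow> g b \<in> borel_measurable lborel"
    "\<And>b. b \<in> Basis \<Longrightarrow> AE x in lborel. f x \<bullet> b = g b x" by metis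
  have "AE x in lborel. \<forall>b\<in>Basis. f x \<bullet> b = g b x"
    by (rule AE_finite_allI) (use g in auto)
  then have "AE x in lebesgue. \<forall>b\<in>Basis. f x \<bullet> b = g b x" by (rule AE_completion)
  then have "AE x in lebesgue. f x = (\<Sum>b\<in>Basis. g b x *\<^sub>R b)"
    by eventually_elim (subst euclidean_representation[symmetric], auto intro!: sum.cong)
  moreover have "(\<lambda>x. \<Sum>b\<in>Basis. g b x *\<^sub>R b) \<in> borel_measurable borel"
    using g(1) by (intro borel_measurable_sum borel_measurable_scaleR) auto
  ultimately show thesis using that by blast
qed

lemma L2_loc_representative:
  fixes f :: "'a::euclidean_space \<Rightarrow> 'b::euclidean_space"
  assumes f: "L2_loc f"
  obtains f' where "loc_L2 f'" "AE x in lebesgue. f x = f' x"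
proof -
  obtain f' where f' [measurable]: "f' \<in> borel_measurable borel" and ae: "AE x in lebesgue. f x = f' x"
    using lebesgue_borel_representative[OF L2_loc_lebesgue_measurable[OF f]] by blast
  have [measurable]: "f \<in> borel_measurable lebesgue"
    using L2_loc_lebesgue_measurable[OF f] .
  have "integrable lborel (\<lambda>x. indicator (cball 0 R) x * (norm (f' x))\<^sup>2)" for R
  proof -
    have i: "integrable (lebesgue_on (cball 0 R)) (\<lambda>x. (norm (f x))\<^sup>2)"
      using f unfolding L2_loc_def L2_on_def by simp
    have m: "(\<lambda>x. indicator (cball 0 R) x * (norm (f' x))\<^sup>2) \<in> borel_measurable lborel" by measurable
    from i have "integrable lebesgue (\<lambda>x. indicator (cball 0 R) x *\<^sub>R (norm (f x))\<^sup>2)"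
      by (subst (asm) integrable_restrict_space) auto
    also have "?this \<longleftrightarrow> integrable lebesgue (\<lambda>x. indicator (cball 0 R) x * (norm (f' x))\<^sup>2)"
    proof (rule integrable_cong_AE)
      show "(\<lambda>x. indicator (cball 0 R) x *\<^sub>R (norm (f x))\<^sup>2) \<in> borel_measurable lebesgue"
        by (intro borel_measurable_scaleR borel_measurable_indicator borel_measurable_power
            measurable_compose[OF L2_loc_lebesgue_measurable[OF f] borel_measurable_norm]) simp
    qed (use ae measurable_completion[OF m] in auto)
    also have "\<dots> \<longleftrightarrow> integrable lborel (\<lambda>x. indicator (cball 0 R) x * (norm (f' x))\<^sup>2)"
      by (rule integrable_completion[OF m])
    finally show ?thesis .
  qed
  then have "loc_L2 f'" by (simp add: loc_L2_def)
  then show thesis using ae that by blast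
qed

text \<open>The reflected kernel y -> eta(x - y) is an admissible test function for each x, so the
  identity holds at every point; the minus sign in the definition cancels the one from the
  reflection. In the estimates below, weak differentiability enters in this form only.\<close>

lemma (in mollifier) conv_weak_partial:
  fixes f g :: "real^'n \<Rightarrow> 'b::euclidean_space"
  assumes fg: "has_weak_partial f j g"
    and f': "loc_L2 f'" "AE x in lebesgue. f x = f' x"
    and g': "loc_L2 g'" "AE x in lebesgue. g x = g' x"
  shows "conv (\<eta> ((\<lambda>_. 0)(j := 1))) f' x = conv (\<eta> (\<lambda>_. 0)) g' x"
proof -
  have m': "f' \<in> borel_measurable borel" "g' \<in> borel_measurable borel"
    using f' g' by (auto intro: loc_L2_measurable)
  have m: "f \<in> borel_measurable lebesgue" "g \<in> borel_measurable lebesgue"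
    using fg by (auto simp: has_weak_partial_def intro: L2_loc_lebesgue_measurable)
  let ?\<phi> = "\<lambda>y. \<eta> (\<lambda>_. 0) (x - y)"
  have fd: "frechet_derivative ?\<phi> (at y) (axis j 1) = - \<eta> ((\<lambda>_. 0)(j := 1)) (x - y)" for y
  proof -
    have "frechet_derivative ?\<phi> (at y) (axis j 1)
        = (\<Sum>i\<in>UNIV. axis j 1 $ i * - \<eta> ((\<lambda>_. 0)(i := Suc 0)) (x - y))"
      by (subst frechet_derivative_at[OF reflected_deriv, symmetric]) (rule refl)
    also have "\<dots> = - \<eta> ((\<lambda>_. 0)(j := 1)) (x - y)"
      by (subst sum.remove[of _ j]) (auto simp: axis_def intro!: sum.neutral)
    finally show ?thesis .
  qed
  have wd: "(\<integral>y. frechet_derivative ?\<phi> (at y) (axis j 1) *\<^sub>R f y \<partial>lebesgue) = - (\<integral>y. ?\<phi> y *\<^sub>R g y \<partial>lebesgue)"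
    using fg test_function_reflected[of "\<lambda>_. 0" x] unfolding has_weak_partial_def by blast
  have borel_leb: "h \<in> borel_measurable lebesgue" if "h \<in> borel_measurable borel" for h :: "real^'n \<Rightarrow> real"
    using that by (simp add: measurable_completion)
  have m1: "(\<lambda>y. \<eta> m (x - y)) \<in> borel_measurable lebesgue" for m
    by (rule borel_leb) measurable
  have m2: "(\<lambda>y. \<eta> m (x - y) *\<^sub>R h y) \<in> borel_measurable borel" if [measurable]: "h \<in> borel_measurable borel"
    for m and h :: "real^'n \<Rightarrow> 'b"
    by measurable
  have eq: "(\<integral>y. \<eta> m (x - y) *\<^sub>R h y \<partial>lebesgue) = conv (\<eta> m) h' x"
    if "h \<in> borel_measurable lebesgue" "h' \<in> borel_measurable borel" "AE x in lebesgue. h x = h' x"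
    for m and h h' :: "real^'n \<Rightarrow> 'b"
  proof -
    have "(\<integral>y. \<eta> m (x - y) *\<^sub>R h y \<partial>lebesgue) = (\<integral>y. \<eta> m (x - y) *\<^sub>R h' y \<partial>lebesgue)"
      using that m1 m2 by (intro integral_cong_AE borel_measurable_scaleR) (auto simp: measurable_completion)
    also have "\<dots> = conv (\<eta> m) h' x"
      unfolding conv_def using m2[OF that(2)] by (intro integral_completion) simp
    finally show ?thesis .
  qed
  from wd show ?thesis
    by (simp add: fd eq[OF m(1) m'(1) f'(2)] eq[OF m(2) m'(2) g'(2)])
qed

subsection \<open>The Carleman estimate for smooth functions\<close>

text \<open>The integral of a difference quotient vanishes by translation invariance, and dominated
  convergence passes to the derivative. Asking for differentiability along a single direction
  reduces all later derivatives to calculus in one variable.\<close>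

lemma integral_line_derivative_eq_0:
  fixes f f' :: "'a::euclidean_space \<Rightarrow> real"
  assumes deriv: "\<And>x. ((\<lambda>t. f (x + t *\<^sub>R e)) has_real_derivative f' x) (at 0)"
    and f: "continuous_on UNIV f" and f': "continuous_on UNIV f'"
    and supp: "\<And>x. norm x \<ge> R \<Longrightarrow> f x = 0" "\<And>x. norm x \<ge> R \<Longrightarrow> f' x = 0"
  shows "(\<integral>x. f' x \<partial>lborel) = 0"
proof -
  have [measurable]: "f \<in> borel_measurable borel" "f' \<in> borel_measurable borel"
    using f f' by (auto intro: borel_measurable_continuous_onI)
  have deriv': "((\<lambda>t. f (x + t *\<^sub>R e)) has_real_derivative f' (x + t *\<^sub>R e)) (at t)" for x t
    using deriv[of "x + t *\<^sub>R e"] DERIV_shift[of "\<lambda>t. f (x + t *\<^sub>R e)" "f' (x + t *\<^sub>R e)" 0 t]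
    by (simp add: algebra_simps)
  have "bounded (f' ` cball 0 R)"
    by (intro compact_imp_bounded compact_continuous_image continuous_on_subset[OF f']) auto
  then obtain M where "M > 0" "\<forall>x\<in>cball 0 R. \<bar>f' x\<bar> \<le> M" by (auto simp: bounded_pos)
  then have M: "\<bar>f' x\<bar> \<le> M" for x using supp(2)[of x] by (cases "norm x \<le> R") auto
  have int: "integrable lborel f"
  proof -
    have "integrable lborel (\<lambda>x. indicator (cball 0 R) x *\<^sub>R f x)"
      by (rule borel_integrable_compact) (auto intro: continuous_on_subset[OF f])
    moreover have "indicator (cball 0 R) x *\<^sub>R f x = f x" for x
      using supp(1)[of x] by (auto simp: indicator_def)
    ultimately show ?thesis by (simp only:)
  qed
  \<comment> \<open>The step sizes 1/(k+1) are at most 1, so all quotients live in the ball of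
    radius \<open>R + norm e\<close>. The mean value theorem bounds them by the maximum of
    |f'|.\<close>
  define F where "F k x = (f (x + (1 / real (Suc k)) *\<^sub>R e) - f x) * real (Suc k)" for k x
  have tr: "integrable lborel (\<lambda>x. f (x + c))" "(\<integral>x. f (x + c) \<partial>lborel) = (\<integral>x. f x \<partial>lborel)" for c
  proof -
    have "integrable (distr lborel borel ((+) c)) f" using int by (simp add: lborel_distr_plus)
    then show "integrable lborel (\<lambda>x. f (x + c))"
      by (subst (asm) integrable_distr_eq) (auto simp: add.commute)
    have "(\<integral>x. f x \<partial>lborel) = (\<integral>x. f x \<partial>distr lborel borel ((+) c))" by (simp add: lborel_distr_plus)
    also have "\<dots> = (\<integral>x. f (c + x) \<partial>lborel)" by (rule integral_distr) measurable
    finally show "(\<integral>x. f (x + c) \<partial>lborel) = (\<integral>x. f x \<partial>lborel)" by (simp add: add.commute)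
  qed
  have F0: "(\<integral>x. F k x \<partial>lborel) = 0" for k
    unfolding F_def
    by (subst integral_mult_left_zero, subst Bochner_Integration.integral_diff) (use tr int in auto)
  have "(\<lambda>k. \<integral>x. F k x \<partial>lborel) \<longlonglongrightarrow> (\<integral>x. f' x \<partial>lborel)"
  proof (rule integral_dominated_convergence)
    show "integrable lborel (\<lambda>x. M * indicator (cball 0 (R + norm e)) x)"
      by (intro integrable_mult_right integrable_real_indicator) (use emeasure_lborel_cball_finite in auto)
    show "AE x in lborel. (\<lambda>k. F k x) \<longlonglongrightarrow> f' x"
    proof (rule AE_I2)
      fix x
      have "(\<lambda>k. (f (x + (0 + 1 / real (Suc k)) *\<^sub>R e) - f (x + 0 *\<^sub>R e)) / (1 / real (Suc k))) \<longlonglongrightarrow> f' x"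
        by (rule filterlim_compose[OF deriv[of x, THEN DERIV_D]])
          (auto intro!: filterlim_atI LIMSEQ_Suc[OF lim_1_over_n] simp del: of_nat_Suc)
      then show "(\<lambda>k. F k x) \<longlonglongrightarrow> f' x" by (simp add: F_def field_simps)
    qed
    show "AE x in lborel. norm (F k x) \<le> M * indicator (cball 0 (R + norm e)) x" for k
    proof (rule AE_I2)
      fix x
      show "norm (F k x) \<le> M * indicator (cball 0 (R + norm e)) x"
      proof (cases "norm x \<le> R + norm e")
        case True
        have "\<exists>z. z > 0 \<and> z < 1 / real (Suc k) \<and> f (x + (1 / real (Suc k)) *\<^sub>R e) - f (x + 0 *\<^sub>R e)
          = (1 / real (Suc k) - 0) * f' (x + z *\<^sub>R e)"
          by (rule MVT2) (auto intro: deriv')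
        then obtain z where "f (x + (1 / real (Suc k)) *\<^sub>R e) - f x = (1 / real (Suc k)) * f' (x + z *\<^sub>R e)"
          by auto
        then have "F k x = f' (x + z *\<^sub>R e)" by (simp add: F_def)
        then show ?thesis using M True by simp
      next
        case False
        have "norm x \<le> norm (x + (1 / real (Suc k)) *\<^sub>R e) + norm ((1 / real (Suc k)) *\<^sub>R e)"
          using norm_triangle_ineq4[of "x + (1 / real (Suc k)) *\<^sub>R e" "(1 / real (Suc k)) *\<^sub>R e"] by simp
        moreover have "norm ((1 / real (Suc k)) *\<^sub>R e) \<le> norm e"
          using mult_left_mono[of 1 "1 + real k" "norm e"] by (simp add: divide_le_eq)
        ultimately have "norm (x + (1 / real (Suc k)) *\<^sub>R e) \<ge> R" using False by linarith
        moreover have "norm x \<ge> R" using False norm_ge_zero[of e] by linarith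
        ultimately show ?thesis using False by (simp add: F_def supp(1))
      qed
    qed
  qed (simp_all add: F_def[abs_def])
  then show ?thesis by (simp add: F0 LIMSEQ_const_iff)
qed

lemma norm_square_ge: "sqrt (max b 0) \<le> norm x \<Longrightarrow> b \<le> (norm x)\<^sup>2"
  by (drule sqrt_le_D) simp

section \<open>Clifford multiplication on a real Euclidean space\<close>

locale clifford =
  fixes A :: "'n::finite \<Rightarrow> 'b::euclidean_space \<Rightarrow> 'b"
  assumes linear_A: "linear (A j)"
    and symmetric_A: "A j u \<bullet> v = u \<bullet> A j v"
    and anticommute: "A j (A k u) + A k (A j u) = (if j = k then 2 *\<^sub>R u else 0)"
begin

definition slash :: "real^'n \<Rightarrow> 'b \<Rightarrow> 'b" where
  "slash x u = (\<Sum>k\<in>UNIV. x $ k *\<^sub>R A k u)"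

sublocale A: linear "A j" for j by (rule linear_A)

lemma linear_slash: "linear (slash x)"
  unfolding slash_def by (intro linear_compose_sum ballI linear_compose_scale_right) (auto intro: linear_A)

sublocale slash: linear "slash x" for x by (rule linear_slash)

lemma A_A [simp]: "A j (A j u) = u"
  using anticommute[of j j u] by (simp add: scaleR_2[symmetric])

lemma inner_slash: "slash x u \<bullet> v = u \<bullet> slash x v"
  by (simp add: slash_def inner_sum_left inner_sum_right symmetric_A)

text \<open>The anticommutation relations summed against the coordinates of x: A_j passes through X
  up to a sign and the scalar 2 x_j. Both the square of X and the angular operator are computed from
  this rule.\<close>

lemma A_slash: "A j (slash x u) = (2 * x $ j) *\<^sub>R u - slash x (A j u)"
proof -
  have "A j (slash x u) + slash x (A j u) = (\<Sum>k\<in>UNIV. x $ k *\<^sub>R (A j (A k u) + A k (A j u)))"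
    by (simp add: slash_def A.sum A.scale sum.distrib scaleR_add_right)
  also have "\<dots> = (2 * x $ j) *\<^sub>R u"
    by (simp add: anticommute if_distrib[of "\<lambda>t. _ *\<^sub>R t"] cong: if_cong)
  finally show ?thesis by (simp add: algebra_simps)
qed

text \<open>Expanding the outer factor and moving it through the inner one gives X X u = 2 |x|^2 u -
  X X u.\<close>

lemma slash_slash: "slash x (slash x u) = (norm x)\<^sup>2 *\<^sub>R u"
proof -
  have "slash x (slash x u) = (\<Sum>j\<in>UNIV. x $ j *\<^sub>R A j (slash x u))" by (simp add: slash_def)
  also have "\<dots> = (\<Sum>j\<in>UNIV. (2 * (x $ j * x $ j)) *\<^sub>R u - x $ j *\<^sub>R slash x (A j u))"
    by (simp add: A_slash scaleR_diff_right algebra_simps)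
  also have "\<dots> = (2 * (norm x)\<^sup>2) *\<^sub>R u - slash x (slash x u)"
    by (simp add: sum_subtractf scaleR_left.sum[symmetric] sum_distrib_left[symmetric] slash_def[of x u]
        slash.sum slash.scale power2_norm_eq_inner inner_vec_def)
  finally have "2 *\<^sub>R slash x (slash x u) = 2 *\<^sub>R ((norm x)\<^sup>2 *\<^sub>R u)"
    by (simp add: scaleR_2 algebra_simps)
  then show ?thesis by (simp only: scaleR_cancel_left) simp
qed

lemma norm_slash_square: "(norm (slash x u))\<^sup>2 = (norm x)\<^sup>2 * (norm u)\<^sup>2"
  by (simp add: power2_norm_eq_inner[of "slash x u"] inner_slash slash_slash power2_norm_eq_inner[of u])

lemma bounded_linear_A: "bounded_linear (A j)"
  by (rule linear_conv_bounded_linear[THEN iffD1, OF linear_A])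

lemma slash_axis: "slash (axis j 1) u = A j u"
  by (simp add: slash_def axis_def if_distrib[of "\<lambda>t. t *\<^sub>R _"] cong: if_cong)

lemma slash_add: "slash (x + y) u = slash x u + slash y u"
  by (simp add: slash_def scaleR_add_left sum.distrib)

lemma slash_scaleR: "slash (c *\<^sub>R x) u = c *\<^sub>R slash x u"
  by (simp add: slash_def scaleR_sum_right)

lemma bounded_bilinear_slash: "bounded_bilinear slash"
proof (rule bilinear_conv_bounded_bilinear[THEN iffD1])
  show "bilinear slash"
    unfolding bilinear_def
    by (auto intro!: linearI simp: slash_add slash_scaleR slash.add slash.scale)
qed

end

section \<open>Divergence identities for the Euler field and the angular Dirac operator\<close>

locale C2_function = clifford A for A :: "'n::finite \<Rightarrow> 'b::euclidean_space \<Rightarrow> 'b" +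
  fixes v :: "real^'n \<Rightarrow> 'b" and p :: "'n \<Rightarrow> real^'n \<Rightarrow> 'b" and r :: "'n \<Rightarrow> 'n \<Rightarrow> real^'n \<Rightarrow> 'b"
  assumes v_deriv: "(v has_derivative (\<lambda>h. \<Sum>j\<in>UNIV. h $ j *\<^sub>R p j x)) (at x)"
    and p_deriv: "(p j has_derivative (\<lambda>h. \<Sum>k\<in>UNIV. h $ k *\<^sub>R r j k x)) (at x)"
    and r_sym: "r j k x = r k j x"
    and r_cont: "continuous_on UNIV (r j k)"
begin

text \<open>In the notation of the overview, this and the next two definitions are E v, P v and X P
  v, so \<open>slash_dirac x - euler x\<close> is G v.\<close>

definition "euler x = (\<Sum>j\<in>UNIV. x $ j *\<^sub>R p j x)"
definition "dirac_sum x = (\<Sum>j\<in>UNIV. A j (p j x))"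
definition "slash_dirac x = slash x (dirac_sum x)"

lemma v_cont: "continuous_on S v"
  by (rule has_derivative_continuous_on, rule has_derivative_at_withinI, rule v_deriv)

lemma p_cont: "continuous_on S (p j)"
  by (rule has_derivative_continuous_on, rule has_derivative_at_withinI, rule p_deriv)

lemma euler_cont: "continuous_on S euler"
  unfolding euler_def[abs_def] by (intro continuous_intros p_cont)

lemma dirac_sum_cont: "continuous_on S dirac_sum"
  unfolding dirac_sum_def[abs_def]
  by (intro continuous_intros bounded_linear.continuous_on[OF bounded_linear_A] p_cont)

lemma slash_dirac_cont: "continuous_on S slash_dirac"
  unfolding slash_dirac_def[abs_def]
  by (intro bounded_bilinear.continuous_on[OF bounded_bilinear_slash] continuous_intros dirac_sum_cont)

lemma line_derivative:
  fixes f :: "real^'n \<Rightarrow> 'c::real_normed_vector"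
  assumes "(f has_derivative (\<lambda>h. \<Sum>j\<in>UNIV. h $ j *\<^sub>R f' j)) (at x)"
  shows "((\<lambda>t. f (x + t *\<^sub>R axis j 1)) has_vector_derivative f' j) (at 0)"
proof -
  have l: "((\<lambda>t. x + t *\<^sub>R axis j 1) has_derivative (\<lambda>t. t *\<^sub>R axis j 1)) (at 0)"
    by (auto intro!: derivative_eq_intros)
  have "((\<lambda>t. f (x + t *\<^sub>R axis j 1)) has_derivative (\<lambda>t. \<Sum>i\<in>UNIV. (t *\<^sub>R axis j 1) $ i *\<^sub>R f' i)) (at 0)"
    by (rule has_derivative_compose[OF l]) (use assms in simp)
  moreover have "(\<Sum>i\<in>UNIV. (t *\<^sub>R axis j 1) $ i *\<^sub>R f' i) = t *\<^sub>R f' j" for t :: real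
    by (subst sum.remove[of _ j]) (auto simp: axis_def intro!: sum.neutral)
  ultimately show ?thesis by (simp add: has_vector_derivative_def)
qed

definition "d_dirac_sum j x = (\<Sum>k\<in>UNIV. A k (r k j x))"
definition "d_euler j x = p j x + (\<Sum>k\<in>UNIV. x $ k *\<^sub>R r k j x)"

lemma coordinate_line_derivative:
  "((\<lambda>t. (x + t *\<^sub>R axis j 1) $ k) has_real_derivative axis j 1 $ k) (at 0)"
  by (auto intro!: derivative_eq_intros)

lemma dirac_sum_line_derivative: "((\<lambda>t. dirac_sum (x + t *\<^sub>R axis j 1)) has_vector_derivative d_dirac_sum j x) (at 0)"
  unfolding dirac_sum_def d_dirac_sum_def
  by (intro has_vector_derivative_sum bounded_linear.has_vector_derivative[OF bounded_linear_A] line_derivative[OF p_deriv])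

lemma euler_line_derivative: "((\<lambda>t. euler (x + t *\<^sub>R axis j 1)) has_vector_derivative d_euler j x) (at 0)"
proof -
  have "((\<lambda>t. euler (x + t *\<^sub>R axis j 1)) has_vector_derivative
      (\<Sum>k\<in>UNIV. x $ k *\<^sub>R r k j x + axis j 1 $ k *\<^sub>R p k x)) (at 0)"
    unfolding euler_def
    using has_vector_derivative_scaleR[OF coordinate_line_derivative line_derivative[OF p_deriv], of x j]
    by (intro has_vector_derivative_sum) simp
  also have "(\<Sum>k\<in>UNIV. x $ k *\<^sub>R r k j x + axis j 1 $ k *\<^sub>R p k x) = d_euler j x"
    by (simp add: d_euler_def sum.distrib axis_def if_distrib[of "\<lambda>t. t *\<^sub>R _"] cong: if_cong)
  finally show ?thesis .
qed

lemma slash_v_line_derivative: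
  "((\<lambda>t. slash (x + t *\<^sub>R axis j 1) (v (x + t *\<^sub>R axis j 1))) has_vector_derivative slash x (p j x) + A j (v x)) (at 0)"
proof -
  have "((\<lambda>t. x + t *\<^sub>R axis j 1) has_vector_derivative axis j 1) (at 0)"
    by (auto intro!: derivative_eq_intros)
  from bounded_bilinear.has_vector_derivative[OF bounded_bilinear_slash this line_derivative[OF v_deriv, of x j]]
  show ?thesis by (simp add: slash_axis)
qed

lemma radial_line_derivative:
  assumes "(\<kappa> has_real_derivative \<kappa>' ((norm x)\<^sup>2)) (at ((norm x)\<^sup>2))"
  shows "((\<lambda>t. \<kappa> ((norm (x + t *\<^sub>R axis j 1))\<^sup>2)) has_real_derivative \<kappa>' ((norm x)\<^sup>2) * (2 * x $ j)) (at (0::real))"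
proof -
  have "((\<lambda>t. (norm (x + t *\<^sub>R axis j 1))\<^sup>2) has_real_derivative 2 * x $ j) (at 0)"
    unfolding power2_norm_eq_inner
    by (auto intro!: derivative_eq_intros simp: has_field_derivative_def inner_axis inner_axis' algebra_simps fun_eq_iff)
  then show ?thesis
    using DERIV_chain2[where f = \<kappa> and g = "\<lambda>t. (norm (x + t *\<^sub>R axis j 1))\<^sup>2" and x = 0] assms by simp
qed

text \<open>Up to lower-order terms, the divergence of this field is twice
  the inner product of the Euler derivative and the angular derivative of \<^term>\<open>v\<close>: the second
  derivatives cancel by symmetry.\<close>

definition "field j x = slash x (v x) \<bullet> (x $ j *\<^sub>R dirac_sum x - A j (euler x))"
definition "dfield j x = (slash x (p j x) + A j (v x)) \<bullet> (x $ j *\<^sub>R dirac_sum x - A j (euler x))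
    + slash x (v x) \<bullet> (dirac_sum x + x $ j *\<^sub>R d_dirac_sum j x - A j (d_euler j x))"

lemma field_line_derivative: "((\<lambda>t. field j (x + t *\<^sub>R axis j 1)) has_real_derivative dfield j x) (at 0)"
proof -
  have c: "((\<lambda>t. (x + t *\<^sub>R axis j 1) $ j) has_real_derivative 1) (at 0)"
    using coordinate_line_derivative[of x j j] by (simp add: axis_def)
  have "((\<lambda>t. (x + t *\<^sub>R axis j 1) $ j *\<^sub>R dirac_sum (x + t *\<^sub>R axis j 1) - A j (euler (x + t *\<^sub>R axis j 1)))
      has_vector_derivative (x $ j *\<^sub>R d_dirac_sum j x + 1 *\<^sub>R dirac_sum x) - A j (d_euler j x)) (at 0)"
    using has_vector_derivative_diff[OF has_vector_derivative_scaleR[OF c dirac_sum_line_derivative[of x j]]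
        bounded_linear.has_vector_derivative[OF bounded_linear_A euler_line_derivative[of x j]]] by simp
  from bounded_bilinear.has_vector_derivative[OF bounded_bilinear_inner slash_v_line_derivative this]
  show ?thesis
    by (simp add: field_def dfield_def has_real_derivative_iff_has_vector_derivative algebra_simps)
qed

text \<open>This is the contraction that meets the derivative of a radial factor, whose gradient
  points along x. The product of X v with X E v collapses by X^2 = |x|^2.\<close>

lemma field_sum: "(\<Sum>j\<in>UNIV. x $ j * field j x) = (norm x)\<^sup>2 * (v x \<bullet> slash_dirac x - v x \<bullet> euler x)"
proof -
  have "(\<Sum>j\<in>UNIV. x $ j * field j x) = slash x (v x) \<bullet> (\<Sum>j\<in>UNIV. x $ j *\<^sub>R (x $ j *\<^sub>R dirac_sum x - A j (euler x)))"
    by (simp add: field_def inner_sum_right)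
  also have "(\<Sum>j\<in>UNIV. x $ j *\<^sub>R (x $ j *\<^sub>R dirac_sum x - A j (euler x))) = (norm x)\<^sup>2 *\<^sub>R dirac_sum x - slash x (euler x)"
    by (simp add: scaleR_diff_right sum_subtractf scaleR_left.sum[symmetric] power2_norm_eq_inner inner_vec_def flip: slash_def)
  finally show ?thesis
    by (simp add: inner_diff_right inner_slash slash_slash slash.diff slash.scale algebra_simps slash_dirac_def)
qed

text \<open>Here the symmetry of G and its commuting with E show up. The second derivatives in the
  two halves of the field cancel, and moving A_j through X in the first-order terms assembles G
  v.\<close>

lemma dfield_sum:
  "(\<Sum>j\<in>UNIV. dfield j x) = 2 * (euler x \<bullet> (slash_dirac x - euler x)) + real CARD('n) * (v x \<bullet> (slash_dirac x - euler x))"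
proof -
  have 1: "(\<Sum>j\<in>UNIV. (x $ j) * (slash x (p j x) \<bullet> dirac_sum x)) = euler x \<bullet> slash_dirac x"
    by (simp add: euler_def slash_dirac_def inner_sum_left inner_slash)
  \<comment> \<open>Entering the divergence with a minus sign, this contributes -2 |E v|^2 and a
    second copy of E v . X P v: the subtraction that turns X P into G.\<close>
  have 2: "(\<Sum>j\<in>UNIV. slash x (p j x) \<bullet> A j (euler x)) = 2 * (euler x \<bullet> euler x) - slash_dirac x \<bullet> euler x"
  proof -
    have "slash x (p j x) \<bullet> A j (euler x) = 2 * (x $ j *\<^sub>R p j x \<bullet> euler x) - slash x (A j (p j x)) \<bullet> euler x" for j
      by (simp add: symmetric_A[symmetric] A_slash inner_diff_left)
    then show ?thesis
      by (simp add: sum_subtractf sum_distrib_left[symmetric] inner_sum_left[symmetric] slash.sum[symmetric]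
          euler_def[symmetric] dirac_sum_def[symmetric] slash_dirac_def[symmetric] del: inner_scaleR_left)
  qed
  have 3: "(\<Sum>j\<in>UNIV. x $ j * (A j (v x) \<bullet> dirac_sum x)) = v x \<bullet> slash_dirac x"
    by (simp add: slash_dirac_def inner_slash[symmetric]) (simp add: slash_def inner_sum_left)
  have 4: "A j (v x) \<bullet> A j (euler x) = v x \<bullet> euler x" for j
    by (simp add: symmetric_A)
  \<comment> \<open>The second derivatives cancel by \<open>r_sym\<close>. The remaining -P v comes
    from differentiating the coefficients of the Euler field, and its product with X v cancels fact
    3.\<close>
  have 5: "(\<Sum>j\<in>UNIV. x $ j *\<^sub>R d_dirac_sum j x - A j (d_euler j x)) = - dirac_sum x"
  proof -
    have "(\<Sum>j\<in>UNIV. x $ j *\<^sub>R d_dirac_sum j x) = (\<Sum>j\<in>UNIV. \<Sum>k\<in>UNIV. x $ j *\<^sub>R A k (r k j x))"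
      by (simp add: d_dirac_sum_def scaleR_sum_right)
    also have "\<dots> = (\<Sum>k\<in>UNIV. \<Sum>j\<in>UNIV. x $ j *\<^sub>R A k (r j k x))"
      by (subst sum.swap) (simp add: r_sym)
    finally show ?thesis
      by (simp add: sum_subtractf d_euler_def A.add A.sum A.scale sum.distrib dirac_sum_def)
  qed
  have "dfield j x = x $ j * (slash x (p j x) \<bullet> dirac_sum x) - slash x (p j x) \<bullet> A j (euler x)
      + x $ j * (A j (v x) \<bullet> dirac_sum x) - A j (v x) \<bullet> A j (euler x)
      + slash x (v x) \<bullet> dirac_sum x + slash x (v x) \<bullet> (x $ j *\<^sub>R d_dirac_sum j x - A j (d_euler j x))" for j
    by (simp add: dfield_def inner_add_left inner_diff_right inner_add_right algebra_simps)
  then have "(\<Sum>j\<in>UNIV. dfield j x) = (\<Sum>j\<in>UNIV. x $ j * (slash x (p j x) \<bullet> dirac_sum x)) - (\<Sum>j\<in>UNIV. slash x (p j x) \<bullet> A j (euler x))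
      + (\<Sum>j\<in>UNIV. x $ j * (A j (v x) \<bullet> dirac_sum x)) - (\<Sum>j\<in>(UNIV::'n set). v x \<bullet> euler x)
      + (\<Sum>j\<in>(UNIV::'n set). slash x (v x) \<bullet> dirac_sum x) + slash x (v x) \<bullet> (\<Sum>j\<in>UNIV. x $ j *\<^sub>R d_dirac_sum j x - A j (d_euler j x))"
    by (simp only: sum.distrib sum_subtractf 4 inner_sum_right inner_diff_right)
  then show ?thesis
    unfolding 1 2 3 5 by (simp add: inner_slash slash_dirac_def[symmetric] inner_diff_right inner_commute[of "slash_dirac x"] algebra_simps)
qed


lemma field_cont: "continuous_on S (field j)"
  unfolding field_def[abs_def]
  by (intro continuous_intros bounded_bilinear.continuous_on[OF bounded_bilinear_slash]
      bounded_linear.continuous_on[OF bounded_linear_A] v_cont dirac_sum_cont euler_cont)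

lemma dfield_cont: "continuous_on S (dfield j)"
  unfolding dfield_def[abs_def] d_dirac_sum_def d_euler_def
  by (intro continuous_intros bounded_bilinear.continuous_on[OF bounded_bilinear_slash]
      bounded_linear.continuous_on[OF bounded_linear_A] v_cont p_cont dirac_sum_cont euler_cont
      continuous_on_subset[OF r_cont]) auto

lemma continuous_on_radial:
  fixes \<kappa> :: "real \<Rightarrow> 'c::topological_space"
  assumes "continuous_on UNIV \<kappa>" shows "continuous_on S (\<lambda>x :: 'd::real_normed_vector. \<kappa> ((norm x)\<^sup>2))"
  by (rule continuous_on_compose2[OF assms]) (auto intro!: continuous_intros)

text \<open>The divergence theorem for the field kappa(|x|^2) F of compact support; the component
  F_j is differentiated along axis j only.\<close>

lemma radial_divergence:
  fixes F dF :: "'n \<Rightarrow> real^'n \<Rightarrow> real"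
  assumes \<kappa>: "\<And>q. (\<kappa> has_real_derivative \<kappa>' q) (at q)" and \<kappa>': "continuous_on UNIV \<kappa>'"
    and supp: "\<And>q. q \<ge> b \<Longrightarrow> \<kappa> q = 0" "\<And>q. q \<ge> b \<Longrightarrow> \<kappa>' q = 0"
    and F: "\<And>j x. ((\<lambda>t. F j (x + t *\<^sub>R axis j 1)) has_real_derivative dF j x) (at 0)"
    and F_cont: "\<And>j. continuous_on UNIV (F j)" and dF_cont: "\<And>j. continuous_on UNIV (dF j)"
  shows "(\<integral>x. \<kappa>' ((norm x)\<^sup>2) * 2 * (\<Sum>j\<in>UNIV. x $ j * F j x) + \<kappa> ((norm x)\<^sup>2) * (\<Sum>j\<in>UNIV. dF j x) \<partial>lborel) = 0"
proof -
  define R where "R = sqrt (max b 0)"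
  have R: "(norm x)\<^sup>2 \<ge> b" if "norm x \<ge> R" for x :: "real^'n"
    using that by (simp add: R_def norm_square_ge)
  have \<kappa>_cont: "continuous_on UNIV \<kappa>"
    using \<kappa> by (meson DERIV_continuous_on has_field_derivative_at_within)
  define G where "G j x = \<kappa> ((norm x)\<^sup>2) * F j x" for j and x :: "real^'n"
  define dG where "dG j x = \<kappa>' ((norm x)\<^sup>2) * (2 * x $ j) * F j x + dF j x * \<kappa> ((norm x)\<^sup>2)" for j and x :: "real^'n"
  have dG_cont: "continuous_on UNIV (dG j)" for j
    unfolding dG_def[abs_def] by (intro continuous_intros continuous_on_radial \<kappa>_cont \<kappa>' F_cont dF_cont)
  have int0: "(\<integral>x. dG j x \<partial>lborel) = 0" for j
  proof (rule integral_line_derivative_eq_0[where e = "axis j 1" and f = "G j" and R = R])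
    show "((\<lambda>t. G j (x + t *\<^sub>R axis j 1)) has_real_derivative dG j x) (at 0)" for x
      using DERIV_mult[OF radial_line_derivative[of \<kappa> \<kappa>' x j, OF \<kappa>] F[of j x]] by (simp add: G_def dG_def)
    show "continuous_on UNIV (G j)"
      unfolding G_def[abs_def] by (intro continuous_intros continuous_on_radial \<kappa>_cont F_cont)
    show "continuous_on UNIV (dG j)" by (rule dG_cont)
  qed (auto simp: G_def dG_def supp R)
  have int: "integrable lborel (dG j)" for j
  proof -
    have "integrable lborel (\<lambda>x. indicator (cball 0 R) x *\<^sub>R dG j x)"
      by (rule borel_integrable_compact) (auto intro: continuous_on_subset[OF dG_cont])
    moreover have "indicator (cball 0 R) x *\<^sub>R dG j x = dG j x" for x
      using R[of x] supp by (auto simp: indicator_def dG_def)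
    ultimately show ?thesis by (simp only:)
  qed
  have "\<kappa>' ((norm x)\<^sup>2) * 2 * (\<Sum>j\<in>UNIV. x $ j * F j x) + \<kappa> ((norm x)\<^sup>2) * (\<Sum>j\<in>UNIV. dF j x) = (\<Sum>j\<in>UNIV. dG j x)" for x
    by (simp add: dG_def sum.distrib sum_distrib_left sum_distrib_right algebra_simps)
  then show ?thesis
    by (simp add: Bochner_Integration.integral_sum[OF int] int0)
qed

lemma v_square_line_derivative:
  "((\<lambda>t. (x + t *\<^sub>R axis j 1) $ j * (norm (v (x + t *\<^sub>R axis j 1)))\<^sup>2) has_real_derivative
     (norm (v x))\<^sup>2 + 2 * (x $ j * (p j x \<bullet> v x))) (at 0)"
proof -
  have c: "((\<lambda>t. (x + t *\<^sub>R axis j 1) $ j) has_real_derivative 1) (at 0)"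
    using coordinate_line_derivative[of x j j] by (simp add: axis_def)
  from bounded_bilinear.has_vector_derivative[OF bounded_bilinear_inner line_derivative[OF v_deriv, of x j] line_derivative[OF v_deriv, of x j]]
  have "((\<lambda>t. (norm (v (x + t *\<^sub>R axis j 1)))\<^sup>2) has_real_derivative 2 * (p j x \<bullet> v x)) (at 0)"
    by (simp add: has_real_derivative_iff_has_vector_derivative power2_norm_eq_inner inner_commute)
  from DERIV_mult[OF c this] show ?thesis by (simp add: algebra_simps)
qed

text \<open>For kappa = theta^2 the integrand is 2 (E + n/2)(theta v) . G(theta v), with theta
  evaluated at |x|^2. Its integral vanishes because an antisymmetric and a symmetric operator that
  commute have no cross term.\<close>

lemma commutator_identity:
  assumes "\<And>q. (\<kappa> has_real_derivative \<kappa>' q) (at q)" "continuous_on UNIV \<kappa>'"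
    and "\<And>q. q \<ge> b \<Longrightarrow> \<kappa> q = 0" "\<And>q. q \<ge> b \<Longrightarrow> \<kappa>' q = 0"
  shows "(\<integral>x. \<kappa> ((norm x)\<^sup>2) * (2 * (euler x \<bullet> (slash_dirac x - euler x)) + real CARD('n) * (v x \<bullet> (slash_dirac x - euler x)))
     + 2 * (norm x)\<^sup>2 * \<kappa>' ((norm x)\<^sup>2) * (v x \<bullet> (slash_dirac x - euler x)) \<partial>lborel) = 0"
  using radial_divergence[where b = b, OF assms field_line_derivative field_cont dfield_cont]
  by (simp add: field_sum dfield_sum inner_diff_right algebra_simps)

text \<open>The divergence theorem for the field kappa(|x|^2) |v|^2 x, which expresses the
  antisymmetry of E + n/2. Applied with kappa = s theta^2, it makes s' appear.\<close>

lemma Euler_identity: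
  assumes "\<And>q. (\<kappa> has_real_derivative \<kappa>' q) (at q)" "continuous_on UNIV \<kappa>'"
    and "\<And>q. q \<ge> b \<Longrightarrow> \<kappa> q = 0" "\<And>q. q \<ge> b \<Longrightarrow> \<kappa>' q = 0"
  shows "(\<integral>x. \<kappa> ((norm x)\<^sup>2) * (real CARD('n) * (norm (v x))\<^sup>2 + 2 * (euler x \<bullet> v x))
     + 2 * (norm x)\<^sup>2 * \<kappa>' ((norm x)\<^sup>2) * (norm (v x))\<^sup>2 \<partial>lborel) = 0"
proof -
  have 1: "(\<Sum>j\<in>UNIV. x $ j * (x $ j * (norm (v x))\<^sup>2)) = (norm x)\<^sup>2 * (norm (v x))\<^sup>2" for x
    by (simp add: power2_norm_eq_inner[of x] inner_vec_def sum_distrib_right mult.assoc)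
  have 2: "(\<Sum>j\<in>UNIV. (norm (v x))\<^sup>2 + 2 * (x $ j * (p j x \<bullet> v x))) = real CARD('n) * (norm (v x))\<^sup>2 + 2 * (euler x \<bullet> v x)" for x
    by (simp add: sum.distrib euler_def inner_sum_left sum_distrib_left)
  have "(\<integral>x. \<kappa>' ((norm x)\<^sup>2) * 2 * (\<Sum>j\<in>UNIV. x $ j * (x $ j * (norm (v x))\<^sup>2))
      + \<kappa> ((norm x)\<^sup>2) * (\<Sum>j\<in>UNIV. (norm (v x))\<^sup>2 + 2 * (x $ j * (p j x \<bullet> v x))) \<partial>lborel) = 0"
    by (rule radial_divergence[where b = b, OF assms v_square_line_derivative])
      (assumption | intro continuous_intros v_cont p_cont)+
  then show ?thesis unfolding 1 2 by (simp add: algebra_simps)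
qed

end

text \<open>Real powers may be singular at 0. A cutoff that vanishes up to some a > 0 makes the
  product differentiable on the whole line, whatever values s takes on the nonpositive axis.\<close>

lemma DERIV_mult_vanishing:
  fixes \<theta> \<theta>' s s' :: "real \<Rightarrow> real"
  assumes "a > 0" and \<theta>: "\<And>q. (\<theta> has_real_derivative \<theta>' q) (at q)"
    and vanish: "\<And>q. q \<le> a \<Longrightarrow> \<theta> q = 0" "\<And>q. q \<le> a \<Longrightarrow> \<theta>' q = 0"
    and s: "\<And>q. q > 0 \<Longrightarrow> (s has_real_derivative s' q) (at q)"
  shows "((\<lambda>q. s q * \<theta> q) has_real_derivative s' q * \<theta> q + s q * \<theta>' q) (at q)"
proof (cases "q > 0")
  case True
  from DERIV_mult[OF s[OF this] \<theta>[of q]] show ?thesis by (simp add: mult.commute)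
next
  case False
  then have q: "q < a" using \<open>a > 0\<close> by simp
  have "((\<lambda>q. 0) has_real_derivative s' q * \<theta> q + s q * \<theta>' q) (at q)"
    using q by (simp add: vanish)
  then show ?thesis
    by (rule DERIV_cong_ev[THEN iffD1, rotated -1])
      (use q in \<open>auto simp: vanish intro: eventually_mono[OF eventually_nhds_in_open[of "{..<a}"]]\<close>)
qed

lemma continuous_on_mult_vanishing:
  fixes \<theta> s :: "real \<Rightarrow> real"
  assumes "a > 0" and \<theta>: "continuous_on UNIV \<theta>" and vanish: "\<And>q. q \<le> a \<Longrightarrow> \<theta> q = 0"
    and s: "continuous_on {0<..} s"
  shows "continuous_on UNIV (\<lambda>q. s q * \<theta> q)"
proof -
  have "continuous_on {..<a} (\<lambda>q. s q * \<theta> q)"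
    using continuous_on_const[of "{..<a}" 0] by (rule continuous_on_eq) (simp add: vanish)
  moreover have "continuous_on {0<..} (\<lambda>q. s q * \<theta> q)"
    by (intro continuous_intros s continuous_on_subset[OF \<theta>]) auto
  ultimately have "continuous_on ({..<a} \<union> {0<..}) (\<lambda>q. s q * \<theta> q)"
    by (intro continuous_on_open_Un) auto
  moreover have "{..<a} \<union> {0<..} = (UNIV :: real set)" using \<open>a > 0\<close> by auto
  ultimately show ?thesis by simp
qed

lemma integrable_radial_support:
  fixes f :: "'a::euclidean_space \<Rightarrow> real"
  assumes f: "continuous_on UNIV f" and supp: "\<And>x. (norm x)\<^sup>2 \<ge> b \<Longrightarrow> f x = 0"
  shows "integrable lborel f"
proof -
  define R where "R = sqrt (max b 0)"
  have R: "(norm x)\<^sup>2 \<ge> b" if "norm x \<ge> R" for x :: 'a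
    using that by (simp add: R_def norm_square_ge)
  have "integrable lborel (\<lambda>x. indicator (cball 0 R) x *\<^sub>R f x)"
    by (rule borel_integrable_compact) (auto intro: continuous_on_subset[OF f])
  moreover have "indicator (cball 0 R) x *\<^sub>R f x = f x" for x
    using R[of x] supp[of x] by (auto simp: indicator_def)
  ultimately show ?thesis by (simp only:)
qed

context C2_function
begin

text \<open>Since E applied to theta(|x|^2) is 2 q theta', the vector inside the norm on the right
  is (E + n/2)(theta v) + (G - s)(theta v). Dropping the two squares leaves twice the cross term.
  Its part with G integrates to zero, and its part with s gives the commutator 2 q s' theta^2
  |v|^2.\<close>

lemma carleman_C2:
  fixes \<theta> \<theta>' s s' :: "real \<Rightarrow> real"
  assumes "a > 0" and \<theta>: "\<And>q. (\<theta> has_real_derivative \<theta>' q) (at q)" and \<theta>': "continuous_on UNIV \<theta>'"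
    and vanish: "\<And>q. q \<le> a \<Longrightarrow> \<theta> q = 0" "\<And>q. q \<le> a \<Longrightarrow> \<theta>' q = 0"
    and supp: "\<And>q. q \<ge> b \<Longrightarrow> \<theta> q = 0" "\<And>q. q \<ge> b \<Longrightarrow> \<theta>' q = 0"
    and s: "\<And>q. q > 0 \<Longrightarrow> (s has_real_derivative s' q) (at q)" and s': "continuous_on {0<..} s'"
  shows "(\<integral>x. 2 * (norm x)\<^sup>2 * (s' ((norm x)\<^sup>2) * (\<theta> ((norm x)\<^sup>2))\<^sup>2) * (norm (v x))\<^sup>2 \<partial>lborel)
    \<le> (\<integral>x. (norm (\<theta> ((norm x)\<^sup>2) *\<^sub>R slash_dirac x + (2 * (norm x)\<^sup>2 * \<theta>' ((norm x)\<^sup>2)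
         + (real CARD('n) / 2 * \<theta> ((norm x)\<^sup>2) - s ((norm x)\<^sup>2) * \<theta> ((norm x)\<^sup>2))) *\<^sub>R v x))\<^sup>2 \<partial>lborel)"
proof -
  let ?n = "real CARD('n)"
  have \<theta>_cont: "continuous_on UNIV \<theta>"
    using \<theta> by (meson DERIV_continuous_on has_field_derivative_at_within)
  have s_cont: "continuous_on {0<..} s"
    by (rule DERIV_continuous_on[where D = s']) (auto intro: has_field_derivative_at_within s)
  note rad = continuous_on_radial
  note van = continuous_on_mult_vanishing[OF \<open>a > 0\<close>]
  define \<kappa>1 where "\<kappa>1 q = (\<theta> q)\<^sup>2" for q
  define \<kappa>1' where "\<kappa>1' q = 2 * (\<theta> q * \<theta>' q)" for q
  have \<kappa>1: "(\<kappa>1 has_real_derivative \<kappa>1' q) (at q)" for q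
    unfolding \<kappa>1_def[abs_def] \<kappa>1'_def by (auto intro!: derivative_eq_intros \<theta>)
  have \<kappa>1_cont: "continuous_on UNIV \<kappa>1" "continuous_on UNIV \<kappa>1'"
    unfolding \<kappa>1_def[abs_def] \<kappa>1'_def[abs_def] by (intro continuous_intros \<theta>_cont \<theta>')+
  define \<kappa>2 where "\<kappa>2 q = s q * \<kappa>1 q" for q
  define \<kappa>2' where "\<kappa>2' q = s' q * \<kappa>1 q + s q * \<kappa>1' q" for q
  have \<kappa>2: "(\<kappa>2 has_real_derivative \<kappa>2' q) (at q)" for q
    unfolding \<kappa>2_def[abs_def] \<kappa>2'_def
    by (rule DERIV_mult_vanishing[OF \<open>a > 0\<close> \<kappa>1 _ _ s]) (simp_all add: \<kappa>1_def \<kappa>1'_def vanish)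
  have s'\<kappa>1_cont: "continuous_on UNIV (\<lambda>q. s' q * \<kappa>1 q)"
    by (rule van[OF \<kappa>1_cont(1) _ s']) (simp add: \<kappa>1_def vanish)
  have \<kappa>2_cont: "continuous_on UNIV \<kappa>2" "continuous_on UNIV \<kappa>2'"
    unfolding \<kappa>2_def[abs_def] \<kappa>2'_def[abs_def]
    by (intro van continuous_on_add \<kappa>1_cont s_cont s'; simp add: \<kappa>1_def \<kappa>1'_def vanish)+
  have s\<theta>_cont: "continuous_on UNIV (\<lambda>q. s q * \<theta> q)"
    by (rule van[OF \<theta>_cont _ s_cont]) (simp add: vanish)
  let ?I1 = "\<lambda>x. \<kappa>1 ((norm x)\<^sup>2) * (2 * (euler x \<bullet> (slash_dirac x - euler x)) + ?n * (v x \<bullet> (slash_dirac x - euler x)))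
     + 2 * (norm x)\<^sup>2 * \<kappa>1' ((norm x)\<^sup>2) * (v x \<bullet> (slash_dirac x - euler x))"
  let ?I2 = "\<lambda>x. \<kappa>2 ((norm x)\<^sup>2) * (?n * (norm (v x))\<^sup>2 + 2 * (euler x \<bullet> v x))
     + 2 * (norm x)\<^sup>2 * \<kappa>2' ((norm x)\<^sup>2) * (norm (v x))\<^sup>2"
  let ?J = "\<lambda>x. 2 * (norm x)\<^sup>2 * (s' ((norm x)\<^sup>2) * \<kappa>1 ((norm x)\<^sup>2)) * (norm (v x))\<^sup>2"
  define F where "F x = \<theta> ((norm x)\<^sup>2) *\<^sub>R slash_dirac x + (2 * (norm x)\<^sup>2 * \<theta>' ((norm x)\<^sup>2)
         + (?n / 2 * \<theta> ((norm x)\<^sup>2) - s ((norm x)\<^sup>2) * \<theta> ((norm x)\<^sup>2))) *\<^sub>R v x" for x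
  have I1: "(\<integral>x. ?I1 x \<partial>lborel) = 0"
    by (rule commutator_identity[OF \<kappa>1 \<kappa>1_cont(2), where b = b]) (simp_all add: \<kappa>1_def \<kappa>1'_def supp)
  have I2: "(\<integral>x. ?I2 x \<partial>lborel) = 0"
    by (rule Euler_identity[OF \<kappa>2 \<kappa>2_cont(2), where b = b]) (simp_all add: \<kappa>2_def \<kappa>2'_def \<kappa>1_def \<kappa>1'_def supp)
  have i1: "integrable lborel ?I1"
    by (rule integrable_radial_support[where b = b])
      (intro continuous_intros rad \<kappa>1_cont v_cont euler_cont slash_dirac_cont, simp add: \<kappa>1_def \<kappa>1'_def supp)
  have i2: "integrable lborel ?I2"
    by (rule integrable_radial_support[where b = b])
      (intro continuous_intros rad \<kappa>2_cont v_cont euler_cont, simp add: \<kappa>2_def \<kappa>2'_def \<kappa>1_def \<kappa>1'_def supp)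
  have iJ: "integrable lborel ?J"
    by (rule integrable_radial_support[where b = b])
      (intro continuous_intros rad[OF s'\<kappa>1_cont] v_cont, simp add: \<kappa>1_def supp)
  have iF: "integrable lborel (\<lambda>x. (norm (F x))\<^sup>2)"
    unfolding F_def
    by (rule integrable_radial_support[where b = b])
      (intro continuous_intros rad[OF s\<theta>_cont] rad[OF \<theta>_cont] rad[OF \<theta>'] v_cont slash_dirac_cont, simp add: supp)
  have "?I1 x - ?I2 x + ?J x \<le> (norm (F x))\<^sup>2" for x
  proof -
    define q \<theta>q \<theta>'q sq where "q = (norm x)\<^sup>2" "\<theta>q = \<theta> q" "\<theta>'q = \<theta>' q" "sq = s q"
    note q = this
    define u where "u = \<theta>q *\<^sub>R euler x + (2 * q * \<theta>'q + ?n / 2 * \<theta>q) *\<^sub>R v x"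
    define w where "w = \<theta>q *\<^sub>R (slash_dirac x - euler x) - (sq * \<theta>q) *\<^sub>R v x"
    have "F x = u + w"
      by (simp add: F_def u_def w_def q(2-4) q(1)[symmetric] algebra_simps)
    then have "2 * (u \<bullet> w) \<le> (norm (F x))\<^sup>2"
      using inner_ge_zero[of u] inner_ge_zero[of w]
      by (simp add: power2_norm_eq_inner inner_add_left inner_add_right inner_commute)
    \<comment> \<open>\<open>?I1\<close> is the cross term with G. The one with -s is
      \<open>?J - ?I2\<close>: differentiating s theta^2 in \<open>?I2\<close> also hits s, and
      \<open>?J\<close> compensates exactly this.\<close>
    moreover have "2 * (u \<bullet> w) = ?I1 x - ?I2 x + ?J x"
      unfolding u_def w_def \<kappa>1_def \<kappa>1'_def \<kappa>2_def \<kappa>2'_def q(1)[symmetric] q(2-4)[symmetric]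
      by (simp add: power2_norm_eq_inner inner_add_left inner_add_right inner_diff_left inner_diff_right inner_commute
          power2_eq_square[of \<theta>q] algebra_simps)
    ultimately show ?thesis by simp
  qed
  then have "(\<integral>x. ?I1 x - ?I2 x + ?J x \<partial>lborel) \<le> (\<integral>x. (norm (F x))\<^sup>2 \<partial>lborel)"
    by (intro integral_mono iF Bochner_Integration.integrable_add Bochner_Integration.integrable_diff i1 i2 iJ)
  also have "(\<integral>x. ?I1 x - ?I2 x + ?J x \<partial>lborel) = (\<integral>x. ?J x \<partial>lborel)"
    by (subst Bochner_Integration.integral_add[OF Bochner_Integration.integrable_diff[OF i1 i2] iJ],
        subst Bochner_Integration.integral_diff[OF i1 i2]) (simp only: I1 I2)
  finally show ?thesis unfolding F_def \<kappa>1_def .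
qed

end

subsection \<open>The Carleman estimate for weak solutions\<close>

text \<open>Young's inequality with a small weight \<open>t\<close> on the limit bounds the
  difference of the squares. The choice of \<open>t\<close> makes the first contribution at most
  e/2, and the hypothesis makes the second one small.\<close>

lemma integral_norm_square_tendsto:
  fixes F :: "nat \<Rightarrow> 'a \<Rightarrow> 'b::euclidean_space"
  assumes F: "\<And>k. integrable M (\<lambda>x. (norm (F k x))\<^sup>2)" and f: "integrable M (\<lambda>x. (norm (f x))\<^sup>2)"
    and d: "\<And>k. integrable M (\<lambda>x. (norm (F k x - f x))\<^sup>2)"
    and lim: "(\<lambda>k. \<integral>x. (norm (F k x - f x))\<^sup>2 \<partial>M) \<longlonglongrightarrow> 0"
  shows "(\<lambda>k. \<integral>x. (norm (F k x))\<^sup>2 \<partial>M) \<longlonglongrightarrow> (\<integral>x. (norm (f x))\<^sup>2 \<partial>M)"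
proof (rule tendstoI)
  fix e :: real assume "e > 0"
  define S where "S = (\<integral>x. (norm (f x))\<^sup>2 \<partial>M)"
  have "S \<ge> 0" by (simp add: S_def)
  define t where "t = e / (2 * (S + 1))"
  have "t > 0" using \<open>e > 0\<close> \<open>S \<ge> 0\<close> by (simp add: t_def)
  have pt: "\<bar>(norm a)\<^sup>2 - (norm b)\<^sup>2\<bar> \<le> t * (norm b)\<^sup>2 + (1 + 1 / t) * (norm (a - b))\<^sup>2" for a b :: 'b
  proof -
    have "(norm a)\<^sup>2 - (norm b)\<^sup>2 = 2 * (b \<bullet> (a - b)) + (norm (a - b))\<^sup>2"
      by (simp add: power2_norm_eq_inner algebra_simps inner_commute)
    moreover have "2 * \<bar>b \<bullet> (a - b)\<bar> \<le> t * (norm b)\<^sup>2 + (1 / t) * (norm (a - b))\<^sup>2"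
    proof -
      have "\<bar>b \<bullet> (a - b)\<bar> \<le> norm b * norm (a - b)" by (rule Cauchy_Schwarz_ineq2)
      moreover have "0 \<le> (t * norm b - norm (a - b))\<^sup>2 / t" using \<open>t > 0\<close> by simp
      then have "2 * (norm b * norm (a - b)) \<le> t * (norm b)\<^sup>2 + (1 / t) * (norm (a - b))\<^sup>2"
        using \<open>t > 0\<close> by (simp add: field_simps power2_eq_square)
      ultimately show ?thesis by linarith
    qed
    moreover have "(norm (a - b))\<^sup>2 \<ge> 0" by simp
    ultimately show ?thesis unfolding distrib_right by linarith
  qed
  have "\<forall>\<^sub>F k in sequentially. (\<integral>x. (norm (F k x - f x))\<^sup>2 \<partial>M) < e / 2 / (1 + 1 / t)"
    using lim \<open>e > 0\<close> \<open>t > 0\<close> by (intro order_tendstoD(2)) (auto intro!: divide_pos_pos add_pos_pos)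
  then show "\<forall>\<^sub>F k in sequentially. dist (\<integral>x. (norm (F k x))\<^sup>2 \<partial>M) (\<integral>x. (norm (f x))\<^sup>2 \<partial>M) < e"
  proof eventually_elim
    case (elim k)
    have "dist (\<integral>x. (norm (F k x))\<^sup>2 \<partial>M) (\<integral>x. (norm (f x))\<^sup>2 \<partial>M) = \<bar>\<integral>x. (norm (F k x))\<^sup>2 - (norm (f x))\<^sup>2 \<partial>M\<bar>"
      by (simp add: dist_real_def Bochner_Integration.integral_diff[OF F f])
    also have "\<dots> \<le> (\<integral>x. \<bar>(norm (F k x))\<^sup>2 - (norm (f x))\<^sup>2\<bar> \<partial>M)" by (rule integral_abs_bound)
    also have "\<dots> \<le> (\<integral>x. t * (norm (f x))\<^sup>2 + (1 + 1 / t) * (norm (F k x - f x))\<^sup>2 \<partial>M)"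
      by (intro integral_mono integrable_abs Bochner_Integration.integrable_diff Bochner_Integration.integrable_add
          integrable_mult_right F f d pt)
    also have "\<dots> = t * S + (1 + 1 / t) * (\<integral>x. (norm (F k x - f x))\<^sup>2 \<partial>M)"
      unfolding S_def
      by (subst Bochner_Integration.integral_add[OF integrable_mult_right[OF f] integrable_mult_right[OF d]])
        (simp only: integral_mult_right_zero)
    also have "\<dots> < t * S + (1 + 1 / t) * (e / 2 / (1 + 1 / t))"
      using elim \<open>t > 0\<close> by (intro add_strict_left_mono mult_strict_left_mono) (auto intro: add_pos_pos)
    also have "(1 + 1 / t) * (e / 2 / (1 + 1 / t)) = e / 2"
    proof -
      define c where "c = 1 + 1 / t"
      have "c > 0" using \<open>t > 0\<close> by (simp add: c_def add_pos_pos)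
      then show ?thesis unfolding c_def[symmetric] by simp
    qed
    also have "t * S + e / 2 \<le> e / 2 + e / 2"
    proof -
      have "t * S = e / 2 * (S / (S + 1))" by (simp add: t_def)
      also have "\<dots> \<le> e / 2 * 1" using \<open>e > 0\<close> \<open>S \<ge> 0\<close> by (intro mult_left_mono) auto
      finally show ?thesis by simp
    qed
    finally show ?case by simp
  qed
qed

context clifford
begin

lemma norm_A: "norm (A j u) = norm u"
proof -
  have "A j u \<bullet> A j u = u \<bullet> u" by (simp add: symmetric_A)
  then show ?thesis by (simp add: norm_eq)
qed

lemma norm_slash: "norm (slash x u) = norm x * norm u"
  using norm_slash_square[of x u] by (simp flip: power_mult_distrib)

text \<open>Both sides of the Carleman estimate are squared L2 norms of such an expression, with f
  the function and g its gradient. It is linear in the pair (f, g), so one convergence result serves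
  both sides.\<close>

definition combo :: "(real^'n \<Rightarrow> real) \<Rightarrow> (real^'n \<Rightarrow> real) \<Rightarrow> (real^'n \<Rightarrow> 'b) \<Rightarrow> ('n \<Rightarrow> real^'n \<Rightarrow> 'b) \<Rightarrow> real^'n \<Rightarrow> 'b" where
  "combo c0 c1 f g x = c1 x *\<^sub>R slash x (\<Sum>j\<in>UNIV. A j (g j x)) + c0 x *\<^sub>R f x"

lemma combo_diff:
  "combo c0 c1 f g x - combo c0 c1 f' g' x = combo c0 c1 (\<lambda>x. f x - f' x) (\<lambda>j x. g j x - g' j x) x"
  by (simp add: combo_def A.diff sum_subtractf slash.diff scaleR_diff_right)

lemma combo_borel_measurable:
  assumes [measurable]: "c0 \<in> borel_measurable borel" "c1 \<in> borel_measurable borel" "f \<in> borel_measurable borel"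
    "\<And>j. g j \<in> borel_measurable borel"
  shows "combo c0 c1 f g \<in> borel_measurable borel"
proof -
  have [measurable]: "A j \<in> borel_measurable borel" for j
    by (intro borel_measurable_continuous_onI linear_continuous_on bounded_linear_A)
  have [measurable]: "(\<lambda>x :: real^'n. x $ k) \<in> borel_measurable borel" for k
    by (intro borel_measurable_continuous_onI continuous_intros)
  show ?thesis
    unfolding combo_def[abs_def] slash_def by measurable
qed

text \<open>\<open>K\<close> and \<open>R\<close> depend on the coefficients alone, so the same
  bound applies to the difference between mollified and original data.\<close>

lemma combo_bound:
  assumes c0: "continuous_on UNIV c0" and c1: "continuous_on UNIV c1"
    and supp: "\<And>x. (norm x)\<^sup>2 \<ge> b \<Longrightarrow> c0 x = 0" "\<And>x. (norm x)\<^sup>2 \<ge> b \<Longrightarrow> c1 x = 0"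
  obtains K R where "K \<ge> 0"
    "\<And>f g x. (norm (combo c0 c1 f g x))\<^sup>2 \<le> K * (indicator (cball 0 R) x * (norm (f x))\<^sup>2 + (\<Sum>j\<in>UNIV. indicator (cball 0 R) x * (norm (g j x))\<^sup>2))"
proof -
  define R where "R = sqrt (max b 0)"
  have "R \<ge> 0" by (simp add: R_def)
  have R: "(norm x)\<^sup>2 \<ge> b" if "norm x \<ge> R" for x :: "real^'n"
    using that by (simp add: R_def norm_square_ge)
  have "bounded (c0 ` cball 0 R)" "bounded (c1 ` cball 0 R)"
    by (intro compact_imp_bounded compact_continuous_image continuous_on_subset[OF c0] continuous_on_subset[OF c1]; simp)+
  then obtain M0 M1 where M: "M0 > 0" "M1 > 0" "\<And>x. norm x \<le> R \<Longrightarrow> \<bar>c0 x\<bar> \<le> M0" "\<And>x. norm x \<le> R \<Longrightarrow> \<bar>c1 x\<bar> \<le> M1"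
    unfolding bounded_pos by (metis image_eqI mem_cball_0 real_norm_def)
  define K where "K = 2 * (M1 * R)\<^sup>2 * real CARD('n) + 2 * M0\<^sup>2"
  show thesis
  proof
    show "K \<ge> 0" by (simp add: K_def)
    fix f :: "real^'n \<Rightarrow> 'b" and g x
    show "(norm (combo c0 c1 f g x))\<^sup>2 \<le> K * (indicator (cball 0 R) x * (norm (f x))\<^sup>2 + (\<Sum>j\<in>UNIV. indicator (cball 0 R) x * (norm (g j x))\<^sup>2))"
    proof (cases "norm x \<le> R")
      case False
      then show ?thesis using supp R by (simp add: combo_def)
    next
      case True
      let ?S = "\<Sum>j\<in>UNIV. (norm (g j x))\<^sup>2"
      have "?S \<ge> 0" by (simp add: sum_nonneg)
      have "norm (c1 x *\<^sub>R slash x (\<Sum>j\<in>UNIV. A j (g j x))) \<le> (M1 * R) * (\<Sum>j\<in>UNIV. norm (g j x))"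
        unfolding norm_scaleR norm_slash mult.assoc
        using True M \<open>R \<ge> 0\<close> norm_sum[of "\<lambda>j. A j (g j x)" UNIV]
        by (intro mult_mono) (auto simp: norm_A)
      then have "(norm (c1 x *\<^sub>R slash x (\<Sum>j\<in>UNIV. A j (g j x))))\<^sup>2 \<le> ((M1 * R) * (\<Sum>j\<in>UNIV. norm (g j x)))\<^sup>2"
        by (intro power_mono) auto
      also have "\<dots> \<le> (M1 * R)\<^sup>2 * (?S * real CARD('n))"
        unfolding power_mult_distrib[of "M1 * R"] by (intro mult_left_mono sum_squared_le_sum_of_squares) auto
      finally have 1: "(norm (c1 x *\<^sub>R slash x (\<Sum>j\<in>UNIV. A j (g j x))))\<^sup>2 \<le> (M1 * R)\<^sup>2 * (?S * real CARD('n))" .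
      have "(norm (c0 x *\<^sub>R f x))\<^sup>2 \<le> (M0 * norm (f x))\<^sup>2"
        using M True by (intro power_mono) (auto intro: mult_right_mono)
      then have 2: "(norm (c0 x *\<^sub>R f x))\<^sup>2 \<le> M0\<^sup>2 * (norm (f x))\<^sup>2" by (simp add: power_mult_distrib)
      have "(norm (combo c0 c1 f g x))\<^sup>2 \<le> 2 * ((M1 * R)\<^sup>2 * (?S * real CARD('n))) + 2 * (M0\<^sup>2 * (norm (f x))\<^sup>2)"
        unfolding combo_def using 1 2 by (intro order_trans[OF norm_add_square_le]) simp
      also have "\<dots> \<le> K * ((norm (f x))\<^sup>2 + ?S)"
        using \<open>?S \<ge> 0\<close> unfolding K_def by (simp add: algebra_simps)
      finally show ?thesis using True by simp
    qed
  qed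
qed

lemma combo_integrable:
  assumes c0: "continuous_on UNIV c0" and c1: "continuous_on UNIV c1"
    and supp: "\<And>x. (norm x)\<^sup>2 \<ge> b \<Longrightarrow> c0 x = 0" "\<And>x. (norm x)\<^sup>2 \<ge> b \<Longrightarrow> c1 x = 0"
    and f: "loc_L2 f" and g: "\<And>j. loc_L2 (g j)"
  shows "integrable lborel (\<lambda>x. (norm (combo c0 c1 f g x))\<^sup>2)"
proof -
  obtain K R where K: "K \<ge> 0"
    "\<And>f g x. (norm (combo c0 c1 f g x))\<^sup>2 \<le> K * (indicator (cball 0 R) x * (norm (f x))\<^sup>2 + (\<Sum>j\<in>UNIV. indicator (cball 0 R) x * (norm (g j x))\<^sup>2))"
    using combo_bound[where b = b, OF c0 c1 supp] by metis
  have [measurable]: "combo c0 c1 f g \<in> borel_measurable borel"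
    by (intro combo_borel_measurable borel_measurable_continuous_onI c0 c1 loc_L2_measurable f g)
  show ?thesis
  proof (rule Bochner_Integration.integrable_bound)
    show "integrable lborel (\<lambda>x. K * (indicator (cball 0 R) x * (norm (f x))\<^sup>2 + (\<Sum>j\<in>UNIV. indicator (cball 0 R) x * (norm (g j x))\<^sup>2)))"
      by (intro integrable_mult_right Bochner_Integration.integrable_add Bochner_Integration.integrable_sum loc_L2_integrable f g)
    show "AE x in lborel. norm ((norm (combo c0 c1 f g x))\<^sup>2) \<le>
      norm (K * (indicator (cball 0 R) x * (norm (f x))\<^sup>2 + (\<Sum>j\<in>UNIV. indicator (cball 0 R) x * (norm (g j x))\<^sup>2)))"
      unfolding real_norm_def abs_power2 by (intro AE_I2 order_trans[OF K(2) abs_ge_self])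
  qed measurable
qed

lemma combo_conv_tendsto:
  assumes c0: "continuous_on UNIV c0" and c1: "continuous_on UNIV c1"
    and supp: "\<And>x. (norm x)\<^sup>2 \<ge> b \<Longrightarrow> c0 x = 0" "\<And>x. (norm x)\<^sup>2 \<ge> b \<Longrightarrow> c1 x = 0"
    and f: "loc_L2 f" and g: "\<And>j. loc_L2 (g j)"
    and moll: "\<And>k. mollifier (\<eta> k) (r k)" and r: "r \<longlonglongrightarrow> 0"
  shows "(\<lambda>k. \<integral>x. (norm (combo c0 c1 (conv (\<eta> k (\<lambda>_. 0)) f) (\<lambda>j. conv (\<eta> k (\<lambda>_. 0)) (g j)) x))\<^sup>2 \<partial>lborel)
    \<longlonglongrightarrow> (\<integral>x. (norm (combo c0 c1 f g x))\<^sup>2 \<partial>lborel)"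
proof -
  obtain K R where K: "K \<ge> 0"
    "\<And>f g x. (norm (combo c0 c1 f g x))\<^sup>2 \<le> K * (indicator (cball 0 R) x * (norm (f x))\<^sup>2 + (\<Sum>j\<in>UNIV. indicator (cball 0 R) x * (norm (g j x))\<^sup>2))"
    using combo_bound[where b = b, OF c0 c1 supp] by metis
  have conv_L2: "loc_L2 (conv (\<eta> k (\<lambda>_. 0)) h)" if "loc_L2 h" for k and h :: "real^'n \<Rightarrow> 'b"
    by (intro continuous_loc_L2 mollifier.conv_continuous_on[OF moll] that)
  let ?D = "\<lambda>k h x. conv (\<eta> k (\<lambda>_. 0)) h x - h x"
  have i: "integrable lborel (\<lambda>x. indicator (cball 0 R) x * (norm (?D k h x))\<^sup>2)" if "loc_L2 h" for k and h :: "real^'n \<Rightarrow> 'b"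
    by (intro loc_L2_integrable loc_L2_diff conv_L2 that)
  note int = combo_integrable[where b = b, OF c0 c1 supp]
  show ?thesis
  proof (rule integral_norm_square_tendsto)
    show id: "integrable lborel (\<lambda>x. (norm (combo c0 c1 (conv (\<eta> k (\<lambda>_. 0)) f) (\<lambda>j. conv (\<eta> k (\<lambda>_. 0)) (g j)) x - combo c0 c1 f g x))\<^sup>2)" for k
      unfolding combo_diff by (intro int loc_L2_diff conv_L2 f g)
    have "(\<lambda>k. K * ((\<integral>x. indicator (cball 0 R) x * (norm (?D k f x))\<^sup>2 \<partial>lborel) + (\<Sum>j\<in>UNIV. \<integral>x. indicator (cball 0 R) x * (norm (?D k (g j) x))\<^sup>2 \<partial>lborel)))
      \<longlonglongrightarrow> K * (0 + (\<Sum>j\<in>(UNIV::'n set). 0))"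
      by (intro tendsto_intros mollification_tendsto[OF _ moll r] f g)
    then have lim: "(\<lambda>k. K * ((\<integral>x. indicator (cball 0 R) x * (norm (?D k f x))\<^sup>2 \<partial>lborel) + (\<Sum>j\<in>UNIV. \<integral>x. indicator (cball 0 R) x * (norm (?D k (g j) x))\<^sup>2 \<partial>lborel)))
      \<longlonglongrightarrow> 0" by simp
    show "(\<lambda>k. \<integral>x. (norm (combo c0 c1 (conv (\<eta> k (\<lambda>_. 0)) f) (\<lambda>j. conv (\<eta> k (\<lambda>_. 0)) (g j)) x - combo c0 c1 f g x))\<^sup>2 \<partial>lborel) \<longlonglongrightarrow> 0"
    proof (rule tendsto_sandwich[OF _ _ tendsto_const lim]; intro always_eventually allI)
      fix k
      have "(\<integral>x. (norm (combo c0 c1 (conv (\<eta> k (\<lambda>_. 0)) f) (\<lambda>j. conv (\<eta> k (\<lambda>_. 0)) (g j)) x - combo c0 c1 f g x))\<^sup>2 \<partial>lborel)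
         \<le> (\<integral>x. K * (indicator (cball 0 R) x * (norm (?D k f x))\<^sup>2 + (\<Sum>j\<in>UNIV. indicator (cball 0 R) x * (norm (?D k (g j) x))\<^sup>2)) \<partial>lborel)"
        using id[of k] unfolding combo_diff
        by (intro integral_mono integrable_mult_right Bochner_Integration.integrable_add Bochner_Integration.integrable_sum i f g K(2))
      also have "\<dots> = K * ((\<integral>x. indicator (cball 0 R) x * (norm (?D k f x))\<^sup>2 \<partial>lborel) + (\<Sum>j\<in>UNIV. \<integral>x. indicator (cball 0 R) x * (norm (?D k (g j) x))\<^sup>2 \<partial>lborel))"
        by (simp only: integral_mult_right_zero Bochner_Integration.integral_add[OF i[OF f] Bochner_Integration.integrable_sum[OF i[OF g]]]
            Bochner_Integration.integral_sum[OF i[OF g]])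
      finally show "(\<integral>x. (norm (combo c0 c1 (conv (\<eta> k (\<lambda>_. 0)) f) (\<lambda>j. conv (\<eta> k (\<lambda>_. 0)) (g j)) x - combo c0 c1 f g x))\<^sup>2 \<partial>lborel)
        \<le> K * ((\<integral>x. indicator (cball 0 R) x * (norm (?D k f x))\<^sup>2 \<partial>lborel) + (\<Sum>j\<in>UNIV. \<integral>x. indicator (cball 0 R) x * (norm (?D k (g j) x))\<^sup>2 \<partial>lborel))" .
    qed simp
    show "integrable lborel (\<lambda>x. (norm (combo c0 c1 f g x))\<^sup>2)" by (rule int) (assumption | rule f g)+
    show "integrable lborel (\<lambda>x. (norm (combo c0 c1 (conv (\<eta> k (\<lambda>_. 0)) f) (\<lambda>j. conv (\<eta> k (\<lambda>_. 0)) (g j)) x))\<^sup>2)" for k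
      by (rule int) (assumption | rule conv_L2 f g)+
  qed
qed

text \<open>Mollification turns psi into a smooth function whose gradient is the mollified
  \<open>g\<close>. The coefficients stay fixed, continuous and compactly supported while the kernel
  shrinks, so convergence in L2 on a ball suffices for the limit.\<close>

lemma carleman_weak:
  fixes \<theta> \<theta>' s s' :: "real \<Rightarrow> real" and \<psi> :: "real^'n \<Rightarrow> 'b" and g :: "'n \<Rightarrow> real^'n \<Rightarrow> 'b"
  assumes \<psi>: "loc_L2 \<psi>" and g: "\<And>j. loc_L2 (g j)"
    and weak: "\<And>\<eta> r j x. mollifier \<eta> r \<Longrightarrow> conv (\<eta> ((\<lambda>_. 0)(j := 1))) \<psi> x = conv (\<eta> (\<lambda>_. 0)) (g j) x"
    and "a > 0" and \<theta>: "\<And>q. (\<theta> has_real_derivative \<theta>' q) (at q)" and \<theta>': "continuous_on UNIV \<theta>'"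
    and vanish: "\<And>q. q \<le> a \<Longrightarrow> \<theta> q = 0" "\<And>q. q \<le> a \<Longrightarrow> \<theta>' q = 0"
    and supp: "\<And>q. q \<ge> b \<Longrightarrow> \<theta> q = 0" "\<And>q. q \<ge> b \<Longrightarrow> \<theta>' q = 0"
    and s: "\<And>q. q > 0 \<Longrightarrow> (s has_real_derivative s' q) (at q)" and s': "continuous_on {0<..} s'"
    and s'_nonneg: "\<And>q. q > 0 \<Longrightarrow> s' q \<ge> 0"
  shows "(\<integral>x. 2 * (norm x)\<^sup>2 * (s' ((norm x)\<^sup>2) * (\<theta> ((norm x)\<^sup>2))\<^sup>2) * (norm (\<psi> x))\<^sup>2 \<partial>lborel)
    \<le> (\<integral>x. (norm (\<theta> ((norm x)\<^sup>2) *\<^sub>R slash x (\<Sum>j\<in>UNIV. A j (g j x)) + (2 * (norm x)\<^sup>2 * \<theta>' ((norm x)\<^sup>2)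
         + (real CARD('n) / 2 * \<theta> ((norm x)\<^sup>2) - s ((norm x)\<^sup>2) * \<theta> ((norm x)\<^sup>2))) *\<^sub>R \<psi> x))\<^sup>2 \<partial>lborel)"
proof -
  have \<theta>_cont: "continuous_on UNIV \<theta>"
    using \<theta> by (meson DERIV_continuous_on has_field_derivative_at_within)
  have s_cont: "continuous_on {0<..} s"
    by (rule DERIV_continuous_on[where D = s']) (auto intro: has_field_derivative_at_within s)
  note van = continuous_on_mult_vanishing[OF \<open>a > 0\<close>]
  have s\<theta>_cont: "continuous_on UNIV (\<lambda>q. s q * \<theta> q)"
    by (rule van[OF \<theta>_cont _ s_cont]) (simp add: vanish)
  have s'\<theta>_cont: "continuous_on UNIV (\<lambda>q. s' q * (\<theta> q)\<^sup>2)"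
    by (rule van[OF _ _ s']) (auto simp: vanish intro!: continuous_intros \<theta>_cont)
  have rad: "continuous_on UNIV (\<lambda>x :: real^'n. \<kappa> ((norm x)\<^sup>2))" if "continuous_on UNIV \<kappa>" for \<kappa> :: "real \<Rightarrow> real"
    by (rule continuous_on_compose2[OF that]) (auto intro!: continuous_intros)
  \<comment> \<open>The square root turns the left-hand side into the squared norm of a
    \<open>combo\<close>; the radicand is nonnegative since s' is.\<close>
  define w where "w x = sqrt (2 * (norm x)\<^sup>2 * (s' ((norm x)\<^sup>2) * (\<theta> ((norm x)\<^sup>2))\<^sup>2))" for x :: "real^'n"
  have w2: "(norm (combo w (\<lambda>_. 0) f g x))\<^sup>2 = 2 * (norm x)\<^sup>2 * (s' ((norm x)\<^sup>2) * (\<theta> ((norm x)\<^sup>2))\<^sup>2) * (norm (f x))\<^sup>2"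
    for f g x
  proof -
    have "(norm x)\<^sup>2 * (s' ((norm x)\<^sup>2) * (\<theta> ((norm x)\<^sup>2))\<^sup>2) \<ge> 0"
      using s'_nonneg[of "(norm x)\<^sup>2"] by (cases "x = 0") auto
    then show ?thesis by (simp add: combo_def w_def power_mult_distrib)
  qed
  have w_cont: "continuous_on UNIV w"
    unfolding w_def[abs_def] by (intro continuous_intros rad[OF s'\<theta>_cont])
  define c0 where "c0 x = 2 * (norm x)\<^sup>2 * \<theta>' ((norm x)\<^sup>2)
         + (real CARD('n) / 2 * \<theta> ((norm x)\<^sup>2) - s ((norm x)\<^sup>2) * \<theta> ((norm x)\<^sup>2))" for x :: "real^'n"
  have c0_cont: "continuous_on UNIV c0"
    unfolding c0_def[abs_def] by (intro continuous_intros rad[OF s\<theta>_cont] rad[OF \<theta>_cont] rad[OF \<theta>'])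
  have "\<forall>k. \<exists>\<eta> :: ('n \<Rightarrow> nat) \<Rightarrow> real^'n \<Rightarrow> real. mollifier \<eta> (1 / real (Suc k))"
    by (metis mollifier_exists of_nat_0_less_iff zero_less_Suc zero_less_divide_1_iff)
  then obtain \<eta> :: "nat \<Rightarrow> ('n \<Rightarrow> nat) \<Rightarrow> real^'n \<Rightarrow> real" where \<eta>: "\<And>k. mollifier (\<eta> k) (1 / real (Suc k))"
    by metis
  have r: "(\<lambda>k. 1 / real (Suc k)) \<longlonglongrightarrow> 0" by (rule LIMSEQ_Suc[OF lim_1_over_n])
  have le: "(\<integral>x. (norm (combo w (\<lambda>_. 0) (conv (\<eta> k (\<lambda>_. 0)) \<psi>) (\<lambda>j. conv (\<eta> k (\<lambda>_. 0)) (g j)) x))\<^sup>2 \<partial>lborel)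
    \<le> (\<integral>x. (norm (combo c0 (\<lambda>x. \<theta> ((norm x)\<^sup>2)) (conv (\<eta> k (\<lambda>_. 0)) \<psi>) (\<lambda>j. conv (\<eta> k (\<lambda>_. 0)) (g j)) x))\<^sup>2 \<partial>lborel)" for k
  proof -
    interpret mollifier "\<eta> k" "1 / real (Suc k)" by (rule \<eta>)
    interpret C2_function A "conv (\<eta> k (\<lambda>_. 0)) \<psi>" "\<lambda>j. conv (\<eta> k (\<lambda>_. 0)) (g j)"
      "\<lambda>j l. conv (\<eta> k ((\<lambda>_. 0)(l := 1))) (g j)"
    proof
      fix j l x
      show "(conv (\<eta> k (\<lambda>_. 0)) \<psi> has_derivative (\<lambda>h. \<Sum>j\<in>UNIV. h $ j *\<^sub>R conv (\<eta> k (\<lambda>_. 0)) (g j) x)) (at x)"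
        using conv_has_derivative[OF \<psi>, of "\<lambda>_. 0" x] weak[OF \<eta>] by simp
      show "(conv (\<eta> k (\<lambda>_. 0)) (g j) has_derivative (\<lambda>h. \<Sum>l\<in>UNIV. h $ l *\<^sub>R conv (\<eta> k ((\<lambda>_. 0)(l := 1))) (g j) x)) (at x)"
        using conv_has_derivative[OF g, of "\<lambda>_. 0" j x] by simp
      \<comment> \<open>The same function is differentiated twice over: once as a convolution with
        \<open>g j\<close>, once as a convolution of the differentiated kernel with \<psi>.
        Uniqueness of the derivative identifies the results, and in the second form the two
        increments of the multi-index commute. This is the required symmetry of second
        derivatives.\<close>
      have mixed: "conv (\<eta> k ((\<lambda>_. 0)(l := 1))) (g j) x
          = conv (\<eta> k (((\<lambda>_. 0)(j := 1))(l := Suc (((\<lambda>_. 0)(j := 1)) l)))) \<psi> x" for j l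
      proof -
        let ?m = "(\<lambda>_. 0)(j := 1) :: 'n \<Rightarrow> nat"
        have "conv (\<eta> k ?m) \<psi> = conv (\<eta> k (\<lambda>_. 0)) (g j)" using weak[OF \<eta>] by (intro ext)
        then have "(conv (\<eta> k (\<lambda>_. 0)) (g j) has_derivative (\<lambda>h. \<Sum>i\<in>UNIV. h $ i *\<^sub>R conv (\<eta> k (?m(i := Suc (?m i)))) \<psi> x)) (at x)"
          using conv_has_derivative[OF \<psi>, of ?m x] by simp
        moreover have "(conv (\<eta> k (\<lambda>_. 0)) (g j) has_derivative (\<lambda>h. \<Sum>i\<in>UNIV. h $ i *\<^sub>R conv (\<eta> k ((\<lambda>_. 0)(i := 1))) (g j) x)) (at x)"
          using conv_has_derivative[OF g, of "\<lambda>_. 0" j x] by simp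
        ultimately have "(\<lambda>h. \<Sum>i\<in>UNIV. h $ i *\<^sub>R conv (\<eta> k (?m(i := Suc (?m i)))) \<psi> x)
            = (\<lambda>h :: real^'n. \<Sum>i\<in>UNIV. h $ i *\<^sub>R conv (\<eta> k ((\<lambda>_. 0)(i := 1))) (g j) x)"
          by (rule has_derivative_unique)
        then have eq: "(\<Sum>i\<in>UNIV. axis l 1 $ i *\<^sub>R conv (\<eta> k (?m(i := Suc (?m i)))) \<psi> x)
            = (\<Sum>i\<in>UNIV. axis l 1 $ i *\<^sub>R conv (\<eta> k ((\<lambda>_. 0)(i := 1))) (g j) x)"
          by (rule fun_cong)
        have ax: "(\<Sum>i\<in>UNIV. axis l 1 $ i *\<^sub>R y i) = y l" for y :: "'n \<Rightarrow> 'b"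
          by (subst sum.remove[of _ l]) (auto simp: axis_def intro!: sum.neutral)
        show ?thesis using eq unfolding ax by simp
      qed
      show "conv (\<eta> k ((\<lambda>_. 0)(l := 1))) (g j) x = conv (\<eta> k ((\<lambda>_. 0)(j := 1))) (g l) x"
        unfolding mixed by (cases "j = l") (simp_all add: fun_upd_twist)
      show "continuous_on UNIV (conv (\<eta> k ((\<lambda>_. 0)(l := 1))) (g j))"
        by (rule conv_continuous_on[OF g])
    qed
    show ?thesis
      using carleman_C2[OF \<open>a > 0\<close> \<theta> \<theta>' vanish supp s s']
      unfolding w2 by (simp add: combo_def c0_def slash_dirac_def dirac_sum_def)
  qed
  have "(\<integral>x. (norm (combo w (\<lambda>_. 0) \<psi> g x))\<^sup>2 \<partial>lborel) \<le> (\<integral>x. (norm (combo c0 (\<lambda>x. \<theta> ((norm x)\<^sup>2)) \<psi> g x))\<^sup>2 \<partial>lborel)"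
  proof (rule LIMSEQ_le)
    show "(\<lambda>k. \<integral>x. (norm (combo w (\<lambda>_. 0) (conv (\<eta> k (\<lambda>_. 0)) \<psi>) (\<lambda>j. conv (\<eta> k (\<lambda>_. 0)) (g j)) x))\<^sup>2 \<partial>lborel)
      \<longlonglongrightarrow> (\<integral>x. (norm (combo w (\<lambda>_. 0) \<psi> g x))\<^sup>2 \<partial>lborel)"
      by (rule combo_conv_tendsto[OF w_cont continuous_on_const _ _ \<psi> g \<eta> r, where b = b]) (simp_all add: w_def supp)
    show "(\<lambda>k. \<integral>x. (norm (combo c0 (\<lambda>x. \<theta> ((norm x)\<^sup>2)) (conv (\<eta> k (\<lambda>_. 0)) \<psi>) (\<lambda>j. conv (\<eta> k (\<lambda>_. 0)) (g j)) x))\<^sup>2 \<partial>lborel)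
      \<longlonglongrightarrow> (\<integral>x. (norm (combo c0 (\<lambda>x. \<theta> ((norm x)\<^sup>2)) \<psi> g x))\<^sup>2 \<partial>lborel)"
      by (rule combo_conv_tendsto[OF c0_cont rad[OF \<theta>_cont] _ _ \<psi> g \<eta> r, where b = b]) (simp_all add: c0_def supp)
  qed (use le in auto)
  then show ?thesis unfolding w2 by (simp add: combo_def c0_def)
qed

end

subsection \<open>Cutoffs and vanishing\<close>

lemma max_square_has_derivative: "((\<lambda>t. (max 0 t)\<^sup>2) has_real_derivative 2 * max 0 t) (at t)" for t :: real
proof -
  consider "t > 0" | "t < 0" | "t = 0" by linarith
  then show ?thesis
  proof cases
    case 1
    have "((\<lambda>t. t\<^sup>2) has_real_derivative 2 * max 0 t) (at t)"
      using 1 by (auto intro!: derivative_eq_intros)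
    then show ?thesis
      by (rule DERIV_cong_ev[THEN iffD1, rotated -1])
        (use 1 in \<open>auto intro: eventually_mono[OF eventually_nhds_in_open[of "{0<..}"]]\<close>)
  next
    case 2
    have "((\<lambda>t. 0) has_real_derivative 2 * max 0 t) (at t)"
      using 2 by auto
    then show ?thesis
      by (rule DERIV_cong_ev[THEN iffD1, rotated -1])
        (use 2 in \<open>auto intro: eventually_mono[OF eventually_nhds_in_open[of "{..<0}"]]\<close>)
  next
    case 3
    have "((\<lambda>h. ((max 0 h)\<^sup>2 - (max 0 0)\<^sup>2) / h) \<longlongrightarrow> 0) (at (0::real))"
    proof (rule Lim_null_comparison)
      show "\<forall>\<^sub>F h in at (0::real). norm (((max 0 h)\<^sup>2 - (max 0 0)\<^sup>2) / h) \<le> \<bar>h\<bar>"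
        by (auto simp: eventually_at_filter max_def power2_eq_square)
      show "((\<lambda>h. \<bar>h\<bar>) \<longlongrightarrow> 0) (at (0::real))" by (auto intro!: tendsto_eq_intros)
    qed
    then show ?thesis using 3 by (simp add: has_field_derivative_iff)
  qed
qed

text \<open>A $C^1$ step function: a quadratic spline with knots $0$, $1/2$ and $1$.\<close>

definition step :: "real \<Rightarrow> real" where
  "step t = 2 * ((max 0 t)\<^sup>2 - 2 * (max 0 (t - 1 / 2))\<^sup>2 + (max 0 (t - 1))\<^sup>2)"

definition step' :: "real \<Rightarrow> real" where
  "step' t = 4 * (max 0 t - 2 * max 0 (t - 1 / 2) + max 0 (t - 1))"

lemma step_has_derivative: "(step has_real_derivative step' t) (at t)"
proof -
  have "((\<lambda>t. (max 0 (t - c))\<^sup>2) has_real_derivative 2 * max 0 (t - c)) (at t)" for c :: real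
    using DERIV_chain'[OF DERIV_diff[OF DERIV_ident DERIV_const[of c]] max_square_has_derivative] by simp
  note d = this
  show ?thesis
    unfolding step_def[abs_def] step'_def
    using DERIV_cmult[OF DERIV_add[OF DERIV_diff[OF d[of 0] DERIV_cmult[OF d[of "1 / 2"], of 2]] d[of 1]], of 2]
    by (simp add: algebra_simps)
qed

lemma step'_cont: "continuous_on UNIV step'"
  unfolding step'_def[abs_def] by (intro continuous_intros)

lemma step_simps: "t \<le> 0 \<Longrightarrow> step t = 0" "t \<le> 0 \<Longrightarrow> step' t = 0" "t \<ge> 1 \<Longrightarrow> step t = 1" "t \<ge> 1 \<Longrightarrow> step' t = 0"
  by (auto simp: step_def step'_def max_def power2_eq_square algebra_simps)

lemma step'_bound: "\<bar>step' t\<bar> \<le> 2"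
  by (auto simp: step'_def max_def abs_if)

text \<open>The cutoff rises on [a, a + 1] and descends on [b, 2 b]. The length of the descent is
  proportional to b, so q xi'(q) is bounded there independently of b; this is what allows b to tend
  to infinity later.\<close>

lemma cutoff_exists:
  fixes a b :: real
  assumes "a > 0" "b \<ge> a + 1"
  obtains \<xi> \<xi>' :: "real \<Rightarrow> real" where
    "\<And>q. (\<xi> has_real_derivative \<xi>' q) (at q)" "continuous_on UNIV \<xi>'"
    "\<And>q. q \<le> a \<Longrightarrow> \<xi> q = 0" "\<And>q. q \<le> a \<Longrightarrow> \<xi>' q = 0"
    "\<And>q. q \<ge> 2 * b \<Longrightarrow> \<xi> q = 0" "\<And>q. q \<ge> 2 * b \<Longrightarrow> \<xi>' q = 0"
    "\<And>q. a + 1 \<le> q \<Longrightarrow> q \<le> b \<Longrightarrow> \<xi> q = 1" "\<And>q. a + 1 \<le> q \<Longrightarrow> q \<le> b \<Longrightarrow> \<xi>' q = 0"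
    "\<And>q. a \<le> q \<Longrightarrow> q \<le> a + 1 \<Longrightarrow> \<bar>2 * q * \<xi>' q\<bar> \<le> 4 * (a + 1)"
    "\<And>q. b \<le> q \<Longrightarrow> \<bar>2 * q * \<xi>' q\<bar> \<le> 8"
proof -
  define \<xi> where "\<xi> q = step (q - a) * step (2 - q / b)" for q
  define \<xi>' where "\<xi>' q = step' (q - a) * step (2 - q / b) - step (q - a) * (step' (2 - q / b) / b)" for q
  have b: "b > 0" using assms by simp
  show thesis
  proof
    show "(\<xi> has_real_derivative \<xi>' q) (at q)" for q
    proof -
      have 1: "((\<lambda>q. step (q - a)) has_real_derivative step' (q - a)) (at q)"
        using DERIV_chain'[OF DERIV_diff[OF DERIV_ident DERIV_const[of a]] step_has_derivative] by simp
      have "((\<lambda>q. 2 - q / b) has_real_derivative - (1 / b)) (at q)"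
        using b by (auto intro!: derivative_eq_intros)
      from DERIV_chain'[OF this step_has_derivative]
      have 2: "((\<lambda>q. step (2 - q / b)) has_real_derivative - (step' (2 - q / b) / b)) (at q)" by simp
      from DERIV_mult[OF 1 2] show ?thesis unfolding \<xi>_def[abs_def] \<xi>'_def by (simp add: algebra_simps)
    qed
    have sc: "continuous_on UNIV step"
      using step_has_derivative by (meson DERIV_continuous_on has_field_derivative_at_within)
    have c: "continuous_on UNIV (\<lambda>q. f (h q))" if "continuous_on UNIV f" "continuous_on UNIV h" for f h :: "real \<Rightarrow> real"
      by (rule continuous_on_compose2[OF that]) simp
    show "continuous_on UNIV \<xi>'"
      unfolding \<xi>'_def[abs_def]
      by (intro continuous_on_diff continuous_on_mult continuous_on_divide c[OF sc] c[OF step'_cont])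
        (use b in \<open>auto intro!: continuous_intros\<close>)
    show "\<xi> q = 0" "\<xi>' q = 0" if "q \<le> a" for q
      using that by (simp_all add: \<xi>_def \<xi>'_def step_simps)
    show "\<xi> q = 0" "\<xi>' q = 0" if "q \<ge> 2 * b" for q
    proof -
      have "2 - q / b \<le> 0" using that b by (simp add: field_simps)
      then show "\<xi> q = 0" "\<xi>' q = 0" by (simp_all add: \<xi>_def \<xi>'_def step_simps)
    qed
    show "\<xi> q = 1" "\<xi>' q = 0" if "a + 1 \<le> q" "q \<le> b" for q
    proof -
      have "2 - q / b \<ge> 1" using that b by (simp add: field_simps)
      then show "\<xi> q = 1" "\<xi>' q = 0" using that by (simp_all add: \<xi>_def \<xi>'_def step_simps)
    qed
    show "\<bar>2 * q * \<xi>' q\<bar> \<le> 4 * (a + 1)" if "a \<le> q" "q \<le> a + 1" for q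
    proof -
      have "2 - q / b \<ge> 1" using that b assms by (simp add: field_simps)
      then have "\<xi>' q = step' (q - a)" by (simp add: \<xi>'_def step_simps)
      then have "\<bar>2 * q * \<xi>' q\<bar> = 2 * q * \<bar>step' (q - a)\<bar>" using that assms by (simp add: abs_mult)
      also have "\<dots> \<le> 2 * (a + 1) * 2" using that assms step'_bound by (intro mult_mono) auto
      finally show ?thesis by simp
    qed
    show "\<bar>2 * q * \<xi>' q\<bar> \<le> 8" if "b \<le> q" for q
    proof (cases "q \<le> 2 * b")
      case True
      have "\<xi>' q = - (step' (2 - q / b) / b)" using that assms by (simp add: \<xi>'_def step_simps)
      then have "\<bar>2 * q * \<xi>' q\<bar> = 2 * q * \<bar>step' (2 - q / b)\<bar> / b" using that b by (simp add: abs_mult)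
      also have "\<dots> \<le> 2 * (2 * b) * 2 / b"
        using True that b step'_bound by (intro divide_right_mono mult_mono) auto
      also have "\<dots> = 8" using b by simp
      finally show ?thesis .
    next
      case False
      then have "2 - q / b \<le> 0" using b by (simp add: field_simps)
      then show ?thesis by (simp add: \<xi>'_def step_simps)
    qed
  qed
qed

lemma loc_L2_weight_integrable:
  fixes c :: "'a::euclidean_space \<Rightarrow> real"
  assumes f: "loc_L2 f" and c: "continuous_on UNIV c" and supp: "\<And>x. (norm x)\<^sup>2 \<ge> b \<Longrightarrow> c x = 0"
  shows "integrable lborel (\<lambda>x. c x * (norm (f x))\<^sup>2)"
proof -
  define R where "R = sqrt (max b 0)"
  have R: "(norm x)\<^sup>2 \<ge> b" if "norm x \<ge> R" for x :: 'a
    using that by (simp add: R_def norm_square_ge)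
  have "bounded (c ` cball 0 R)"
    by (intro compact_imp_bounded compact_continuous_image continuous_on_subset[OF c]) auto
  then obtain M where M: "M > 0" "\<And>x. norm x \<le> R \<Longrightarrow> \<bar>c x\<bar> \<le> M"
    unfolding bounded_pos by (metis image_eqI mem_cball_0 real_norm_def)
  have [measurable]: "f \<in> borel_measurable borel" "c \<in> borel_measurable borel"
    using f c by (auto intro: loc_L2_measurable borel_measurable_continuous_onI)
  show ?thesis
  proof (rule Bochner_Integration.integrable_bound)
    show "integrable lborel (\<lambda>x. M * (indicator (cball 0 R) x * (norm (f x))\<^sup>2))"
      by (intro integrable_mult_right loc_L2_integrable f)
    show "AE x in lborel. norm (c x * (norm (f x))\<^sup>2) \<le> norm (M * (indicator (cball 0 R) x * (norm (f x))\<^sup>2))"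
    proof (rule AE_I2)
      fix x
      show "norm (c x * (norm (f x))\<^sup>2) \<le> norm (M * (indicator (cball 0 R) x * (norm (f x))\<^sup>2))"
        using M R[of x] supp[of x] by (cases "norm x \<le> R") (auto simp: abs_mult intro!: mult_right_mono)
    qed
  qed measurable
qed

section \<open>Absorption of the potential\<close>

context clifford
begin

text \<open>\<open>W\<close> is the square of the weight Omega. The threshold on tau leaves a
  coefficient of at least 1 on the left: the commutator supplies 4 tau gamma^2, and the potential
  consumes 2 C^2, the factor 2 being the price of separating it from the derivative of the
  cutoff.\<close>

lemma carleman_cutoff:
  fixes \<psi> :: "real^'n \<Rightarrow> 'b" and g :: "'n \<Rightarrow> real^'n \<Rightarrow> 'b" and \<xi> \<xi>' :: "real \<Rightarrow> real"
  defines "W \<tau> \<gamma> q \<equiv> exp (2 * \<tau> * q powr \<gamma>) * q powr (- real CARD('n) / 2)"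
  assumes \<psi>: "loc_L2 \<psi>" and g: "\<And>j. loc_L2 (g j)"
    and weak: "\<And>\<eta> r j x. mollifier \<eta> r \<Longrightarrow> conv (\<eta> ((\<lambda>_. 0)(j := 1))) \<psi> x = conv (\<eta> (\<lambda>_. 0)) (g j) x"
    and "\<gamma> > 0" and "\<rho> > 0" and "\<tau> > 0" and \<tau>: "4 * \<tau> * \<gamma>\<^sup>2 \<ge> 2 * C\<^sup>2 + 1"
    and eqn: "AE x in lborel. norm x > \<rho> \<longrightarrow> norm (\<Sum>j\<in>UNIV. A j (g j x)) \<le> C * norm x powr (\<gamma> - 1) * norm (\<psi> x)"
    and \<xi>: "\<And>q. (\<xi> has_real_derivative \<xi>' q) (at q)" and \<xi>': "continuous_on UNIV \<xi>'"
    and vanish: "\<And>q. q \<le> \<rho>\<^sup>2 \<Longrightarrow> \<xi> q = 0" "\<And>q. q \<le> \<rho>\<^sup>2 \<Longrightarrow> \<xi>' q = 0"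
    and supp: "\<And>q. q \<ge> b \<Longrightarrow> \<xi> q = 0" "\<And>q. q \<ge> b \<Longrightarrow> \<xi>' q = 0"
  shows "(\<integral>x. ((norm x)\<^sup>2 powr \<gamma> * W \<tau> \<gamma> ((norm x)\<^sup>2)) * (\<xi> ((norm x)\<^sup>2))\<^sup>2 * (norm (\<psi> x))\<^sup>2 \<partial>lborel)
    \<le> 2 * (\<integral>x. W \<tau> \<gamma> ((norm x)\<^sup>2) * (2 * (norm x)\<^sup>2 * \<xi>' ((norm x)\<^sup>2))\<^sup>2 * (norm (\<psi> x))\<^sup>2 \<partial>lborel)" (is "?L \<le> 2 * ?R")
    and "integrable lborel (\<lambda>x. ((norm x)\<^sup>2 powr \<gamma> * W \<tau> \<gamma> ((norm x)\<^sup>2)) * (\<xi> ((norm x)\<^sup>2))\<^sup>2 * (norm (\<psi> x))\<^sup>2)"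
    and "integrable lborel (\<lambda>x. W \<tau> \<gamma> ((norm x)\<^sup>2) * (2 * (norm x)\<^sup>2 * \<xi>' ((norm x)\<^sup>2))\<^sup>2 * (norm (\<psi> x))\<^sup>2)"
proof -
  let ?n = "real CARD('n)"
  define a where "a = \<rho>\<^sup>2"
  have "a > 0" using \<open>\<rho> > 0\<close> by (simp add: a_def)
  \<comment> \<open>A solution of 2 q Omega' = (s - n/2) Omega for the \<open>s\<close> defined
    below, chosen to cancel the zeroth-order terms of the conjugated operator.\<close>
  define \<Omega> where "\<Omega> q = exp (\<tau> * q powr \<gamma>) * q powr (- ?n / 4)" for q
  define \<Omega>' where "\<Omega>' q = (\<tau> * \<gamma> * q powr (\<gamma> - 1) - ?n / (4 * q)) * \<Omega> q" for q
  define s where "s q = 2 * \<tau> * \<gamma> * q powr \<gamma>" for q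
  define s' where "s' q = 2 * \<tau> * \<gamma>\<^sup>2 * q powr (\<gamma> - 1)" for q
  define \<theta> where "\<theta> q = \<Omega> q * \<xi> q" for q
  define \<theta>' where "\<theta>' q = \<Omega>' q * \<xi> q + \<Omega> q * \<xi>' q" for q
  note van_a = vanish[folded a_def]
  have \<Omega>: "(\<Omega> has_real_derivative \<Omega>' q) (at q)" if "q > 0" for q
  proof -
    have 1: "((\<lambda>q. exp (\<tau> * q powr \<gamma>)) has_real_derivative exp (\<tau> * q powr \<gamma>) * (\<tau> * (\<gamma> * q powr (\<gamma> - 1)))) (at q)"
      using that by (auto intro!: derivative_eq_intros)
    have 2: "((\<lambda>q. q powr (- ?n / 4)) has_real_derivative (- ?n / 4) * q powr (- ?n / 4 - 1)) (at q)"
      by (rule has_real_derivative_powr[OF that])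
    have 3: "q powr (c - 1) = q powr c / q" for c
      using that by (simp add: powr_diff)
    from DERIV_mult[OF 1 2] show ?thesis
      unfolding \<Omega>_def[abs_def] \<Omega>'_def 3 using that by (simp add: field_simps)
  qed
  have powr_cont: "continuous_on {0<..} (\<lambda>q :: real. q powr c)" for c
    by (intro continuous_intros) auto
  have \<Omega>_cont: "continuous_on {0<..} \<Omega>" "continuous_on {0<..} \<Omega>'"
    unfolding \<Omega>_def[abs_def] \<Omega>'_def[abs_def] by (intro continuous_intros powr_cont; simp)+
  have s: "(s has_real_derivative s' q) (at q)" if "q > 0" for q
    unfolding s_def[abs_def] s'_def using that
    by (auto intro!: derivative_eq_intros simp: power2_eq_square)
  have s'_cont: "continuous_on {0<..} s'"
    unfolding s'_def[abs_def] by (intro continuous_intros powr_cont)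
  have \<xi>_cont: "continuous_on UNIV \<xi>"
    using \<xi> by (meson DERIV_continuous_on has_field_derivative_at_within)
  have W: "W \<tau> \<gamma> q = (\<Omega> q)\<^sup>2" for q
  proof -
    have "exp (2 * \<tau> * q powr \<gamma>) = exp (\<tau> * q powr \<gamma>) * exp (\<tau> * q powr \<gamma>)"
      by (simp add: algebra_simps flip: exp_add)
    moreover have "q powr (- ?n / 2) = q powr (- ?n / 4) * q powr (- ?n / 4)"
      by (simp flip: powr_add)
    ultimately show ?thesis by (simp only: W_def \<Omega>_def power2_eq_square mult_ac)
  qed
  have W_cont: "continuous_on {0<..} (W \<tau> \<gamma>)"
    unfolding W by (intro continuous_intros \<Omega>_cont)
  note van = continuous_on_mult_vanishing[OF \<open>a > 0\<close>]
  have rad: "continuous_on UNIV (\<lambda>x :: real^'n. \<kappa> ((norm x)\<^sup>2))" if "continuous_on UNIV \<kappa>" for \<kappa> :: "real \<Rightarrow> real"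
    by (rule continuous_on_compose2[OF that]) (auto intro!: continuous_intros)
  have \<theta>: "(\<theta> has_real_derivative \<theta>' q) (at q)" for q
    unfolding \<theta>_def[abs_def] \<theta>'_def
    by (rule DERIV_mult_vanishing[OF \<open>a > 0\<close> \<xi> van_a \<Omega>])
  have \<theta>'_cont: "continuous_on UNIV \<theta>'"
    unfolding \<theta>'_def[abs_def] by (intro continuous_on_add van \<xi>_cont \<xi>' \<Omega>_cont van_a)
  have carleman: "(\<integral>x. 2 * (norm x)\<^sup>2 * (s' ((norm x)\<^sup>2) * (\<theta> ((norm x)\<^sup>2))\<^sup>2) * (norm (\<psi> x))\<^sup>2 \<partial>lborel)
    \<le> (\<integral>x. (norm (\<theta> ((norm x)\<^sup>2) *\<^sub>R slash x (\<Sum>j\<in>UNIV. A j (g j x)) + (2 * (norm x)\<^sup>2 * \<theta>' ((norm x)\<^sup>2)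
         + (?n / 2 * \<theta> ((norm x)\<^sup>2) - s ((norm x)\<^sup>2) * \<theta> ((norm x)\<^sup>2))) *\<^sub>R \<psi> x))\<^sup>2 \<partial>lborel)"
    by (rule carleman_weak[OF \<psi> g weak \<open>a > 0\<close> \<theta> \<theta>'_cont _ _ _ _ s s'_cont, where b = b])
      (use \<open>\<tau> > 0\<close> in \<open>auto simp: \<theta>_def \<theta>'_def van_a supp s'_def\<close>)
  let ?w1 = "\<lambda>q. (q powr \<gamma> * W \<tau> \<gamma> q) * (\<xi> q)\<^sup>2"
  let ?w2 = "\<lambda>q. W \<tau> \<gamma> q * (2 * q * \<xi>' q)\<^sup>2"
  have w1_cont: "continuous_on UNIV ?w1"
    by (rule van) (auto simp: van_a intro!: continuous_intros \<xi>_cont W_cont)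
  have w2_cont: "continuous_on UNIV ?w2"
    by (rule van) (auto simp: van_a intro!: continuous_intros \<xi>' W_cont)
  show i1: "integrable lborel (\<lambda>x. ((norm x)\<^sup>2 powr \<gamma> * W \<tau> \<gamma> ((norm x)\<^sup>2)) * (\<xi> ((norm x)\<^sup>2))\<^sup>2 * (norm (\<psi> x))\<^sup>2)"
    by (rule loc_L2_weight_integrable[OF \<psi> rad[OF w1_cont], where b = b]) (simp add: supp)
  show i2: "integrable lborel (\<lambda>x. W \<tau> \<gamma> ((norm x)\<^sup>2) * (2 * (norm x)\<^sup>2 * \<xi>' ((norm x)\<^sup>2))\<^sup>2 * (norm (\<psi> x))\<^sup>2)"
    by (rule loc_L2_weight_integrable[OF \<psi> rad[OF w2_cont], where b = b]) (simp add: supp)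
  have lhs: "2 * (norm x)\<^sup>2 * (s' ((norm x)\<^sup>2) * (\<theta> ((norm x)\<^sup>2))\<^sup>2) * (norm (\<psi> x))\<^sup>2
     = (4 * \<tau> * \<gamma>\<^sup>2) * (((norm x)\<^sup>2 powr \<gamma> * W \<tau> \<gamma> ((norm x)\<^sup>2)) * (\<xi> ((norm x)\<^sup>2))\<^sup>2 * (norm (\<psi> x))\<^sup>2)" for x
  proof (cases "x = 0")
    case True
    then show ?thesis using \<open>\<gamma> > 0\<close> by simp
  next
    case False
    then have "(norm x)\<^sup>2 powr \<gamma> = (norm x)\<^sup>2 * (norm x)\<^sup>2 powr (\<gamma> - 1)"
      by (simp add: powr_diff)
    then show ?thesis by (simp add: s'_def \<theta>_def W power_mult_distrib)
  qed
  have rhs: "AE x in lborel. (norm (\<theta> ((norm x)\<^sup>2) *\<^sub>R slash x (\<Sum>j\<in>UNIV. A j (g j x)) + (2 * (norm x)\<^sup>2 * \<theta>' ((norm x)\<^sup>2)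
         + (?n / 2 * \<theta> ((norm x)\<^sup>2) - s ((norm x)\<^sup>2) * \<theta> ((norm x)\<^sup>2))) *\<^sub>R \<psi> x))\<^sup>2
     \<le> 2 * C\<^sup>2 * (((norm x)\<^sup>2 powr \<gamma> * W \<tau> \<gamma> ((norm x)\<^sup>2)) * (\<xi> ((norm x)\<^sup>2))\<^sup>2 * (norm (\<psi> x))\<^sup>2)
       + 2 * (W \<tau> \<gamma> ((norm x)\<^sup>2) * (2 * (norm x)\<^sup>2 * \<xi>' ((norm x)\<^sup>2))\<^sup>2 * (norm (\<psi> x))\<^sup>2)"
    using eqn
  proof eventually_elim
    case (elim x)
    define q where "q = (norm x)\<^sup>2"
    define Z where "Z = slash x (\<Sum>j\<in>UNIV. A j (g j x))"
    have "(norm (\<theta> q *\<^sub>R Z + (2 * q * \<theta>' q + (?n / 2 * \<theta> q - s q * \<theta> q)) *\<^sub>R \<psi> x))\<^sup>2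
      \<le> 2 * C\<^sup>2 * ((q powr \<gamma> * W \<tau> \<gamma> q) * (\<xi> q)\<^sup>2 * (norm (\<psi> x))\<^sup>2) + 2 * (W \<tau> \<gamma> q * (2 * q * \<xi>' q)\<^sup>2 * (norm (\<psi> x))\<^sup>2)"
    proof (cases "norm x \<le> \<rho>")
      case True
      then have "q \<le> a" unfolding q_def a_def by (intro power_mono) auto
      then show ?thesis by (simp add: \<theta>_def \<theta>'_def van_a)
    next
      case False
      then have x: "norm x > 0" using \<open>\<rho> > 0\<close> by linarith
      then have q: "q > 0" by (simp add: q_def)
      have "norm Z = norm x * norm (\<Sum>j\<in>UNIV. A j (g j x))" by (simp add: Z_def norm_slash)
      also have "\<dots> \<le> norm x * (C * norm x powr (\<gamma> - 1) * norm (\<psi> x))"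
        using elim False by (intro mult_left_mono) auto
      also have "\<dots> = C * norm x powr \<gamma> * norm (\<psi> x)" using x by (simp add: powr_diff)
      finally have "(norm Z)\<^sup>2 \<le> (C * norm x powr \<gamma> * norm (\<psi> x))\<^sup>2" by (intro power_mono) auto
      also have "\<dots> = C\<^sup>2 * q powr \<gamma> * (norm (\<psi> x))\<^sup>2"
        using x by (simp add: q_def power_mult_distrib powr_power powr_powr mult.commute[of \<gamma> 2] flip: powr_numeral)
      finally have Z: "(norm Z)\<^sup>2 \<le> C\<^sup>2 * q powr \<gamma> * (norm (\<psi> x))\<^sup>2" .
      have "2 * q * \<Omega>' q = (s q - ?n / 2) * \<Omega> q"
        using q by (simp add: \<Omega>'_def s_def powr_diff field_simps)
      \<comment> \<open>By the differential equation for the weight, only the derivative of the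
        cutoff survives as a coefficient of \<psi>.\<close>
      then have "2 * q * \<theta>' q + (?n / 2 * \<theta> q - s q * \<theta> q) = \<Omega> q * (2 * q * \<xi>' q)"
        by (simp add: \<theta>_def \<theta>'_def distrib_left mult.assoc[symmetric]) (simp add: algebra_simps)
      then have "\<theta> q *\<^sub>R Z + (2 * q * \<theta>' q + (?n / 2 * \<theta> q - s q * \<theta> q)) *\<^sub>R \<psi> x
          = \<Omega> q *\<^sub>R (\<xi> q *\<^sub>R Z + (2 * q * \<xi>' q) *\<^sub>R \<psi> x)"
        by (simp add: \<theta>_def scaleR_add_right)
      then have "(norm (\<theta> q *\<^sub>R Z + (2 * q * \<theta>' q + (?n / 2 * \<theta> q - s q * \<theta> q)) *\<^sub>R \<psi> x))\<^sup>2
          = W \<tau> \<gamma> q * (norm (\<xi> q *\<^sub>R Z + (2 * q * \<xi>' q) *\<^sub>R \<psi> x))\<^sup>2"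
        by (simp only: W norm_scaleR power_mult_distrib power2_abs)
      also have "\<dots> \<le> W \<tau> \<gamma> q * (2 * (norm (\<xi> q *\<^sub>R Z))\<^sup>2 + 2 * (norm ((2 * q * \<xi>' q) *\<^sub>R \<psi> x))\<^sup>2)"
        by (intro mult_left_mono norm_add_square_le) (simp add: W)
      also have "\<dots> = W \<tau> \<gamma> q * (2 * ((\<xi> q)\<^sup>2 * (norm Z)\<^sup>2) + 2 * ((2 * q * \<xi>' q)\<^sup>2 * (norm (\<psi> x))\<^sup>2))"
        by (simp only: norm_scaleR power_mult_distrib[of "\<bar>_\<bar>"] power2_abs)
      also have "\<dots> \<le> W \<tau> \<gamma> q * (2 * ((\<xi> q)\<^sup>2 * (C\<^sup>2 * q powr \<gamma> * (norm (\<psi> x))\<^sup>2)) + 2 * ((2 * q * \<xi>' q)\<^sup>2 * (norm (\<psi> x))\<^sup>2))"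
        by (intro mult_left_mono add_right_mono Z) (simp_all add: W)
      also have "\<dots> = 2 * C\<^sup>2 * ((q powr \<gamma> * W \<tau> \<gamma> q) * (\<xi> q)\<^sup>2 * (norm (\<psi> x))\<^sup>2) + 2 * (W \<tau> \<gamma> q * (2 * q * \<xi>' q)\<^sup>2 * (norm (\<psi> x))\<^sup>2)"
        by (simp only: distrib_left mult_ac)
      finally show ?thesis .
    qed
    then show ?case by (simp only: q_def Z_def)
  qed
  have L_nonneg: "?L \<ge> 0"
    by (intro integral_nonneg_AE AE_I2) (simp add: W)
  have "(4 * \<tau> * \<gamma>\<^sup>2) * ?L = (\<integral>x. 2 * (norm x)\<^sup>2 * (s' ((norm x)\<^sup>2) * (\<theta> ((norm x)\<^sup>2))\<^sup>2) * (norm (\<psi> x))\<^sup>2 \<partial>lborel)"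
    unfolding lhs integral_mult_right_zero ..
  also note carleman
  also have "(\<integral>x. (norm (\<theta> ((norm x)\<^sup>2) *\<^sub>R slash x (\<Sum>j\<in>UNIV. A j (g j x)) + (2 * (norm x)\<^sup>2 * \<theta>' ((norm x)\<^sup>2)
         + (?n / 2 * \<theta> ((norm x)\<^sup>2) - s ((norm x)\<^sup>2) * \<theta> ((norm x)\<^sup>2))) *\<^sub>R \<psi> x))\<^sup>2 \<partial>lborel)
     \<le> (\<integral>x. 2 * C\<^sup>2 * (((norm x)\<^sup>2 powr \<gamma> * W \<tau> \<gamma> ((norm x)\<^sup>2)) * (\<xi> ((norm x)\<^sup>2))\<^sup>2 * (norm (\<psi> x))\<^sup>2)
       + 2 * (W \<tau> \<gamma> ((norm x)\<^sup>2) * (2 * (norm x)\<^sup>2 * \<xi>' ((norm x)\<^sup>2))\<^sup>2 * (norm (\<psi> x))\<^sup>2) \<partial>lborel)"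
    by (rule integral_mono_AE'[OF _ rhs])
      (intro Bochner_Integration.integrable_add integrable_mult_right i1 i2, intro AE_I2, simp add: W)
  also have "\<dots> = 2 * C\<^sup>2 * ?L + 2 * ?R"
    by (subst Bochner_Integration.integral_add[OF integrable_mult_right[OF i1] integrable_mult_right[OF i2]])
      (simp only: integral_mult_right_zero)
  finally have "(4 * \<tau> * \<gamma>\<^sup>2 - 2 * C\<^sup>2) * ?L \<le> 2 * ?R" by (simp only: left_diff_distrib)
  moreover have "1 * ?L \<le> (4 * \<tau> * \<gamma>\<^sup>2 - 2 * C\<^sup>2) * ?L"
    using \<tau> L_nonneg by (intro mult_right_mono) auto
  ultimately show "?L \<le> 2 * ?R" by linarith
qed

end

section \<open>Decay at infinity and the limit of large parameters\<close>

context clifford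
begin

text \<open>The right-hand side depends on tau only through its exponential and not at all on N. The
  inner transition of the cutoff ends at |x|^2 = rho^2 + 1 while the annulus starts at rho^2 + 2;
  large tau will exploit this gap between the two exponentials.\<close>

lemma decay_imp_annulus_bound:
  fixes \<psi> :: "real^'n \<Rightarrow> 'b" and g :: "'n \<Rightarrow> real^'n \<Rightarrow> 'b" and \<rho> :: real
  defines "h \<gamma> N x \<equiv> indicator {x. \<rho>\<^sup>2 + 2 \<le> (norm x)\<^sup>2 \<and> (norm x)\<^sup>2 \<le> N} x
      * ((norm x)\<^sup>2 powr \<gamma> * (norm x)\<^sup>2 powr (- real CARD('n) / 2) * (norm (\<psi> x))\<^sup>2)"
  assumes \<psi>: "loc_L2 \<psi>" and g: "\<And>j. loc_L2 (g j)"
    and weak: "\<And>\<eta> r j x. mollifier \<eta> r \<Longrightarrow> conv (\<eta> ((\<lambda>_. 0)(j := 1))) \<psi> x = conv (\<eta> (\<lambda>_. 0)) (g j) x"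
    and "\<gamma> > 0" and "\<rho> > 0" and "\<tau> > 0" and \<tau>: "4 * \<tau> * \<gamma>\<^sup>2 \<ge> 2 * C\<^sup>2 + 1"
    and eqn: "AE x in lborel. norm x > \<rho> \<longrightarrow> norm (\<Sum>j\<in>UNIV. A j (g j x)) \<le> C * norm x powr (\<gamma> - 1) * norm (\<psi> x)"
    and decay: "integrable lborel (\<lambda>x. indicator {x. norm x > \<rho>} x * (exp (2 * \<tau> * (norm x)\<^sup>2 powr \<gamma>) * (norm (\<psi> x))\<^sup>2))"
  shows "exp (2 * \<tau> * (\<rho>\<^sup>2 + 2) powr \<gamma>) * (\<integral>x. h \<gamma> N x \<partial>lborel)
    \<le> exp (2 * \<tau> * (\<rho>\<^sup>2 + 1) powr \<gamma>) * (2 * (4 * (\<rho>\<^sup>2 + 1))\<^sup>2 * \<rho>\<^sup>2 powr (- real CARD('n) / 2)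
        * (\<integral>x. indicator (cball 0 (sqrt (\<rho>\<^sup>2 + 1))) x * (norm (\<psi> x))\<^sup>2 \<partial>lborel))"
    and "integrable lborel (h \<gamma> N)"
proof -
  let ?n = "real CARD('n)"
  define a where "a = \<rho>\<^sup>2"
  have "a > 0" using \<open>\<rho> > 0\<close> by (simp add: a_def)
  define L where "L = a powr (- ?n / 2)"
  define W where "W q = exp (2 * \<tau> * q powr \<gamma>) * q powr (- ?n / 2)" for q
  define D where "D x = indicator {x. norm x > \<rho>} x * (exp (2 * \<tau> * (norm x)\<^sup>2 powr \<gamma>) * (norm (\<psi> x))\<^sup>2)" for x
  have D_int: "integrable lborel D" using decay by (simp add: D_def[abs_def])
  have D_nonneg: "D x \<ge> 0" for x by (simp add: D_def)
  have [measurable]: "\<psi> \<in> borel_measurable borel" using \<psi> by (rule loc_L2_measurable)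
  have D_meas [measurable]: "D \<in> borel_measurable borel" using D_int by (auto dest: borel_measurable_integrable)
  \<comment> \<open>The remainder of the convergent decay integral. It dominates, up to a constant,
    the error of a cutoff descending on [k, 2 k], and tends to 0 in k for fixed tau.\<close>
  define tail where "tail k = (\<integral>x. indicator {x. real k \<le> (norm x)\<^sup>2} x * D x \<partial>lborel)" for k :: nat
  have tail_int: "integrable lborel (\<lambda>x. indicator {x. real k \<le> (norm x)\<^sup>2} x * D x)" for k
    by (rule Bochner_Integration.integrable_bound[OF D_int], measurable) (auto simp: indicator_def)
  have "tail \<longlonglongrightarrow> (\<integral>x. 0 \<partial>(lborel :: (real^'n) measure))"
    unfolding tail_def
  proof (rule integral_dominated_convergence[OF _ _ D_int])
    show "AE x in lborel. (\<lambda>k. indicator {x. real k \<le> (norm x)\<^sup>2} x * D x) \<longlonglongrightarrow> 0"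
    proof (rule AE_I2)
      fix x :: "real^'n"
      obtain k0 where k0: "(norm x)\<^sup>2 < real k0" using reals_Archimedean2 by blast
      show "(\<lambda>k. indicator {x. real k \<le> (norm x)\<^sup>2} x * D x) \<longlonglongrightarrow> 0"
        by (intro tendsto_eventually eventually_sequentiallyI[of k0]) (use k0 in \<open>auto simp: indicator_def\<close>)
    qed
    show "AE x in lborel. norm (indicator {x. real k \<le> (norm x)\<^sup>2} x * D x) \<le> D x" for k
      using D_nonneg by (auto simp: indicator_def)
  qed measurable
  then have tail: "tail \<longlonglongrightarrow> 0" by simp
  define Q where "Q = (\<integral>x. indicator (cball 0 (sqrt (a + 1))) x * (norm (\<psi> x))\<^sup>2 \<partial>lborel)"
  define K where "K = (4 * (a + 1))\<^sup>2 * L * exp (2 * \<tau> * (a + 1) powr \<gamma>)"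
  have L_bound: "q powr (- ?n / 2) \<le> L" if "a \<le> q" for q
    unfolding L_def using that \<open>a > 0\<close> by (intro powr_mono2') auto
  have W_nonneg: "W q \<ge> 0" for q by (simp add: W_def)
  have h_meas [measurable]: "h \<gamma> N \<in> borel_measurable borel"
    unfolding h_def[abs_def] by measurable
  have h_nonneg: "h \<gamma> N x \<ge> 0" for x by (simp add: h_def)
  \<comment> \<open>\<open>K\<close> bounds the weight times the squared derivative term on the
    inner transition. On the outer one, 64 is the square of the bound 8 for the cutoff, and
    \<open>L\<close> bounds the negative power of q.\<close>
  have key: "integrable lborel (h \<gamma> N) \<and> exp (2 * \<tau> * (a + 2) powr \<gamma>) * (\<integral>x. h \<gamma> N x \<partial>lborel) \<le> 2 * (K * Q + 64 * L * tail k)"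
    if k: "real k \<ge> a + 1" "real k \<ge> N" for k
  proof -
    obtain \<xi> \<xi>' :: "real \<Rightarrow> real" where \<xi>:
      "\<And>q. (\<xi> has_real_derivative \<xi>' q) (at q)" "continuous_on UNIV \<xi>'"
      "\<And>q. q \<le> a \<Longrightarrow> \<xi> q = 0" "\<And>q. q \<le> a \<Longrightarrow> \<xi>' q = 0"
      "\<And>q. q \<ge> 2 * real k \<Longrightarrow> \<xi> q = 0" "\<And>q. q \<ge> 2 * real k \<Longrightarrow> \<xi>' q = 0"
      and \<xi>1: "\<And>q. a + 1 \<le> q \<Longrightarrow> q \<le> real k \<Longrightarrow> \<xi> q = 1" "\<And>q. a + 1 \<le> q \<Longrightarrow> q \<le> real k \<Longrightarrow> \<xi>' q = 0"
      and \<xi>2: "\<And>q. a \<le> q \<Longrightarrow> q \<le> a + 1 \<Longrightarrow> \<bar>2 * q * \<xi>' q\<bar> \<le> 4 * (a + 1)"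
      "\<And>q. real k \<le> q \<Longrightarrow> \<bar>2 * q * \<xi>' q\<bar> \<le> 8"
      using cutoff_exists[OF \<open>a > 0\<close> k(1)] by blast
    note cc = carleman_cutoff[OF \<psi> g weak \<open>\<gamma> > 0\<close> \<open>\<rho> > 0\<close> \<open>\<tau> > 0\<close> \<tau> eqn \<xi>(1,2) \<xi>(3,4)[unfolded a_def] \<xi>(5,6), folded W_def]
    let ?L = "\<lambda>x. ((norm x)\<^sup>2 powr \<gamma> * W ((norm x)\<^sup>2)) * (\<xi> ((norm x)\<^sup>2))\<^sup>2 * (norm (\<psi> x))\<^sup>2"
    let ?R = "\<lambda>x. W ((norm x)\<^sup>2) * (2 * (norm x)\<^sup>2 * \<xi>' ((norm x)\<^sup>2))\<^sup>2 * (norm (\<psi> x))\<^sup>2"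
    have le: "(\<integral>x. ?L x \<partial>lborel) \<le> 2 * (\<integral>x. ?R x \<partial>lborel)" and Li: "integrable lborel ?L" and Ri: "integrable lborel ?R"
      using cc by auto
    have hL: "exp (2 * \<tau> * (a + 2) powr \<gamma>) * h \<gamma> N x \<le> ?L x" for x
    proof (cases "a + 2 \<le> (norm x)\<^sup>2 \<and> (norm x)\<^sup>2 \<le> N")
      case True
      have "exp (2 * \<tau> * (a + 2) powr \<gamma>) \<le> exp (2 * \<tau> * (norm x)\<^sup>2 powr \<gamma>)"
        using True \<open>a > 0\<close> \<open>\<tau> > 0\<close> \<open>\<gamma> > 0\<close> by (auto intro!: mult_left_mono powr_mono2)
      then have "exp (2 * \<tau> * (a + 2) powr \<gamma>) * ((norm x)\<^sup>2 powr \<gamma> * (norm x)\<^sup>2 powr (- ?n / 2) * (norm (\<psi> x))\<^sup>2)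
          \<le> exp (2 * \<tau> * (norm x)\<^sup>2 powr \<gamma>) * ((norm x)\<^sup>2 powr \<gamma> * (norm x)\<^sup>2 powr (- ?n / 2) * (norm (\<psi> x))\<^sup>2)"
        by (rule mult_right_mono) simp
      moreover have "\<xi> ((norm x)\<^sup>2) = 1" using True k by (intro \<xi>1) auto
      ultimately show ?thesis using True by (simp add: h_def a_def W_def mult_ac)
    next
      case False
      then have "h \<gamma> N x = 0" by (auto simp: h_def a_def indicator_def)
      then show ?thesis using W_nonneg by simp
    qed
    have "integrable lborel (\<lambda>x. exp (2 * \<tau> * (a + 2) powr \<gamma>) * h \<gamma> N x)"
      by (rule Bochner_Integration.integrable_bound[OF Li], measurable) (use hL h_nonneg in \<open>auto intro!: AE_I2 order_trans[OF _ abs_ge_self]\<close>)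
    then have hi: "integrable lborel (h \<gamma> N)" by simp
    have "exp (2 * \<tau> * (a + 2) powr \<gamma>) * (\<integral>x. h \<gamma> N x \<partial>lborel) = (\<integral>x. exp (2 * \<tau> * (a + 2) powr \<gamma>) * h \<gamma> N x \<partial>lborel)"
      by simp
    also have "\<dots> \<le> (\<integral>x. ?L x \<partial>lborel)"
      by (intro integral_mono integrable_mult_right hi Li hL)
    also have "\<dots> \<le> 2 * (\<integral>x. ?R x \<partial>lborel)" by (rule le)
    also have "(\<integral>x. ?R x \<partial>lborel) \<le> (\<integral>x. K * (indicator (cball 0 (sqrt (a + 1))) x * (norm (\<psi> x))\<^sup>2)
        + 64 * L * (indicator {x. real k \<le> (norm x)\<^sup>2} x * D x) \<partial>lborel)"
    proof (rule integral_mono[OF Ri])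
      show "integrable lborel (\<lambda>x. K * (indicator (cball 0 (sqrt (a + 1))) x * (norm (\<psi> x))\<^sup>2)
        + 64 * L * (indicator {x. real k \<le> (norm x)\<^sup>2} x * D x))"
        by (intro Bochner_Integration.integrable_add integrable_mult_right loc_L2_integrable[OF \<psi>] tail_int)
      fix x :: "real^'n"
      define q where "q = (norm x)\<^sup>2"
      have KL: "K \<ge> 0" "L \<ge> 0" by (auto simp: K_def L_def)
      \<comment> \<open>The derivative of the cutoff lives on two zones: on the bounded inner one
        local square integrability is enough, on the outer one the decay hypothesis takes
        over.\<close>
      consider "q \<le> a \<or> (a + 1 \<le> q \<and> q \<le> real k)" | "a \<le> q" "q \<le> a + 1" | "real k \<le> q" by linarith
      then show "?R x \<le> K * (indicator (cball 0 (sqrt (a + 1))) x * (norm (\<psi> x))\<^sup>2)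
        + 64 * L * (indicator {x. real k \<le> (norm x)\<^sup>2} x * D x)"
      proof cases
        case 1
        then have "\<xi>' q = 0" using \<xi>(4) \<xi>1(2) by blast
        then show ?thesis using KL D_nonneg[of x] by (simp add: q_def)
      next
        case 2
        have "W q \<le> exp (2 * \<tau> * (a + 1) powr \<gamma>) * L"
          unfolding W_def using 2 \<open>a > 0\<close> \<open>\<tau> > 0\<close> \<open>\<gamma> > 0\<close>
          by (intro mult_mono L_bound) (auto intro!: mult_left_mono powr_mono2)
        moreover have "(2 * q * \<xi>' q)\<^sup>2 \<le> (4 * (a + 1))\<^sup>2"
          using \<xi>2(1)[OF 2] by (metis abs_ge_zero power2_abs power_mono)
        ultimately have "W q * (2 * q * \<xi>' q)\<^sup>2 \<le> (exp (2 * \<tau> * (a + 1) powr \<gamma>) * L) * (4 * (a + 1))\<^sup>2"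
          using KL by (intro mult_mono) auto
        also have "\<dots> = K" by (simp add: K_def)
        finally have "?R x \<le> K * (norm (\<psi> x))\<^sup>2" by (intro mult_right_mono) (auto simp: q_def)
        moreover have "norm x \<le> sqrt (a + 1)" using 2 by (intro real_le_rsqrt) (simp add: q_def)
        ultimately show ?thesis using KL D_nonneg[of x]
          by (simp add: add_increasing2)
      next
        case 3
        then have "a < q" using k by linarith
        then have "\<rho> < norm x" unfolding a_def q_def by (simp add: power2_less_imp_less)
        have "(2 * q * \<xi>' q)\<^sup>2 \<le> 8\<^sup>2"
          using \<xi>2(2)[OF 3] by (metis abs_ge_zero power2_abs power_mono)
        then have "W q * (2 * q * \<xi>' q)\<^sup>2 \<le> (exp (2 * \<tau> * q powr \<gamma>) * L) * 8\<^sup>2"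
          unfolding W_def using \<open>a < q\<close> KL by (intro mult_mono L_bound) auto
        then have "?R x \<le> ((exp (2 * \<tau> * q powr \<gamma>) * L) * 8\<^sup>2) * (norm (\<psi> x))\<^sup>2"
          unfolding q_def by (intro mult_right_mono) auto
        also have "\<dots> = 64 * L * (indicator {x. real k \<le> (norm x)\<^sup>2} x * D x)"
          using 3 \<open>\<rho> < norm x\<close> by (simp add: D_def q_def)
        finally show ?thesis using KL by (simp add: add_increasing)
      qed
    qed
    also have "\<dots> = K * Q + 64 * L * tail k"
      unfolding Q_def tail_def
      by (subst Bochner_Integration.integral_add[OF integrable_mult_right[OF loc_L2_integrable[OF \<psi>]] integrable_mult_right[OF tail_int]])
        (simp only: integral_mult_right_zero)
    finally show ?thesis using hi by simp
  qed
  obtain k0 :: nat where k0: "real k0 \<ge> max (a + 1) N" using real_arch_simple by blast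
  then have ev: "\<forall>k\<ge>k0. real k \<ge> a + 1 \<and> real k \<ge> N" by (auto intro: order_trans)
  show "integrable lborel (h \<gamma> N)" using key[of k0] ev by auto
  have "(\<lambda>k. 2 * (K * Q + 64 * L * tail k)) \<longlonglongrightarrow> 2 * (K * Q + 64 * L * 0)"
    by (intro tendsto_intros tail)
  then have "exp (2 * \<tau> * (a + 2) powr \<gamma>) * (\<integral>x. h \<gamma> N x \<partial>lborel) \<le> 2 * (K * Q + 64 * L * 0)"
    by (rule LIMSEQ_le_const) (use key ev in blast)
  then show "exp (2 * \<tau> * (\<rho>\<^sup>2 + 2) powr \<gamma>) * (\<integral>x. h \<gamma> N x \<partial>lborel)
    \<le> exp (2 * \<tau> * (\<rho>\<^sup>2 + 1) powr \<gamma>) * (2 * (4 * (\<rho>\<^sup>2 + 1))\<^sup>2 * \<rho>\<^sup>2 powr (- real CARD('n) / 2)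
        * (\<integral>x. indicator (cball 0 (sqrt (\<rho>\<^sup>2 + 1))) x * (norm (\<psi> x))\<^sup>2 \<partial>lborel))"
    by (simp add: K_def L_def Q_def a_def mult_ac)
qed

text \<open>Dividing the annulus bound by the smaller exponential gives exp(2 tau delta) T <= K,
  with T the integral of \<open>h N\<close> and K independent of tau. Large tau forces T = 0, and
  integer values of N exhaust the exterior region.\<close>

lemma decay_imp_vanishing:
  fixes \<psi> :: "real^'n \<Rightarrow> 'b" and g :: "'n \<Rightarrow> real^'n \<Rightarrow> 'b"
  assumes \<psi>: "loc_L2 \<psi>" and g: "\<And>j. loc_L2 (g j)"
    and weak: "\<And>\<eta> r j x. mollifier \<eta> r \<Longrightarrow> conv (\<eta> ((\<lambda>_. 0)(j := 1))) \<psi> x = conv (\<eta> (\<lambda>_. 0)) (g j) x"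
    and "\<gamma> > 0" and "\<rho> > 0"
    and eqn: "AE x in lborel. norm x > \<rho> \<longrightarrow> norm (\<Sum>j\<in>UNIV. A j (g j x)) \<le> C * norm x powr (\<gamma> - 1) * norm (\<psi> x)"
    and decay: "\<And>\<tau>. \<tau> > \<tau>\<^sub>0 \<Longrightarrow> integrable lborel (\<lambda>x. indicator {x. norm x > \<rho>} x * (exp (2 * \<tau> * (norm x)\<^sup>2 powr \<gamma>) * (norm (\<psi> x))\<^sup>2))"
  shows "AE x in lborel. \<rho>\<^sup>2 + 2 \<le> (norm x)\<^sup>2 \<longrightarrow> \<psi> x = 0"
proof -
  define h where "h N x = indicator {x. \<rho>\<^sup>2 + 2 \<le> (norm x)\<^sup>2 \<and> (norm x)\<^sup>2 \<le> N} x
      * ((norm x)\<^sup>2 powr \<gamma> * (norm x)\<^sup>2 powr (- real CARD('n) / 2) * (norm (\<psi> x))\<^sup>2)" for N and x :: "real^'n"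
  \<comment> \<open>The first entry puts tau strictly above the range where decay may fail and makes
    it positive; the second is the absorption threshold.\<close>
  define \<tau>1 where "\<tau>1 = max (\<bar>\<tau>\<^sub>0\<bar> + 1) ((2 * C\<^sup>2 + 1) / (4 * \<gamma>\<^sup>2))"
  define K where "K = 2 * (4 * (\<rho>\<^sup>2 + 1))\<^sup>2 * \<rho>\<^sup>2 powr (- real CARD('n) / 2)
        * (\<integral>x. indicator (cball 0 (sqrt (\<rho>\<^sup>2 + 1))) x * (norm (\<psi> x))\<^sup>2 \<partial>lborel)"
  have \<tau>1: "\<tau> > \<tau>\<^sub>0" "\<tau> > 0" "4 * \<tau> * \<gamma>\<^sup>2 \<ge> 2 * C\<^sup>2 + 1" if "\<tau> \<ge> \<tau>1" for \<tau>
    using that \<open>\<gamma> > 0\<close> by (auto simp: \<tau>1_def field_simps)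
  have bound: "exp (2 * \<tau> * (\<rho>\<^sup>2 + 2) powr \<gamma>) * (\<integral>x. h N x \<partial>lborel) \<le> exp (2 * \<tau> * (\<rho>\<^sup>2 + 1) powr \<gamma>) * K"
    and h_int: "integrable lborel (h N)" if "\<tau> \<ge> \<tau>1" for \<tau> N
    using decay_imp_annulus_bound[OF \<psi> g weak \<open>\<gamma> > 0\<close> \<open>\<rho> > 0\<close> \<tau>1(2,3)[OF that] eqn decay[OF \<tau>1(1)[OF that]], where N = N]
    by (simp_all add: h_def[abs_def] K_def)
  define \<delta> where "\<delta> = (\<rho>\<^sup>2 + 2) powr \<gamma> - (\<rho>\<^sup>2 + 1) powr \<gamma>"
  have "\<delta> > 0" using \<open>\<gamma> > 0\<close> by (simp add: \<delta>_def powr_less_mono2 add_nonneg_pos)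
  have h_nonneg: "h N x \<ge> 0" for N x by (simp add: h_def)
  have "(\<integral>x. h N x \<partial>lborel) = 0" for N
  proof (rule ccontr)
    assume "(\<integral>x. h N x \<partial>lborel) \<noteq> 0"
    moreover have "(\<integral>x. h N x \<partial>lborel) \<ge> 0" by (intro integral_nonneg_AE AE_I2 h_nonneg)
    ultimately obtain T where T: "(\<integral>x. h N x \<partial>lborel) = T" "T > 0" by simp
    \<comment> \<open>Chosen so that K <= 2 tau delta T. With exp(y) >= 1 + y this contradicts the
      bound, which would give (1 + 2 tau delta) T <= K.\<close>
    define \<tau> where "\<tau> = max \<tau>1 (K / (2 * \<delta> * T))"
    have "exp (2 * \<tau> * (\<rho>\<^sup>2 + 2) powr \<gamma>) = exp (2 * \<tau> * (\<rho>\<^sup>2 + 1) powr \<gamma>) * exp (2 * \<tau> * \<delta>)"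
      by (simp add: \<delta>_def algebra_simps flip: exp_add)
    with bound[of \<tau> N] T have "exp (2 * \<tau> * \<delta>) * T \<le> K"
      by (simp add: \<tau>_def mult.assoc)
    moreover have "(1 + 2 * \<tau> * \<delta>) * T \<le> exp (2 * \<tau> * \<delta>) * T"
      using T exp_ge_add_one_self[of "2 * \<tau> * \<delta>"] by (intro mult_right_mono) auto
    moreover have "K \<le> 2 * \<tau> * \<delta> * T"
    proof -
      have "K / (2 * \<delta> * T) \<le> \<tau>" by (simp add: \<tau>_def)
      then show ?thesis using \<open>\<delta> > 0\<close> T by (simp add: field_simps)
    qed
    ultimately show False using T by (simp add: distrib_right)
  qed
  then have "AE x in lborel. h (real N) x = 0" for N
    using integral_nonneg_eq_0_iff_AE[OF h_int[OF order_refl], of "real N"] h_nonneg by simp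
  then have "AE x in lborel. \<forall>N. h (real N) x = 0" by (simp add: AE_all_countable)
  then show ?thesis
  proof eventually_elim
    case (elim x)
    show ?case
    proof
      assume x: "\<rho>\<^sup>2 + 2 \<le> (norm x)\<^sup>2"
      obtain N where "(norm x)\<^sup>2 \<le> real N" using real_arch_simple by blast
      moreover have "0 < \<rho>\<^sup>2 + 2" by (simp add: add_nonneg_pos)
      then have "x \<noteq> 0" using x by auto
      ultimately show "\<psi> x = 0" using elim[rule_format, of N] x by (simp add: h_def)
    qed
  qed
qed

end

section \<open>From Dirac matrices to the Clifford setting\<close>

lemma norm_vector_scalar_mult: "norm (c *s u) = norm c * norm u" for c :: complex and u :: "complex^'m"
  by (simp add: norm_vec_def norm_mult L2_set_right_distrib)

text \<open>The Euclidean inner product on complex vectors is the real part of the Hermitian one, so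
  Hermitian matrices are symmetric for it.\<close>

lemma dirac_matrices_clifford:
  fixes \<alpha> :: "'n::finite option \<Rightarrow> complex^'m^'m"
  assumes "dirac_matrices \<alpha>"
  shows "clifford (\<lambda>j. (*v) (\<alpha> (Some j)))"
proof (rule clifford.intro)
  fix j k :: 'n and u v :: "complex^'m"
  show "linear ((*v) (\<alpha> (Some j)))"
    using matrix_vector_mul_bounded_linear by (rule bounded_linear.linear)
  have herm: "\<alpha> l $ a $ b = cnj (\<alpha> l $ b $ a)" for l a b
    using assms unfolding dirac_matrices_def by (elim conjE allE)
  have inner_eq: "x \<bullet> y = Re (x * cnj y)" for x y :: complex
    by (simp add: inner_complex_def)
  have "(\<alpha> (Some j) *v u) \<bullet> v = (\<Sum>a\<in>UNIV. \<Sum>b\<in>UNIV. Re (\<alpha> (Some j) $ a $ b * u $ b * cnj (v $ a)))"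
    by (simp only: inner_vec_def matrix_vector_mult_def inner_eq vec_lambda_beta sum_distrib_right Re_sum)
  also have "\<dots> = (\<Sum>b\<in>UNIV. \<Sum>a\<in>UNIV. Re (u $ b * cnj (\<alpha> (Some j) $ b $ a * v $ a)))"
  proof -
    have "\<alpha> (Some j) $ a $ b * u $ b * cnj (v $ a) = u $ b * cnj (\<alpha> (Some j) $ b $ a * v $ a)" for a b
      using herm[of "Some j" a b] by simp
    then show ?thesis by (subst sum.swap) (simp only:)
  qed
  also have "\<dots> = u \<bullet> (\<alpha> (Some j) *v v)"
    by (simp only: inner_vec_def matrix_vector_mult_def inner_eq vec_lambda_beta cnj_sum sum_distrib_left Re_sum)
  finally show "(\<alpha> (Some j) *v u) \<bullet> v = u \<bullet> (\<alpha> (Some j) *v v)" .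
  have "\<alpha> (Some j) ** \<alpha> (Some k) + \<alpha> (Some k) ** \<alpha> (Some j) = mat (if j = k then 2 else 0)"
    using assms unfolding dirac_matrices_def by (elim conjE allE[of _ "Some j"] allE[of _ "Some k"]) simp
  then have "\<alpha> (Some j) *v (\<alpha> (Some k) *v u) + \<alpha> (Some k) *v (\<alpha> (Some j) *v u) = mat (if j = k then 2 else 0) *v u"
    by (simp add: matrix_vector_mul_assoc flip: matrix_vector_mult_add_rdistrib)
  also have "\<dots> = (if j = k then 2 *\<^sub>R u else 0)"
  proof -
    have "mat c *v u = c *s u" for c :: complex
      by (simp add: vec_eq_iff matrix_vector_mult_def mat_def if_distrib[of "\<lambda>t. t * _"] cong: if_cong)
    then show ?thesis by (simp add: vec_eq_iff scaleR_conv_of_real)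
  qed
  finally show "\<alpha> (Some j) *v (\<alpha> (Some k) *v u) + \<alpha> (Some k) *v (\<alpha> (Some j) *v u) = (if j = k then 2 *\<^sub>R u else 0)" .
qed

theorem theorem1p1:
  fixes \<alpha> :: "'n::finite option \<Rightarrow> complex^'m^'m"
    and \<psi> :: "real^'n \<Rightarrow> complex^'m"
    and V :: "real^'n \<Rightarrow> complex^'m^'m"
    and \<epsilon> \<rho> C :: real
  assumes "CARD('n) \<ge> 2"
    and "CARD('m) = 2 ^ ((CARD('n) + 1) div 2)"
    and "dirac_matrices \<alpha>"
    and "V \<in> borel_measurable lebesgue"
    and "\<epsilon> < 1" and "\<rho> > 0" and "C > 0"
    and "\<And>x. norm x > \<rho> \<Longrightarrow> onorm ((*v) (V x)) \<le> C * norm x powr (- \<epsilon>)"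
    and "H1_loc \<psi>"
    and "AE x in lebesgue. dirac \<alpha> \<psi> x + V x *v \<psi> x = 0"
  shows "\<exists>\<tau>\<^sub>0>0.
           (\<forall>\<tau>>\<tau>\<^sub>0. L2_on {x. norm x > \<rho>}
                     (\<lambda>x. exp (\<tau> * norm x powr (2 - 2 * \<epsilon>)) *\<^sub>R \<psi> x))
           \<longrightarrow> compact (ess_support \<psi>)"
proof (intro exI[of _ 1] conjI impI)
  \<comment> \<open>Any positive witness would do: decay is assumed for all larger tau, so tau may
    be taken above the absorption threshold, which depends on C and epsilon, without building that
    threshold into \<open>\<tau>\<^sub>0\<close>.\<close>
  assume decay: "\<forall>\<tau>>1. L2_on {x. norm x > \<rho>} (\<lambda>x. exp (\<tau> * norm x powr (2 - 2 * \<epsilon>)) *\<^sub>R \<psi> x)"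
  interpret clifford "\<lambda>j. (*v) (\<alpha> (Some j))" using assms(3) by (rule dirac_matrices_clifford)
  define \<gamma> where "\<gamma> = 1 - \<epsilon>"
  have "\<gamma> > 0" using assms(5) by (simp add: \<gamma>_def)
  have wp: "has_weak_partial \<psi> j (weak_partial j \<psi>)" for j
  proof -
    have "\<exists>g. has_weak_partial \<psi> j g" using assms(9) by (simp only: H1_loc_def)
    then show ?thesis unfolding weak_partial_def by (rule someI_ex)
  qed
  obtain \<psi>' where \<psi>': "loc_L2 \<psi>'" and \<psi>_eq: "AE x in lebesgue. \<psi> x = \<psi>' x"
    using L2_loc_representative assms(9) unfolding H1_loc_def by blast
  have "\<exists>g'. loc_L2 g' \<and> (AE x in lebesgue. weak_partial j \<psi> x = g' x)" for j
    using L2_loc_representative wp[of j] unfolding has_weak_partial_def by metis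
  then obtain g where g: "\<And>j. loc_L2 (g j)" and g_eq: "\<And>j. AE x in lebesgue. weak_partial j \<psi> x = g j x"
    by metis
  have weak: "conv (\<eta> ((\<lambda>_. 0)(j := 1))) \<psi>' x = conv (\<eta> (\<lambda>_. 0)) (g j) x" if "mollifier \<eta> r" for \<eta> r j x
    by (rule mollifier.conv_weak_partial[OF that wp \<psi>' \<psi>_eq g g_eq])
  have "AE x in lebesgue. \<forall>j\<in>UNIV. weak_partial j \<psi> x = g j x"
    by (rule AE_finite_allI) (auto intro: g_eq)
  then have eqn: "AE x in lebesgue. norm x > \<rho> \<longrightarrow> norm (\<Sum>j\<in>UNIV. \<alpha> (Some j) *v g j x) \<le> C * norm x powr (\<gamma> - 1) * norm (\<psi>' x)"
    using assms(10) \<psi>_eq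
  proof eventually_elim
    case (elim x)
    show ?case
    proof
      assume x: "norm x > \<rho>"
      have "(- \<i>) *s (\<Sum>j\<in>UNIV. \<alpha> (Some j) *v g j x) = - (V x *v \<psi> x)"
        using elim by (simp add: dirac_def eq_neg_iff_add_eq_0)
      \<comment> \<open>The factor -i has modulus one, so passing to norms leaves the real operator
        P of the Clifford setting.\<close>
      then have "norm ((- \<i>) *s (\<Sum>j\<in>UNIV. \<alpha> (Some j) *v g j x)) = norm (V x *v \<psi> x)" by simp
      then have "norm (\<Sum>j\<in>UNIV. \<alpha> (Some j) *v g j x) = norm (V x *v \<psi> x)"
        by (simp only: norm_vector_scalar_mult) simp
      also have "\<dots> \<le> onorm ((*v) (V x)) * norm (\<psi> x)"
        by (rule onorm[OF matrix_vector_mul_bounded_linear])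
      also have "\<dots> \<le> C * norm x powr (- \<epsilon>) * norm (\<psi> x)"
        using assms(8)[OF x] by (intro mult_right_mono) auto
      finally show "norm (\<Sum>j\<in>UNIV. \<alpha> (Some j) *v g j x) \<le> C * norm x powr (\<gamma> - 1) * norm (\<psi>' x)"
        using elim by (simp add: \<gamma>_def)
    qed
  qed
  have [measurable]: "\<psi>' \<in> borel_measurable borel" using \<psi>' by (rule loc_L2_measurable)
  have dec: "integrable lborel (\<lambda>x. indicator {x. norm x > \<rho>} x * (exp (2 * \<tau> * (norm x)\<^sup>2 powr \<gamma>) * (norm (\<psi>' x))\<^sup>2))"
    if "\<tau> > 1" for \<tau>
  proof -
    have S: "{x :: real^'n. norm x > \<rho>} \<in> sets borel" by measurable
    have sq: "(norm (exp (\<tau> * norm x powr (2 - 2 * \<epsilon>)) *\<^sub>R u))\<^sup>2 = exp (2 * \<tau> * (norm x)\<^sup>2 powr \<gamma>) * (norm u)\<^sup>2"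
      for x :: "real^'n" and u :: "complex^'m"
    proof -
      \<comment> \<open>The exponent 2 - 2 epsilon in |x| is gamma in q = |x|^2; at the origin both
        powers have the value 0.\<close>
      have "(norm x)\<^sup>2 powr \<gamma> = norm x powr (2 - 2 * \<epsilon>)"
        by (cases "x = 0") (simp_all add: \<gamma>_def powr_powr algebra_simps flip: powr_numeral)
      then show ?thesis by (simp add: power_mult_distrib mult.assoc flip: exp_double)
    qed
    have "integrable (lebesgue_on {x. norm x > \<rho>}) (\<lambda>x. (norm (exp (\<tau> * norm x powr (2 - 2 * \<epsilon>)) *\<^sub>R \<psi> x))\<^sup>2)"
      using decay that unfolding L2_on_def by blast
    then have i: "integrable lebesgue (\<lambda>x. indicator {x. norm x > \<rho>} x *\<^sub>R (exp (2 * \<tau> * (norm x)\<^sup>2 powr \<gamma>) * (norm (\<psi> x))\<^sup>2))"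
      unfolding sq by (subst (asm) integrable_restrict_space) (use S in auto)
    have m: "(\<lambda>x. indicator {x. norm x > \<rho>} x * (exp (2 * \<tau> * (norm x)\<^sup>2 powr \<gamma>) * (norm (\<psi>' x))\<^sup>2)) \<in> borel_measurable lborel"
      by measurable
    have "integrable lebesgue (\<lambda>x. indicator {x. norm x > \<rho>} x * (exp (2 * \<tau> * (norm x)\<^sup>2 powr \<gamma>) * (norm (\<psi>' x))\<^sup>2))"
      by (rule integrable_cong_AE_imp[OF i measurable_completion[OF m]]) (use \<psi>_eq in auto)
    then show ?thesis by (simp add: integrable_completion[OF m])
  qed
  have "AE x in lborel. \<rho>\<^sup>2 + 2 \<le> (norm x)\<^sup>2 \<longrightarrow> \<psi>' x = 0"
    by (rule decay_imp_vanishing[OF \<psi>' g weak \<open>\<gamma> > 0\<close> \<open>\<rho> > 0\<close> eqn[unfolded AE_completion_iff] dec])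
  then have "AE x in lebesgue. \<rho>\<^sup>2 + 2 \<le> (norm x)\<^sup>2 \<longrightarrow> \<psi>' x = 0" by (rule AE_completion)
  \<comment> \<open>The inequality is made strict to obtain an open set, as the definition of the
    support requires.\<close>
  then have "AE x in lebesgue. x \<in> {x. \<rho>\<^sup>2 + 2 < (norm x)\<^sup>2} \<longrightarrow> \<psi> x = 0"
    using \<psi>_eq by eventually_elim auto
  moreover have "open {x :: real^'n. \<rho>\<^sup>2 + 2 < (norm x)\<^sup>2}"
    by (intro open_Collect_less continuous_intros)
  ultimately have "ess_support \<psi> \<subseteq> - {x. \<rho>\<^sup>2 + 2 < (norm x)\<^sup>2}"
    unfolding ess_support_def by blast
  also have "\<dots> \<subseteq> cball 0 (sqrt (\<rho>\<^sup>2 + 2))"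
  proof
    fix x :: "real^'n" assume "x \<in> - {x. \<rho>\<^sup>2 + 2 < (norm x)\<^sup>2}"
    then have "(norm x)\<^sup>2 \<le> \<rho>\<^sup>2 + 2" by simp
    then show "x \<in> cball 0 (sqrt (\<rho>\<^sup>2 + 2))" by (simp add: real_le_rsqrt)
  qed
  finally have "bounded (ess_support \<psi>)" using bounded_cball bounded_subset by blast
  moreover have "closed (ess_support \<psi>)"
    unfolding ess_support_def closed_def by (auto intro: open_Union)
  ultimately show "compact (ess_support \<psi>)" by (simp add: compact_eq_bounded_closed)
qed simp

end
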